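(* Let $d\ge 3$ be an integer and suppose that there is an integer $\rho(d)$ such that, for every prime power $q$, every maximal independent set of the Kneser graph $q\Gamma_{2d+1,\{d,d+1\}}$ contains a point-pencil, contains a dual point-pencil, or has at most $\rho(d)\cdot q^{d^2+d-2}$ elements. Put $\alpha=\max\{5,\rho(d)\}$. Let $q$ be a prime power with $q>3\cdot 112^{2^{d+1}-1}\cdot 2^{-d-1}$ and $q\ge\frac32\alpha^2+\frac{21}{2}\alpha+17$. Then $$\chi(q\Gamma_{2d+1,\{d,d+1\}})=\frac{q^{d+2}-1}{q-1}-q .$$ Moreover, let $V=GF(q)^{2d+1}$ be the underlying vector space. If $\mathcal F$ is a family of $\frac{q^{d+2}-1}{q-1}-q$ maximal independent sets of $q\Gamma_{2d+1,\{d,d+1\}}$ that cover the vertex set, then, up to duality, there exist a rank $d+2$ subspace $U$ of $V$ and an injective map $\mu$ from $\mathcal F$ to the set of rank $1$ subspaces of $U$ such that $F(\mu(C))\subseteq C$ for all $C\in\mathcal F$. Here "up to duality" means that either this holds, or the dual statement holds: there exist a rank $d-1$ subspace $U'$ of $V$ and an injective map $\mu$ from $\mathcal F$ to the set of rank $2d$ subspaces of $V$ containing $U'$ such that $F(\mu(C))\subseteq C$ for all $C\in\mathcal F$.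
   Context: Let $V$ be a vector space of finite rank (= vector space dimension) $n$ over $GF(q)$. A flag of $V$ is a set $f$ of non-trivial proper subspaces of $V$ such that $A\le B$ or $B\le A$ for all $A,B\in f$. Its vectorial type is the set $\{\mathrm{rank}(A)\mid A\in f\}$. Two flags $f_1,f_2$ are in general position if $U_1\cap U_2=\{0\}$ or $U_1+U_2=V$ for all $U_1\in f_1$, $U_2\in f_2$. For $J\subseteq\{1,\dots,n-1\}$ the $q$-Kneser graph $q\Gamma_{n,J}$ has as vertices all flags of vectorial type $J$ of $GF(q)^n$; two vertices are adjacent if they are in general position. An independent set is a set of pairwise non-adjacent vertices; maximal means maximal with respect to inclusion. $\chi$ denotes the chromatic number. Let $V=GF(q)^{2d+1}$. For a rank $1$ subspace $P$ of $V$, the point-pencil $F(P)$ is the set of all flags of vectorial type $\{d,d+1\}$ whose rank $d$ subspace contains $P$. For a rank $2d$ subspace $H$ of $V$, the dual point-pencil $F(H)$ is the set of all flags of vectorial type $\{d,d+1\}$ whose rank $d+1$ subspace is contained in $H$. *)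

theory Defs
  imports
    "HOL-Number_Theory.Prime_Powers"
    "Jordan_Normal_Form.Missing_VectorSpace"
    "Graph_Theory.Pair_Digraph"
begin

section \<open>Finite fields, coordinate spaces, ranks\<close>

text \<open>
  The statement quantifies over all prime powers \<open>q\<close> in a hypothesis, so \<open>GF(q)\<close> cannot be a
  type: it is a field in the sense of HOL-Algebra with \<open>q\<close> elements.  Every finite field is
  isomorphic to one whose carrier consists of natural numbers, so \<^typ>\<open>nat\<close> as the type of the
  elements is no restriction.
\<close>
definition is_GF :: "nat \<Rightarrow> nat ring \<Rightarrow> bool" where
  "is_GF q K \<longleftrightarrow> field K \<and> finite (carrier K) \<and> card (carrier K) = q"

text \<open>\<open>K\<^sup>n\<close>, realised as the space of functions \<open>{0,\<dots>,n-1} \<rightarrow> K\<close>.\<close>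
definition coord_space :: "'a ring \<Rightarrow> nat \<Rightarrow> ('a, nat \<Rightarrow> 'a) module" where
  "coord_space K n = ring.func_space K {..<n}"

definition rank :: "'a ring \<Rightarrow> ('a, 'v) module \<Rightarrow> 'v set \<Rightarrow> nat" where
  "rank K V A = vectorspace.dim K (V\<lparr>carrier := A\<rparr>)"

definition subspaces_of_rank :: "'a ring \<Rightarrow> ('a, 'v) module \<Rightarrow> nat \<Rightarrow> 'v set set" where
  "subspaces_of_rank K V r = {A. subspace K A V \<and> rank K V A = r}"

section \<open>Flags\<close>

definition is_flag :: "'a ring \<Rightarrow> ('a, 'v) module \<Rightarrow> 'v set set \<Rightarrow> bool" where
  "is_flag K V f \<longleftrightarrow>
     (\<forall>A\<in>f. subspace K A V \<and> A \<noteq> {\<zero>\<^bsub>V\<^esub>} \<and> A \<noteq> carrier V) \<and>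
     (\<forall>A\<in>f. \<forall>B\<in>f. A \<subseteq> B \<or> B \<subseteq> A)"

definition vectorial_type :: "'a ring \<Rightarrow> ('a, 'v) module \<Rightarrow> 'v set set \<Rightarrow> nat set" where
  "vectorial_type K V f = rank K V ` f"

definition flags :: "'a ring \<Rightarrow> ('a, 'v) module \<Rightarrow> nat set \<Rightarrow> 'v set set set" where
  "flags K V J = {f. is_flag K V f \<and> vectorial_type K V f = J}"

definition general_position :: "('a, 'v) module \<Rightarrow> 'v set set \<Rightarrow> 'v set set \<Rightarrow> bool" where
  "general_position V f1 f2 \<longleftrightarrow>
     (\<forall>U1\<in>f1. \<forall>U2\<in>f2.
        U1 \<inter> U2 = {\<zero>\<^bsub>V\<^esub>} \<or> module.submodule_sum V U1 U2 = carrier V)"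

section \<open>Graphs\<close>

text \<open>
  As in \<open>Graph_Theory\<close>, an undirected graph is a symmetric digraph.  The condition \<open>f1 \<noteq> f2\<close> only
  matters for \<open>J = {}\<close>: otherwise no flag of type \<open>J\<close> is in general position to itself.
\<close>
definition kneser_graph ::
    "'a ring \<Rightarrow> nat \<Rightarrow> nat set \<Rightarrow> (nat \<Rightarrow> 'a) set set pair_pre_digraph" where
  "kneser_graph K n J =
     \<lparr> pverts = flags K (coord_space K n) J,
       parcs = {(f1, f2). f1 \<in> flags K (coord_space K n) J \<and> f2 \<in> flags K (coord_space K n) J \<and>
                          f1 \<noteq> f2 \<and> general_position (coord_space K n) f1 f2} \<rparr>"

definition independent_set :: "'v pair_pre_digraph \<Rightarrow> 'v set \<Rightarrow> bool" where
  "independent_set G S \<longleftrightarrow> S \<subseteq> pverts G \<and> (\<forall>u\<in>S. \<forall>v\<in>S. (u, v) \<notin> parcs G)"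

definition maximal_independent_set :: "'v pair_pre_digraph \<Rightarrow> 'v set \<Rightarrow> bool" where
  "maximal_independent_set G S \<longleftrightarrow>
     independent_set G S \<and> (\<forall>T. independent_set G T \<and> S \<subseteq> T \<longrightarrow> T = S)"

definition proper_coloring :: "'v pair_pre_digraph \<Rightarrow> nat \<Rightarrow> ('v \<Rightarrow> nat) \<Rightarrow> bool" where
  "proper_coloring G k c \<longleftrightarrow> c ` pverts G \<subseteq> {..<k} \<and> (\<forall>(u, v)\<in>parcs G. c u \<noteq> c v)"

definition chromatic_number :: "'v pair_pre_digraph \<Rightarrow> nat" where
  "chromatic_number G = (LEAST k. \<exists>c. proper_coloring G k c)"

section \<open>Point-pencils and dual point-pencils in \<open>GF(q)\<close>-space of rank \<open>2d+1\<close>\<close>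

definition point_pencil ::
    "'a ring \<Rightarrow> nat \<Rightarrow> (nat \<Rightarrow> 'a) set \<Rightarrow> (nat \<Rightarrow> 'a) set set set" where
  "point_pencil K d P =
     {f \<in> flags K (coord_space K (2 * d + 1)) {d, d + 1}.
        \<exists>A\<in>f. rank K (coord_space K (2 * d + 1)) A = d \<and> P \<subseteq> A}"

definition dual_point_pencil ::
    "'a ring \<Rightarrow> nat \<Rightarrow> (nat \<Rightarrow> 'a) set \<Rightarrow> (nat \<Rightarrow> 'a) set set set" where
  "dual_point_pencil K d H =
     {f \<in> flags K (coord_space K (2 * d + 1)) {d, d + 1}.
        \<exists>B\<in>f. rank K (coord_space K (2 * d + 1)) B = d + 1 \<and> B \<subseteq> H}"

end

(*
  Flags of type {d, d+1} are pairs A < B; two of them are in general position iff A meets B' and A'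
  meets B trivially.  A colour class containing the pencil of P consists of that pencil and of few
  further flags, all with P in B.  So covering with about q^(d+1) classes wastes very little.
  Second moments show that points and hyperplanes cannot occur together in large numbers, whence, up
  to duality, almost all classes belong to points.  The variable X counting the points M of these
  classes in a random rank d subspace then has tiny E(X-1)^+, while E X(X-1) is close to 1; by
  Cauchy-Schwarz, lines through two points of M carry q - O(1) points of M on average, and M
  fills almost all of a subspace U of rank d+2.  If U has t holes, then at most t - q classes do not
  belong to points of U in M.  Flags meeting U in a hole Q and in a line l through Q must be covered by these
  classes, which are inefficient at it, or by a point of l, and each point serves only one line;
  counting lines through holes gives t <= q.  All this needs only a self-dual set of axioms of
  the subspace lattice, so the dual case comes for free.
*)
theory Submission
  imports Defs
begin

section \<open>Gaussian integers and binomials\<close>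

text \<open>Here and below [m] stands for \<open>qint q m\<close> and Q for \<open>q ^ d\<close>.
  All flags together amount to about q Q pencils, and [d+2] - q exceeds q Q by about Q, so a
  fraction 1/q of the cover may be waste. Plain counting therefore locates the points only up to an
  error of order Q, and an exact argument has to follow a stability argument. Stability works
  because a waste of 1/q forces the third moment of X up to about q, whereas triples that are not
  collinear contribute only a constant; a line has q + 1 points, so lines must be nearly full. The
  exact value comes from [d+2] = q [d+1] + 1: t holes give t [d+1] pairs of a hole and a line of U
  through it, while the q [d+1] + 1 - t remaining points of U serve one line each. A surplus t > q
  leaves about (t - q) [d+1] pairs to only t - q further classes, each of which handles far fewer
  than [d+1] pairs. Served lines with several holes blur this count when t is large, so small and
  large t need different estimates.\<close>

definition qint :: "nat \<Rightarrow> nat \<Rightarrow> real" where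
  "qint q m = (\<Sum>i<m. real q ^ i)"

fun qbin :: "nat \<Rightarrow> nat \<Rightarrow> nat \<Rightarrow> real" where
  "qbin q m 0 = 1"
| "qbin q m (Suc k) = qint q m * qbin q (m - 1) k / qint q (Suc k)"

lemma qint_0 [simp]: "qint q 0 = 0"
  by (simp add: qint_def)

lemma qint_Suc: "qint q (Suc m) = qint q m + real q ^ m"
  by (simp add: qint_def)

lemma qint_Suc': "qint q (Suc m) = 1 + real q * qint q m"
  by (simp add: qint_def sum.lessThan_Suc_shift sum_distrib_left del: sum.lessThan_Suc)

lemma qint_1 [simp]: "qint q (Suc 0) = 1"
  by (simp add: qint_def)

lemma qint_nonneg [simp]: "0 \<le> qint q m"
  by (simp add: qint_def sum_nonneg)

lemma qint_ge_power: "real q ^ m \<le> qint q (Suc m)"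
  by (simp add: qint_Suc)

lemma qint_pos: "0 < m \<Longrightarrow> 0 < qint q m"
  by (cases m) (simp_all add: qint_Suc' add_pos_nonneg)

lemma qint_mono: "m \<le> k \<Longrightarrow> qint q m \<le> qint q k"
  unfolding qint_def by (rule sum_mono2) auto

lemma qint_closed: "2 \<le> q \<Longrightarrow> qint q m * (real q - 1) = real q ^ m - 1"
  by (induction m) (simp_all add: qint_Suc algebra_simps)

lemma qint_le_2power: "2 \<le> q \<Longrightarrow> qint q (Suc m) \<le> 2 * real q ^ m"
proof (induction m)
  case (Suc m)
  have "qint q (Suc (Suc m)) = qint q (Suc m) + real q ^ Suc m"
    by (rule qint_Suc)
  moreover have "2 * real q ^ m \<le> real q * real q ^ m"
    using Suc.prems by (intro mult_right_mono) auto
  moreover have "qint q (Suc m) \<le> 2 * real q ^ m"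
    using Suc by simp
  ultimately show ?case
    by simp
qed simp

lemma qbin_pos: "k \<le> m \<Longrightarrow> 0 < qbin q m k"
  by (induction q m k rule: qbin.induct) (auto intro!: divide_pos_pos mult_pos_pos qint_pos)

lemma qbin_nonneg [simp]: "0 \<le> qbin q m k"
  by (induction q m k rule: qbin.induct) auto

lemma qbin_power_le:
  assumes "2 \<le> q" "k \<le> m"
  shows "real q ^ (k * (m - k)) \<le> qbin q m k"
  using assms
proof (induction q m k rule: qbin.induct)
  case (2 q m k)
  then obtain m' where m: "m = Suc m'"
    by (cases m) auto
  have le: "k \<le> m'"
    using 2 m by simp
  have "real q ^ (m' - k) * qint q (Suc k) \<le> qint q m"
  proof -
    have "real q ^ (m' - k) * qint q (Suc k) = (\<Sum>i<Suc k. real q ^ (m' - k + i))"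
      by (simp add: qint_def sum_distrib_left power_add del: sum.lessThan_Suc)
    also have "\<dots> = (\<Sum>i\<in>{m' - k..<Suc m'}. real q ^ i)"
      using le by (intro sum.reindex_bij_witness[of _ "\<lambda>i. i - (m' - k)" "\<lambda>i. m' - k + i"]) auto
    also have "\<dots> \<le> qint q m"
      unfolding qint_def m by (rule sum_mono2) auto
    finally show ?thesis .
  qed
  then have "real q ^ (m' - k) \<le> qint q m / qint q (Suc k)"
    by (simp add: pos_le_divide_eq qint_pos)
  moreover have "real q ^ (k * (m' - k)) \<le> qbin q m' k"
    using 2 m by simp
  ultimately have "real q ^ (m' - k) * real q ^ (k * (m' - k)) \<le> qint q m / qint q (Suc k) * qbin q m' k"
    by (intro mult_mono) auto
  then show ?case
    using m by (simp add: power_add[symmetric])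
qed simp

text \<open>The factorial form shows the symmetry of \<open>qbin\<close>, which the recursion
  hides.\<close>

fun qfact :: "nat \<Rightarrow> nat \<Rightarrow> real" where
  "qfact q 0 = 1"
| "qfact q (Suc m) = qint q (Suc m) * qfact q m"

lemma qfact_pos: "0 < qfact q m"
  by (induction m) (auto simp: qint_pos)

lemma qbin_qfact: "k \<le> m \<Longrightarrow> qbin q m k = qfact q m / (qfact q k * qfact q (m - k))"
proof (induction q m k rule: qbin.induct)
  case (1 q m)
  then show ?case
    using qfact_pos[of q m] by simp
next
  case (2 q m k)
  then obtain m' where "m = Suc m'"
    by (cases m) auto
  with 2 show ?case
    by simp
qed

lemma qbin_sym: "k \<le> m \<Longrightarrow> qbin q m (m - k) = qbin q m k"
  by (simp add: qbin_qfact mult.commute)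

section \<open>Ranked modular lattices of order \<open>q\<close>\<close>

text \<open>The subspace lattice of a vector space over \<open>GF(q)\<close> and its order dual are both instances,
  so each result proved here can be applied to hyperplanes as well as to points.\<close>

locale qlat =
  fixes L :: "'a set"
    and le :: "'a \<Rightarrow> 'a \<Rightarrow> bool" (infix "\<preceq>" 50)
    and mt :: "'a \<Rightarrow> 'a \<Rightarrow> 'a" (infixl "\<curlywedge>" 70)
    and jn :: "'a \<Rightarrow> 'a \<Rightarrow> 'a" (infixl "\<curlyvee>" 65)
    and bt tp :: 'a
    and rk :: "'a \<Rightarrow> nat"
    and q :: nat
  assumes fin: "finite L"
    and q2: "2 \<le> q"
    and le_refl [simp, intro]: "x \<in> L \<Longrightarrow> x \<preceq> x"
    and le_trans: "x \<preceq> y \<Longrightarrow> y \<preceq> z \<Longrightarrow> x \<in> L \<Longrightarrow> y \<in> L \<Longrightarrow> z \<in> L \<Longrightarrow> x \<preceq> z"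
    and mt_closed [simp, intro]: "x \<in> L \<Longrightarrow> y \<in> L \<Longrightarrow> x \<curlywedge> y \<in> L"
    and jn_closed [simp, intro]: "x \<in> L \<Longrightarrow> y \<in> L \<Longrightarrow> x \<curlyvee> y \<in> L"
    and mt1 [simp, intro]: "x \<in> L \<Longrightarrow> y \<in> L \<Longrightarrow> x \<curlywedge> y \<preceq> x"
    and mt2 [simp, intro]: "x \<in> L \<Longrightarrow> y \<in> L \<Longrightarrow> x \<curlywedge> y \<preceq> y"
    and mt_greatest: "z \<preceq> x \<Longrightarrow> z \<preceq> y \<Longrightarrow> x \<in> L \<Longrightarrow> y \<in> L \<Longrightarrow> z \<in> L \<Longrightarrow> z \<preceq> x \<curlywedge> y"
    and jn1 [simp, intro]: "x \<in> L \<Longrightarrow> y \<in> L \<Longrightarrow> x \<preceq> x \<curlyvee> y"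
    and jn2 [simp, intro]: "x \<in> L \<Longrightarrow> y \<in> L \<Longrightarrow> y \<preceq> x \<curlyvee> y"
    and jn_least: "x \<preceq> z \<Longrightarrow> y \<preceq> z \<Longrightarrow> x \<in> L \<Longrightarrow> y \<in> L \<Longrightarrow> z \<in> L \<Longrightarrow> x \<curlyvee> y \<preceq> z"
    and bt_closed [simp, intro]: "bt \<in> L"
    and tp_closed [simp, intro]: "tp \<in> L"
    and bt_le [simp, intro]: "x \<in> L \<Longrightarrow> bt \<preceq> x"
    and le_tp [simp, intro]: "x \<in> L \<Longrightarrow> x \<preceq> tp"
    and rk_bt [simp]: "rk bt = 0"
    and modular: "x \<in> L \<Longrightarrow> y \<in> L \<Longrightarrow> rk (x \<curlywedge> y) + rk (x \<curlyvee> y) = rk x + rk y"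
    and rk_strict: "x \<preceq> y \<Longrightarrow> x \<noteq> y \<Longrightarrow> x \<in> L \<Longrightarrow> y \<in> L \<Longrightarrow> rk x < rk y"
    and card_atoms: "x \<preceq> y \<Longrightarrow> x \<in> L \<Longrightarrow> y \<in> L \<Longrightarrow>
      card {z \<in> L. x \<preceq> z \<and> z \<preceq> y \<and> rk z = Suc (rk x)} = (\<Sum>i<rk y - rk x. q ^ i)"
begin

lemma rk_mono: "x \<preceq> y \<Longrightarrow> x \<in> L \<Longrightarrow> y \<in> L \<Longrightarrow> rk x \<le> rk y"
  using rk_strict[of x y] by (cases "x = y") auto

lemma rk_eqD: "x \<preceq> y \<Longrightarrow> rk y \<le> rk x \<Longrightarrow> x \<in> L \<Longrightarrow> y \<in> L \<Longrightarrow> x = y"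
  using rk_strict[of x y] by fastforce

lemma le_antisym: "x \<preceq> y \<Longrightarrow> y \<preceq> x \<Longrightarrow> x \<in> L \<Longrightarrow> y \<in> L \<Longrightarrow> x = y"
  using rk_mono[of y x] rk_eqD[of x y] by auto

lemma rk_le_tp: "x \<in> L \<Longrightarrow> rk x \<le> rk tp"
  by (simp add: rk_mono)

lemma rk_eq_0_iff: "x \<in> L \<Longrightarrow> rk x = 0 \<longleftrightarrow> x = bt"
  using rk_eqD[of bt x] by auto

lemma rk_eq_tp_iff: "x \<in> L \<Longrightarrow> rk x = rk tp \<longleftrightarrow> x = tp"
  using rk_eqD[of x tp] by auto

lemma mt_comm: "x \<in> L \<Longrightarrow> y \<in> L \<Longrightarrow> x \<curlywedge> y = y \<curlywedge> x"
  by (rule le_antisym) (auto intro: mt_greatest)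

lemma jn_comm: "x \<in> L \<Longrightarrow> y \<in> L \<Longrightarrow> x \<curlyvee> y = y \<curlyvee> x"
  by (rule le_antisym) (auto intro: jn_least)

lemma le_mt_iff: "x \<in> L \<Longrightarrow> y \<in> L \<Longrightarrow> z \<in> L \<Longrightarrow> z \<preceq> x \<curlywedge> y \<longleftrightarrow> z \<preceq> x \<and> z \<preceq> y"
  by (meson mt1 mt2 mt_closed le_trans mt_greatest)

lemma jn_le_iff: "x \<in> L \<Longrightarrow> y \<in> L \<Longrightarrow> z \<in> L \<Longrightarrow> x \<curlyvee> y \<preceq> z \<longleftrightarrow> x \<preceq> z \<and> y \<preceq> z"
  by (meson jn1 jn2 jn_closed le_trans jn_least)

lemma finite_sub [simp, intro]: "finite {z \<in> L. P z}"
  using fin by simp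

lemma le_bt_iff: "x \<in> L \<Longrightarrow> x \<preceq> bt \<longleftrightarrow> x = bt"
  using le_antisym[of x bt] by auto

lemma card_atoms_real:
  assumes "x \<preceq> y" "x \<in> L" "y \<in> L"
  shows "real (card {z \<in> L. x \<preceq> z \<and> z \<preceq> y \<and> rk z = Suc (rk x)}) = qint q (rk y - rk x)"
  using card_atoms[OF assms] by (simp add: qint_def)

text \<open>Double counting of pairs of a cover \<open>a\<close> of \<open>x\<close> and an element
  \<open>w\<close> above it: the interval from \<open>a\<close> to \<open>y\<close> is one rank
  shorter, which reproduces the recursion of \<open>qbin\<close>. All Gaussian binomials thus come
  from the axiom on covers.\<close>

theorem card_between:
  assumes "x \<preceq> y" "x \<in> L" "y \<in> L"
  shows "real (card {z \<in> L. x \<preceq> z \<and> z \<preceq> y \<and> rk z = rk x + k}) = qbin q (rk y - rk x) k"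
  using assms
proof (induction k arbitrary: x)
  case 0
  have "{z \<in> L. x \<preceq> z \<and> z \<preceq> y \<and> rk z = rk x + 0} = {x}"
    using 0 by (auto dest: rk_eqD)
  then show ?case by simp
next
  case (Suc k)
  define A where "A = {z \<in> L. x \<preceq> z \<and> z \<preceq> y \<and> rk z = Suc (rk x)}"
  define W where "W = {z \<in> L. x \<preceq> z \<and> z \<preceq> y \<and> rk z = rk x + Suc k}"
  have fin': "finite A" "finite W"
    unfolding A_def W_def by auto
  have "(\<Sum>a\<in>A. \<Sum>w\<in>W. of_bool (a \<preceq> w) :: real) = (\<Sum>w\<in>W. \<Sum>a\<in>A. of_bool (a \<preceq> w))"
    by (rule sum.swap)
  moreover have "(\<Sum>w\<in>W. of_bool (a \<preceq> w) :: real) = qbin q (rk y - rk x - 1) k" if a: "a \<in> A" for a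
  proof -
    have "W \<inter> {w. a \<preceq> w} = {z \<in> L. a \<preceq> z \<and> z \<preceq> y \<and> rk z = rk a + k}"
      using a Suc.prems le_trans[of x a] unfolding A_def W_def by auto
    then show ?thesis
      using Suc.IH[of a] a Suc.prems fin' unfolding A_def
      by (simp add: of_bool_def sum.If_cases)
  qed
  moreover have "(\<Sum>a\<in>A. of_bool (a \<preceq> w) :: real) = qint q (Suc k)" if w: "w \<in> W" for w
  proof -
    have "A \<inter> {a. a \<preceq> w} = {z \<in> L. x \<preceq> z \<and> z \<preceq> w \<and> rk z = Suc (rk x)}"
      using w Suc.prems le_trans[of _ w y] unfolding A_def W_def by auto
    then show ?thesis
      using card_atoms_real[of x w] w Suc.prems fin' unfolding W_def
      by (simp add: of_bool_def sum.If_cases)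
  qed
  moreover have "real (card A) = qint q (rk y - rk x)"
    unfolding A_def using Suc.prems by (rule card_atoms_real)
  ultimately have "qint q (rk y - rk x) * qbin q (rk y - rk x - 1) k = real (card W) * qint q (Suc k)"
    by simp
  then have "real (card W) = qbin q (rk y - rk x) (Suc k)"
    using qint_pos[of "Suc k" q] by (simp add: field_simps)
  then show ?case
    unfolding W_def .
qed

end

text \<open>The one axiom that is not visibly self-dual is the count of covers. Dually it counts
  coatoms of an interval, and these are as many as the atoms by \<open>card_between\<close> and the
  symmetry of \<open>qbin\<close>.\<close>

lemma (in qlat) dual: "qlat L (\<lambda>x y. y \<preceq> x) (\<curlyvee>) (\<curlywedge>) tp bt (\<lambda>x. rk tp - rk x) q"
proof
  fix x y assume xy: "x \<in> L" "y \<in> L"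
  show "rk tp - rk (x \<curlyvee> y) + (rk tp - rk (x \<curlywedge> y)) = rk tp - rk x + (rk tp - rk y)"
    using modular[OF xy] rk_le_tp[of x] rk_le_tp[of y] rk_le_tp[of "x \<curlyvee> y"] rk_le_tp[of "x \<curlywedge> y"] xy
    by simp
  assume le: "y \<preceq> x"
  show "rk tp - rk x < rk tp - rk y" if "x \<noteq> y"
    using rk_strict[OF le] that xy rk_le_tp[of x] by auto
  show "card {z \<in> L. z \<preceq> x \<and> y \<preceq> z \<and> rk tp - rk z = Suc (rk tp - rk x)} =
        (\<Sum>i<rk tp - rk y - (rk tp - rk x). q ^ i)" (is "card ?S = ?n")
  proof (cases "x = y")
    case True
    then have "?S = {}"
      using xy le_antisym[of x] by (auto dest: le_antisym)
    then show ?thesis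
      using True by simp
  next
    case False
    have lt: "rk y < rk x" "rk x \<le> rk tp"
      using False le xy rk_strict[of y x] rk_le_tp by auto
    have S: "?S = {z \<in> L. y \<preceq> z \<and> z \<preceq> x \<and> rk z = rk y + (rk x - rk y - 1)}" (is "_ = ?S'")
      using lt rk_le_tp by (auto simp: diff_eq_eq)
    have "real (card ?S) = qbin q (rk x - rk y) (rk x - rk y - 1)"
      unfolding S using le xy by (subst card_between) auto
    also have "\<dots> = qbin q (rk x - rk y) 1"
      using qbin_sym[of 1 "rk x - rk y" q] lt by simp
    also have "\<dots> = real ?n"
      using lt by (simp add: qint_def)
    finally show ?thesis
      by (rule of_nat_eq_iff[THEN iffD1])
  qed
qed (auto intro: le_trans mt_greatest jn_least fin q2)

lemma real_card_swap:
  assumes "finite A" "finite B"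
  shows "(\<Sum>a\<in>A. real (card {b \<in> B. R a b})) = (\<Sum>b\<in>B. real (card {a \<in> A. R a b}))"
proof -
  have "(\<Sum>a\<in>A. \<Sum>b\<in>B. of_bool (R a b) :: real) = (\<Sum>b\<in>B. \<Sum>a\<in>A. of_bool (R a b))"
    by (rule sum.swap)
  then show ?thesis
    using assms by (simp add: of_bool_def sum.If_cases Int_def)
qed

section \<open>Levels, points, lines and complements\<close>

context qlat
begin

definition lev :: "nat \<Rightarrow> 'a set" where
  "lev k = {x \<in> L. rk x = k}"

lemma levD [simp, dest]: "x \<in> lev k \<Longrightarrow> x \<in> L"
  and lev_rk [simp]: "x \<in> lev k \<Longrightarrow> rk x = k"
  by (auto simp: lev_def)

lemma levI [intro]: "x \<in> L \<Longrightarrow> rk x = k \<Longrightarrow> x \<in> lev k"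
  by (simp add: lev_def del: levD lev_rk)

lemma finite_lev [simp, intro]: "finite (lev k)"
  by (simp add: lev_def del: levD lev_rk)

lemma card_lev_between:
  assumes "x \<preceq> y" "x \<in> L" "y \<in> L" "rk x \<le> k"
  shows "real (card {z \<in> lev k. x \<preceq> z \<and> z \<preceq> y}) = qbin q (rk y - rk x) (k - rk x)"
  using card_between[OF assms(1-3), of "k - rk x"] assms(4)
  by (simp add: lev_def conj_commute conj_left_commute conj_assoc del: levD lev_rk)

lemma card_lev_above:
  assumes "x \<in> L" "rk x \<le> k"
  shows "real (card {z \<in> lev k. x \<preceq> z}) = qbin q (rk tp - rk x) (k - rk x)"
proof -
  have "{z \<in> lev k. x \<preceq> z} = {z \<in> lev k. x \<preceq> z \<and> z \<preceq> tp}"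
    by auto
  then show ?thesis
    using card_lev_between[of x tp k] assms by simp
qed

lemma card_lev_below:
  assumes "y \<in> L"
  shows "real (card {z \<in> lev k. z \<preceq> y}) = qbin q (rk y) k"
proof -
  have "{z \<in> lev k. z \<preceq> y} = {z \<in> lev k. bt \<preceq> z \<and> z \<preceq> y}"
    by auto
  then show ?thesis
    using card_lev_between[of bt y k] assms by simp
qed

lemma card_lev: "real (card (lev k)) = qbin q (rk tp) k"
proof -
  have "lev k = {z \<in> lev k. z \<preceq> tp}"
    by auto
  then show ?thesis
    using card_lev_below[of tp k] by simp
qed

lemma card_points_below:
  assumes "y \<in> L"
  shows "real (card {z \<in> lev 1. z \<preceq> y}) = qint q (rk y)"
  using card_lev_below[OF assms, of 1] by simp

lemma card_covers_between:
  assumes "x \<preceq> y" "x \<in> L" "y \<in> L" "k = Suc (rk x)"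
  shows "real (card {z \<in> lev k. x \<preceq> z \<and> z \<preceq> y}) = qint q (rk y - rk x)"
  using card_lev_between[OF assms(1-3), of k] assms(4) by simp

lemma card_coatoms_between:
  assumes "x \<preceq> y" "x \<in> L" "y \<in> L" "Suc k = rk y" "rk x \<le> k"
  shows "real (card {z \<in> lev k. x \<preceq> z \<and> z \<preceq> y}) = qint q (rk y - rk x)"
proof -
  have "qbin q (rk y - rk x) (k - rk x) = qbin q (rk y - rk x) 1"
  proof -
    have "k - rk x = rk y - rk x - 1" "1 \<le> rk y - rk x"
      using assms(4,5) by linarith+
    then show ?thesis
      using qbin_sym[of 1 "rk y - rk x" q] by simp
  qed
  then show ?thesis
    using card_lev_between[OF assms(1-3,5)] by simp
qed

text \<open>\<open>w \<curlywedge> y\<close> has smaller rank than \<open>y\<close>, so fewer covers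
  of \<open>x\<close> lie below it; a cover below \<open>y\<close> that is not counted there is not
  below \<open>w\<close>.\<close>

lemma ex_cover_not_le:
  assumes "x \<preceq> w" "x \<preceq> y" "x \<in> L" "w \<in> L" "y \<in> L" "\<not> y \<preceq> w"
  obtains z where "z \<in> L" "x \<preceq> z" "z \<preceq> y" "rk z = Suc (rk x)" "\<not> z \<preceq> w"
proof -
  let ?S = "\<lambda>y. {z \<in> lev (Suc (rk x)). x \<preceq> z \<and> z \<preceq> y}"
  have "rk (w \<curlywedge> y) < rk y"
    using rk_strict[of "w \<curlywedge> y" y] assms mt1[of w y] by fastforce
  moreover have "rk x \<le> rk (w \<curlywedge> y)"
    using assms by (intro rk_mono) (auto intro: mt_greatest)
  ultimately have "qint q (rk (w \<curlywedge> y) - rk x) < qint q (rk y - rk x)"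
  proof -
    assume a: "rk (w \<curlywedge> y) < rk y" "rk x \<le> rk (w \<curlywedge> y)"
    have "qint q (rk (w \<curlywedge> y) - rk x) < qint q (Suc (rk (w \<curlywedge> y) - rk x))"
      using q2 by (simp add: qint_Suc)
    also have "\<dots> \<le> qint q (rk y - rk x)"
      using a by (intro qint_mono) auto
    finally show ?thesis .
  qed
  then have "real (card (?S (w \<curlywedge> y))) < real (card (?S y))"
    using assms by (subst (1 2) card_covers_between) (auto intro: mt_greatest)
  then have "card (?S (w \<curlywedge> y)) < card (?S y)"
    by simp
  then have "\<not> ?S y \<subseteq> ?S (w \<curlywedge> y)"
    using card_mono[of "?S (w \<curlywedge> y)" "?S y"] by fastforce
  then obtain z where "z \<in> ?S y" "z \<notin> ?S (w \<curlywedge> y)"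
    by blast
  then show ?thesis
    using that[of z] assms by (auto intro: mt_greatest)
qed

lemma ex_point_not_le:
  assumes "w \<in> L" "y \<in> L" "\<not> y \<preceq> w"
  obtains z where "z \<in> lev 1" "z \<preceq> y" "\<not> z \<preceq> w"
  using ex_cover_not_le[of bt w y] assms by (auto simp: lev_def simp del: levD lev_rk)

lemma ex_point:
  assumes "y \<in> L" "0 < rk y"
  obtains z where "z \<in> lev 1" "z \<preceq> y"
proof -
  have "\<not> y \<preceq> bt"
    using assms le_bt_iff by fastforce
  then show thesis
    using ex_point_not_le[of bt y] assms(1) that by (metis bt_closed)
qed

lemma mt_mono:
  "x \<preceq> x' \<Longrightarrow> y \<preceq> y' \<Longrightarrow> x \<in> L \<Longrightarrow> x' \<in> L \<Longrightarrow> y \<in> L \<Longrightarrow> y' \<in> L \<Longrightarrow> x \<curlywedge> y \<preceq> x' \<curlywedge> y'"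
  by (rule mt_greatest) (auto intro: le_trans[of "x \<curlywedge> y" x x'] le_trans[of "x \<curlywedge> y" y y'])

lemma mt_bt_mono:
  "x \<preceq> x' \<Longrightarrow> x' \<curlywedge> y = bt \<Longrightarrow> x \<in> L \<Longrightarrow> x' \<in> L \<Longrightarrow> y \<in> L \<Longrightarrow> x \<curlywedge> y = bt"
  using mt_mono[of x x' y y] le_bt_iff[of "x \<curlywedge> y"] by simp

lemma point_mt:
  assumes "p \<in> lev 1" "x \<in> L" "\<not> p \<preceq> x"
  shows "p \<curlywedge> x = bt"
proof (rule ccontr)
  assume "p \<curlywedge> x \<noteq> bt"
  then have "rk (p \<curlywedge> x) \<noteq> 0"
    using assms by (simp add: rk_eq_0_iff)
  then have "p \<curlywedge> x = p"
    using rk_eqD[of "p \<curlywedge> x" p] assms by auto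
  then show False
    using assms mt2[of p x] by auto
qed

lemma rk_jn_point:
  assumes "p \<in> lev 1" "x \<in> L" "\<not> p \<preceq> x"
  shows "rk (x \<curlyvee> p) = Suc (rk x)"
  using modular[of p x] point_mt[OF assms] assms by (simp add: jn_comm)

lemma rk_line:
  assumes "p \<in> lev 1" "p' \<in> lev 1" "p \<noteq> p'"
  shows "rk (p \<curlyvee> p') = 2"
proof -
  have "\<not> p' \<preceq> p"
    using rk_eqD[of p' p] assms by auto
  then show ?thesis
    using rk_jn_point[of p' p] assms by simp
qed

lemma points_eq_line:
  assumes "p \<in> lev 1" "p' \<in> lev 1" "p \<noteq> p'" "l \<in> lev 2" "p \<preceq> l" "p' \<preceq> l"
  shows "l = p \<curlyvee> p'"
  using rk_eqD[of "p \<curlyvee> p'" l] rk_line[of p p'] assms by (auto intro: jn_least)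

text \<open>As long as \<open>x \<curlyvee> b\<close> is not the top, \<open>x\<close> is enlarged
  by a cover that is not below \<open>x \<curlyvee> b\<close>. The join with \<open>b\<close> then
  grows by at least as much as \<open>x\<close> does, so modularity keeps the meet with
  \<open>b\<close> trivial.\<close>

lemma ex_complement:
  assumes "x \<in> L" "b \<in> L" "x \<curlywedge> b = bt"
  obtains a where "a \<in> L" "x \<preceq> a" "a \<curlywedge> b = bt" "a \<curlyvee> b = tp"
proof -
  have "\<exists>a\<in>L. x \<preceq> a \<and> a \<curlywedge> b = bt \<and> a \<curlyvee> b = tp"
    using assms
  proof (induction "rk tp - rk (x \<curlyvee> b)" arbitrary: x rule: less_induct)
    case less
    show ?case
    proof (cases "x \<curlyvee> b = tp")
      case True
      then show ?thesis
        using less.prems by auto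
    next
      case False
      have "\<not> tp \<preceq> x \<curlyvee> b"
        using le_antisym[of tp "x \<curlyvee> b"] False less.prems by auto
      then obtain z where z: "z \<in> L" "x \<preceq> z" "rk z = Suc (rk x)" "\<not> z \<preceq> x \<curlyvee> b"
        using ex_cover_not_le[of x "x \<curlyvee> b" tp] less.prems by auto
      have "x \<curlyvee> b \<preceq> z \<curlyvee> b"
        using z less.prems by (meson jn1 jn2 jn_closed jn_least le_trans)
      moreover have "x \<curlyvee> b \<noteq> z \<curlyvee> b"
        using z less.prems by (metis jn1)
      ultimately have lt: "rk (x \<curlyvee> b) < rk (z \<curlyvee> b)"
        using z less.prems by (intro rk_strict) auto
      moreover have "rk (z \<curlywedge> b) = 0"
        using modular[of x b] modular[of z b] z less.prems lt by simp
      then have "z \<curlywedge> b = bt"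
        using z less.prems rk_eq_0_iff by simp
      moreover have "rk (z \<curlyvee> b) \<le> rk tp"
        using z less.prems by (simp add: rk_le_tp)
      ultimately have "\<exists>a\<in>L. z \<preceq> a \<and> a \<curlywedge> b = bt \<and> a \<curlyvee> b = tp"
        using less.hyps[of z] z(1) less.prems(2) by linarith
      then show ?thesis
        using z(1,2) less.prems(1) le_trans[of x z] by blast
    qed
  qed
  then show ?thesis
    using that by blast
qed

end

section \<open>Flags of type \<open>{d, d + 1}\<close>\<close>

text \<open>The bound \<open>q_big\<close> is a weak consequence of the lower bound on \<open>q\<close> in the theorem that absorbs
  all numerical constants below.\<close>

locale qflag = qlat +
  fixes d :: nat
  assumes d3: "3 \<le> d"
    and rk_tp [simp]: "rk tp = 2 * d + 1"
    and q_big: "10000000000000000 * (real d + 1)\<^sup>2 \<le> real q"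
begin

definition FL :: "('a \<times> 'a) set" where
  "FL = {(A, B). A \<in> lev d \<and> B \<in> lev (d + 1) \<and> A \<preceq> B}"

definition indep :: "('a \<times> 'a) set \<Rightarrow> bool" where
  "indep C \<longleftrightarrow> C \<subseteq> FL \<and>
     (\<forall>A B A' B'. (A, B) \<in> C \<longrightarrow> (A', B') \<in> C \<longrightarrow> A \<curlywedge> B' = bt \<longrightarrow> A' \<curlywedge> B \<noteq> bt)"

definition pencil :: "'a \<Rightarrow> ('a \<times> 'a) set" where
  "pencil P = {(A, B) \<in> FL. P \<preceq> A}"

definition dpencil :: "'a \<Rightarrow> ('a \<times> 'a) set" where
  "dpencil H = {(A, B) \<in> FL. B \<preceq> H}"

lemma finite_FL [simp, intro]: "finite FL"
  by (rule finite_subset[of _ "lev d \<times> lev (d + 1)"]) (auto simp: FL_def)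

lemma card_flags_by_B:
  "real (card {(A, B) \<in> FL. R A B}) =
     (\<Sum>B\<in>lev (d + 1). real (card {A \<in> lev d. A \<preceq> B \<and> R A B}))"
proof -
  have "{(A, B) \<in> FL. R A B} = prod.swap ` (SIGMA B:lev (d + 1). {A \<in> lev d. A \<preceq> B \<and> R A B})"
    by (auto simp: FL_def image_iff)
  then show ?thesis
    by (simp add: card_image)
qed

lemma card_flags_by_A:
  "real (card {(A, B) \<in> FL. R A B}) =
     (\<Sum>A\<in>lev d. real (card {B \<in> lev (d + 1). A \<preceq> B \<and> R A B}))"
proof -
  have "{(A, B) \<in> FL. R A B} = (SIGMA A:lev d. {B \<in> lev (d + 1). A \<preceq> B \<and> R A B})"
    by (auto simp: FL_def)
  then show ?thesis
    by simp
qed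

lemma card_flags_A:
  "real (card {(A, B) \<in> FL. R A}) = real (card {A \<in> lev d. R A}) * qint q (d + 1)"
proof -
  have "real (card {B \<in> lev (d + 1). A \<preceq> B \<and> R A}) = (if R A then qint q (d + 1) else 0)"
    if "A \<in> lev d" for A
    using card_lev_above[of A "d + 1"] that by simp
  then show ?thesis
    by (simp add: card_flags_by_A sum.If_cases Int_def)
qed

lemma card_flags_B_le:
  "real (card {(A, B) \<in> FL. R B}) = real (card {B \<in> lev (d + 1). R B}) * qint q (d + 1)"
proof -
  have "real (card {A \<in> lev d. A \<preceq> B \<and> R B}) = (if R B then qint q (d + 1) else 0)"
    if "B \<in> lev (d + 1)" for B
    using card_lev_below[of B d] qbin_sym[of 1 "Suc d" q] that by simp
  then show ?thesis
    by (simp add: card_flags_by_B sum.If_cases Int_def)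
qed

lemma card_flags_point_B:
  assumes "Q \<in> lev 1"
  shows "real (card {(A, B) \<in> FL. Q \<preceq> A \<and> R B}) =
           real (card {B \<in> lev (d + 1). Q \<preceq> B \<and> R B}) * qint q d"
proof -
  have "real (card {A \<in> lev d. A \<preceq> B \<and> Q \<preceq> A \<and> R B}) = (if Q \<preceq> B \<and> R B then qint q d else 0)"
    if B: "B \<in> lev (d + 1)" for B
  proof (cases "Q \<preceq> B \<and> R B")
    case True
    then have "{A \<in> lev d. A \<preceq> B \<and> Q \<preceq> A \<and> R B} = {A \<in> lev d. Q \<preceq> A \<and> A \<preceq> B}"
      by auto
    then show ?thesis
      using card_coatoms_between[of Q B d] assms B True d3 by simp
  next
    case False
    then have e: "{A \<in> lev d. A \<preceq> B \<and> Q \<preceq> A \<and> R B} = {}"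
      using le_trans[of Q _ B] assms B by auto
    show ?thesis
      unfolding e using False by auto
  qed
  then show ?thesis
    by (simp add: card_flags_by_B sum.If_cases Int_def)
qed

lemma indepD:
  "indep C \<Longrightarrow> (A, B) \<in> C \<Longrightarrow> (A', B') \<in> C \<Longrightarrow> A \<curlywedge> B' = bt \<Longrightarrow> A' \<curlywedge> B = bt \<Longrightarrow> False"
  unfolding indep_def by blast

lemma indep_FL: "indep C \<Longrightarrow> C \<subseteq> FL"
  by (simp add: indep_def)

text \<open>A flag whose large member misses \<open>P\<close> is in general position to some flag of the pencil.\<close>
lemma indep_pencil_le:
  assumes C: "indep C" "pencil P \<subseteq> C" and P: "P \<in> lev 1" and AB: "(A, B) \<in> C"
  shows "P \<preceq> B"
proof (rule ccontr)
  assume nle: "\<not> P \<preceq> B"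
  have A: "A \<in> lev d" and B: "B \<in> lev (d + 1)" and le: "A \<preceq> B"
    using AB indep_FL[OF C(1)] by (auto simp: FL_def)
  obtain A' where A': "A' \<in> L" "P \<preceq> A'" "A' \<curlywedge> B = bt" "A' \<curlyvee> B = tp"
    using ex_complement[of P B] point_mt[of P B] P B nle by auto
  have rA': "rk A' = d"
    using modular[of A' B] A' B by simp
  have "A \<curlywedge> A' = bt"
    using mt_bt_mono[of A B A'] A' A B le by (simp add: mt_comm)
  moreover have "A' \<curlywedge> A = A \<curlywedge> A'"
    using A A' by (simp add: mt_comm)
  ultimately obtain X where X: "X \<in> L" "A' \<preceq> X" "X \<curlywedge> A = bt" "X \<curlyvee> A = tp"
    using ex_complement[of A' A] A A' by auto
  have rX: "rk X = d + 1"
    using modular[of X A] X A by simp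
  have "(A', X) \<in> C"
    using C(2) A' X rA' rX by (auto simp: pencil_def FL_def lev_def simp del: levD lev_rk)
  then show False
    using indepD[OF C(1) AB, of A' X] X A' A by (simp add: mt_comm)
qed

text \<open>Both large members contain \<open>P\<close>. If they shared nothing more,
  \<open>A \<curlywedge> B'\<close> and \<open>A' \<curlywedge> B\<close> would lie below
  \<open>P\<close> without containing it, hence be trivial, and the two flags would be in general
  position.\<close>

lemma indep_pencil_mt:
  assumes C: "indep C" "pencil P \<subseteq> C" and P: "P \<in> lev 1"
    and AB: "(A, B) \<in> C" "\<not> P \<preceq> A" and AB': "(A', B') \<in> C" "\<not> P \<preceq> A'"
  shows "2 \<le> rk (B \<curlywedge> B')"
proof (rule ccontr)
  assume less: "\<not> 2 \<le> rk (B \<curlywedge> B')"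
  have A: "A \<in> lev d" "B \<in> lev (d + 1)" "A \<preceq> B" and A': "A' \<in> lev d" "B' \<in> lev (d + 1)" "A' \<preceq> B'"
    using AB AB' indep_FL[OF C(1)] by (auto simp: FL_def)
  have PB: "P \<preceq> B" "P \<preceq> B'"
    using indep_pencil_le[OF C P] AB AB' by auto
  have "P \<preceq> B \<curlywedge> B'"
    using PB A A' P by (auto intro: mt_greatest)
  then have eq: "B \<curlywedge> B' = P"
    using less P A A' rk_eqD[of P "B \<curlywedge> B'"] by simp
  have "A \<curlywedge> B' \<preceq> P" "A' \<curlywedge> B \<preceq> P"
    unfolding eq[symmetric] using A A'
    by (auto intro!: mt_greatest intro: le_trans[of "A \<curlywedge> B'" A B] le_trans[of "A' \<curlywedge> B" A' B'])
  moreover have "\<not> P \<preceq> A \<curlywedge> B'" "\<not> P \<preceq> A' \<curlywedge> B"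
    using AB(2) AB'(2) A A' P by (auto simp: le_mt_iff)
  ultimately have "rk (A \<curlywedge> B') = 0" "rk (A' \<curlywedge> B) = 0"
    using rk_strict[of "A \<curlywedge> B'" P] rk_strict[of "A' \<curlywedge> B" P] A A' P by auto
  then show False
    using indepD[OF C(1) AB(1) AB'(1)] A A' by (simp add: rk_eq_0_iff)
qed

end

lemma qint_power_mult_le: "real q ^ j * qint q m \<le> qint q (m + j)"
proof -
  have "real q ^ j * qint q m = (\<Sum>i<m. real q ^ (i + j))"
    by (simp add: qint_def sum_distrib_left power_add mult.commute)
  also have "\<dots> = (\<Sum>i\<in>{j..<m + j}. real q ^ i)"
    by (intro sum.reindex_bij_witness[of _ "\<lambda>i. i - j" "\<lambda>i. i + j"]) auto
  also have "\<dots> \<le> qint q (m + j)"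
    unfolding qint_def by (rule sum_mono2) auto
  finally show ?thesis .
qed

lemma card_UN_le_mult:
  assumes "finite I" "\<And>i. i \<in> I \<Longrightarrow> real (card (S i)) \<le> c"
  shows "real (card (\<Union>i\<in>I. S i)) \<le> real (card I) * c"
proof -
  have "real (card (\<Union>i\<in>I. S i)) \<le> real (\<Sum>i\<in>I. card (S i))"
    using assms(1) card_UN_le of_nat_mono by blast
  also have "\<dots> \<le> (\<Sum>i\<in>I. c)"
    unfolding of_nat_sum using assms(2) by (rule sum_mono)
  finally show ?thesis
    by simp
qed

context qlat
begin

lemma q_pos [simp]: "0 < real q" "1 \<le> real q" "2 \<le> real q"
  using q2 by auto

lemma q_pos_nat [simp]: "0 < q" "q \<noteq> 0" "Suc 0 \<le> q" "Suc 0 < q"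
  using q2 by auto

declare q2 [simp]

lemma ex_line_below:
  assumes "p \<in> lev 1" "x \<in> L" "p \<preceq> x" "2 \<le> rk x"
  obtains g where "g \<in> lev 2" "p \<preceq> g" "g \<preceq> x"
proof -
  have "\<not> x \<preceq> p"
    using rk_mono[of x p] assms by auto
  then obtain g where "g \<in> L" "p \<preceq> g" "g \<preceq> x" "rk g = Suc (rk p)"
    using ex_cover_not_le[of p p x] assms by auto
  then show thesis
    using that[OF levI] assms(1) by auto
qed

lemma rk_jn_line:
  assumes "p \<in> lev 1" "l \<in> lev 2" "p \<preceq> l" "x \<in> L" "p \<preceq> x" "\<not> l \<preceq> x"
  shows "rk (x \<curlyvee> l) = Suc (rk x)"
proof -
  have "rk (x \<curlywedge> l) < 2"
    using rk_strict[of "x \<curlywedge> l" l] mt1[of x l] assms by fastforce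
  moreover have "1 \<le> rk (x \<curlywedge> l)"
    using rk_mono[of p "x \<curlywedge> l"] mt_greatest[of p x l] assms by simp
  ultimately show ?thesis
    using modular[of x l] assms by simp
qed

lemma jn_eqI:
  assumes "x \<preceq> z" "y \<preceq> z" "x \<in> L" "y \<in> L" "z \<in> L" "rk z \<le> rk (x \<curlyvee> y)"
  shows "x \<curlyvee> y = z"
  using assms by (intro rk_eqD) (auto intro: jn_least)

lemma jn_mono:
  "x \<preceq> x' \<Longrightarrow> y \<preceq> y' \<Longrightarrow> x \<in> L \<Longrightarrow> x' \<in> L \<Longrightarrow> y \<in> L \<Longrightarrow> y' \<in> L \<Longrightarrow> x \<curlyvee> y \<preceq> x' \<curlyvee> y'"
  by (rule jn_least) (auto intro: le_trans[of x x' "x' \<curlyvee> y'"] le_trans[of y y' "x' \<curlyvee> y'"])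

end

section \<open>The size of a class beyond its pencil\<close>

context qflag
begin

lemma d_Suc: obtains m where "d = Suc (Suc (Suc m))"
  by (rule that[of "d - 3"]) (use d3 in simp)

text \<open>This counts the large members above a given line, see
  \<open>card_big_above_line\<close>; it is the unit for all counts of large members.\<close>

definition G :: real where "G = qbin q (2 * d - 1) (d - 1)"

definition fl :: real where "fl = G * qint q (2 * d)"

lemma G_pos: "0 < G"
  using d3 by (simp add: G_def qbin_pos)

lemma fl_pos: "0 < fl"
  using d3 by (simp add: fl_def G_pos qint_pos)

lemma G_ge: "real q ^ (d * (d - 1)) \<le> G"
proof -
  have "2 * d - 1 - (d - 1) = d"
    using d3 by simp
  then show ?thesis
    using qbin_power_le[of q "d - 1" "2 * d - 1"] q2 d3 by (simp add: G_def mult.commute)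
qed

lemma qbin_2d_d: "qbin q (2 * d) d * qint q d = fl"
proof -
  obtain m where m: "d = Suc (Suc (Suc m))"
    by (rule d_Suc)
  show ?thesis
    using qint_pos[of d q] unfolding fl_def G_def unfolding m by simp
qed

lemma card_pencil:
  assumes "P \<in> lev 1"
  shows "real (card (pencil P)) = fl"
proof -
  have "real (card {B \<in> lev (d + 1). P \<preceq> B}) = qbin q (2 * d) d"
    using card_lev_above[of P "d + 1"] assms by simp
  then show ?thesis
    using card_flags_point_B[OF assms, of "\<lambda>_. True"] qbin_2d_d by (simp add: pencil_def)
qed

lemma card_big_above_line:
  assumes "l \<in> lev 2"
  shows "real (card {B \<in> lev (d + 1). l \<preceq> B}) = G"
  using card_lev_above[of l "d + 1"] assms d3 by (simp add: G_def)

text \<open>Each further rank that is prescribed below a large member costs a factor q^d, here from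
  a line to a plane and in \<open>card_big_above_solid\<close> once more.\<close>

lemma card_big_above_plane:
  assumes "e \<in> lev 3"
  shows "real (card {B \<in> lev (d + 1). e \<preceq> B}) \<le> G / real q ^ d"
proof -
  obtain m where m: "d = Suc (Suc (Suc m))"
    by (rule d_Suc)
  have eq: "real (card {B \<in> lev (d + 1). e \<preceq> B}) = qbin q (2 * d - 2) (d - 2)"
    using card_lev_above[of e "d + 1"] assms d3 by simp
  have G: "G = qint q (2 * d - 1) * qbin q (2 * d - 2) (d - 2) / qint q (d - 1)"
    unfolding G_def unfolding m by simp
  have "real q ^ d * qint q (d - 1) \<le> qint q (2 * d - 1)"
    using qint_power_mult_le[of q d "d - 1"] d3 by (simp add: mult_2)
  then have "real q ^ d * qint q (d - 1) * qbin q (2 * d - 2) (d - 2) \<le> qint q (2 * d - 1) * qbin q (2 * d - 2) (d - 2)"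
    by (rule mult_right_mono) simp
  then show ?thesis
    unfolding eq G using qint_pos[of "d - 1" q] d3 by (simp add: field_simps)
qed

lemma card_big_above_solid:
  assumes "e \<in> lev 4"
  shows "real (card {B \<in> lev (d + 1). e \<preceq> B}) \<le> G / real q ^ (2 * d)"
proof -
  obtain m where m: "d = Suc (Suc (Suc m))"
    by (rule d_Suc)
  have eq: "real (card {B \<in> lev (d + 1). e \<preceq> B}) = qbin q (2 * d - 3) (d - 3)"
    using card_lev_above[of e "d + 1"] assms d3 by simp
  have G: "G = qint q (2 * d - 1) * (qint q (2 * d - 2) * qbin q (2 * d - 3) (d - 3) / qint q (d - 2)) / qint q (d - 1)"
    unfolding G_def unfolding m by simp
  have "real q ^ d * qint q (d - 1) \<le> qint q (2 * d - 1)" "real q ^ d * qint q (d - 2) \<le> qint q (2 * d - 2)"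
    using qint_power_mult_le[of q d "d - 1"] qint_power_mult_le[of q d "d - 2"] d3 by (simp_all add: mult_2)
  then have "(real q ^ d * qint q (d - 1)) * (real q ^ d * qint q (d - 2)) \<le> qint q (2 * d - 1) * qint q (2 * d - 2)"
    by (rule mult_mono) auto
  then have "(real q ^ d * qint q (d - 1)) * (real q ^ d * qint q (d - 2)) * qbin q (2 * d - 3) (d - 3)
      \<le> qint q (2 * d - 1) * qint q (2 * d - 2) * qbin q (2 * d - 3) (d - 3)"
    by (rule mult_right_mono) simp
  moreover have p: "real q ^ (2 * d) = real q ^ d * real q ^ d"
    by (simp add: mult_2 power_add)
  ultimately show ?thesis
    unfolding eq G p using qint_pos[of "d - 1" q] qint_pos[of "d - 2" q] d3
    by (simp add: field_simps)
qed

text \<open>A Hilton--Milner type dichotomy in the quotient by \<open>P\<close>.  In the second alternative the members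
  that do not contain \<open>l\<close> all lie in one element of rank \<open>d + 2\<close>.\<close>
lemma intersecting_dichotomy:
  assumes BB: "BB \<subseteq> lev (d + 1)" "\<And>B. B \<in> BB \<Longrightarrow> P \<preceq> B"
      "\<And>B B'. B \<in> BB \<Longrightarrow> B' \<in> BB \<Longrightarrow> 2 \<le> rk (B \<curlywedge> B')"
    and P: "P \<in> lev 1" and l: "l \<in> lev 2" "P \<preceq> l"
  shows "real (card {B \<in> BB. l \<preceq> B}) \<le> 6 * G / (real q)\<^sup>2 \<or>
         real (card {B \<in> BB. \<not> l \<preceq> B}) \<le> qint q (d + 1)"
proof (cases "\<exists>B1\<in>BB. \<exists>B2\<in>BB. \<not> l \<preceq> B1 \<and> \<not> l \<preceq> B2 \<and> \<not> B2 \<preceq> B1 \<curlyvee> l")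
  case True
  then obtain B1 B2 where B12: "B1 \<in> BB" "B2 \<in> BB" "\<not> l \<preceq> B1" "\<not> l \<preceq> B2" "\<not> B2 \<preceq> B1 \<curlyvee> l"
    by blast
  have lev12: "B1 \<in> lev (d + 1)" "B2 \<in> lev (d + 1)" "P \<preceq> B1" "P \<preceq> B2"
    using B12 BB by auto
  have rk12: "rk (B1 \<curlyvee> l) = d + 2" "rk (B2 \<curlyvee> l) = d + 2"
    using rk_jn_line[OF P l] B12 lev12 by auto
  define W where "W = B1 \<curlywedge> (B2 \<curlyvee> l)"
  have "\<not> B1 \<preceq> B2 \<curlyvee> l"
  proof
    assume "B1 \<preceq> B2 \<curlyvee> l"
    then have "B1 \<curlyvee> l = B2 \<curlyvee> l"
      using lev12 l rk12 by (intro jn_eqI) auto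
    then show False
      using B12(5) lev12 l jn1[of B2 l] by simp
  qed
  then have W: "rk W \<le> d" "W \<in> L" "P \<preceq> W"
    using rk_strict[of W B1] mt2[of B1 "B2 \<curlyvee> l"] lev12 l P le_trans[of P l "B2 \<curlyvee> l"]
    unfolding W_def by (fastforce intro: mt_greatest)+
  define G1 where "G1 = {g \<in> lev 2. P \<preceq> g \<and> g \<preceq> B1}"
  define G2 where "G2 = {g \<in> lev 2. P \<preceq> g \<and> g \<preceq> B2}"
  define GW where "GW = {g \<in> lev 2. P \<preceq> g \<and> g \<preceq> W}"
  have fin': "finite G1" "finite G2" "finite GW"
    unfolding G1_def G2_def GW_def by auto
  have cards: "real (card G1) = qint q d" "real (card G2) = qint q d" "real (card GW) \<le> qint q (d - 1)"
    using card_covers_between[of P B1 2] card_covers_between[of P B2 2] card_covers_between[of P W 2]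
      P lev12 W qint_mono[of "rk W - 1" "d - 1" q] unfolding G1_def G2_def GW_def by auto
  \<comment> \<open>A member through \<open>l\<close> contains a line \<open>g\<close> of
    \<open>B1\<close> and a line \<open>g'\<close> of \<open>B2\<close>, both through
    \<open>P\<close>. Either \<open>g\<close> lies in \<open>W\<close>, and the plane
    \<open>g \<curlyvee> l\<close> is prescribed, or \<open>g\<close>, \<open>g'\<close> and
    \<open>l\<close> span an element of rank 4.\<close>
  define S3 where "S3 = (\<Union>g\<in>GW - {l}. {B \<in> lev (d + 1). g \<curlyvee> l \<preceq> B})"
  define S4 where "S4 = (\<Union>g\<in>G1 - {l}. \<Union>g'\<in>{g' \<in> G2. \<not> g' \<preceq> g \<curlyvee> l}. {B \<in> lev (d + 1). g \<curlyvee> l \<curlyvee> g' \<preceq> B})"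
  have rk3: "rk (g \<curlyvee> l) = 3" if "g \<in> lev 2" "P \<preceq> g" "g \<noteq> l" for g
    using rk_jn_line[OF P l, of g] rk_eqD[of l g] that l by auto
  have sub: "{B \<in> BB. l \<preceq> B} \<subseteq> S3 \<union> S4"
  proof
    fix B assume "B \<in> {B \<in> BB. l \<preceq> B}"
    then have B: "B \<in> BB" "l \<preceq> B" "B \<in> lev (d + 1)" "P \<preceq> B"
      using BB by auto
    have "P \<preceq> B \<curlywedge> B1" "P \<preceq> B \<curlywedge> B2"
      using B lev12 P by (auto intro: mt_greatest)
    then obtain g g' where g: "g \<in> lev 2" "P \<preceq> g" "g \<preceq> B \<curlywedge> B1" and g': "g' \<in> lev 2" "P \<preceq> g'" "g' \<preceq> B \<curlywedge> B2"
      using ex_line_below[of P "B \<curlywedge> B1"] ex_line_below[of P "B \<curlywedge> B2"] BB(3) B(1) B12(1,2) P B(3) lev12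
      by (metis levD mt_closed)
    have gB: "g \<preceq> B" "g \<preceq> B1" "g' \<preceq> B" "g' \<preceq> B2"
      using g g' B lev12 by (auto simp: le_mt_iff)
    have ne: "g \<noteq> l"
      using gB B12 by auto
    show "B \<in> S3 \<union> S4"
    proof (cases "g \<preceq> B2 \<curlyvee> l")
      case True
      then have "g \<preceq> W"
        unfolding W_def using gB g lev12 l by (auto intro: mt_greatest)
      then have "g \<in> GW - {l}"
        using g ne by (auto simp: GW_def)
      moreover have "g \<curlyvee> l \<preceq> B"
        using g l B gB by (auto intro: jn_least)
      ultimately show ?thesis
        unfolding S3_def using B by auto
    next
      case False
      have "\<not> g' \<preceq> g \<curlyvee> l"
      proof
        assume a: "g' \<preceq> g \<curlyvee> l"
        have "g' \<noteq> l"
          using gB B12 by auto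
        then have "g' \<curlyvee> l = g \<curlyvee> l"
          using a g g' l ne rk3 by (intro jn_eqI) auto
        then have "g \<preceq> g' \<curlyvee> l"
          using g l by (metis jn1 levD)
        moreover have "g' \<curlyvee> l \<preceq> B2 \<curlyvee> l"
          using g' l lev12 gB by (intro jn_mono) auto
        ultimately show False
          using False g g' l lev12 le_trans[of g "g' \<curlyvee> l" "B2 \<curlyvee> l"] by auto
      qed
      moreover have "g \<curlyvee> l \<curlyvee> g' \<preceq> B"
        using g g' l B gB by (auto intro!: jn_least)
      moreover have "g \<in> G1 - {l}" "g' \<in> G2"
        using g g' ne gB by (auto simp: G1_def G2_def)
      ultimately show ?thesis
        unfolding S4_def using B by auto
    qed
  qed
  have c3: "real (card S3) \<le> qint q (d - 1) * (G / real q ^ d)"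
  proof -
    have "real (card {B \<in> lev (d + 1). g \<curlyvee> l \<preceq> B}) \<le> G / real q ^ d" if "g \<in> GW - {l}" for g
      using that rk3[of g] l by (intro card_big_above_plane levI) (auto simp: GW_def)
    then have "real (card S3) \<le> real (card (GW - {l})) * (G / real q ^ d)"
      unfolding S3_def using fin' by (intro card_UN_le_mult) auto
    also have "\<dots> \<le> qint q (d - 1) * (G / real q ^ d)"
    proof -
      have "real (card (GW - {l})) \<le> qint q (d - 1)"
        using cards(3) card_mono[of GW "GW - {l}"] fin' by force
      then show ?thesis
        using G_pos by (intro mult_right_mono) auto
    qed
    finally show ?thesis .
  qed
  have c4: "real (card S4) \<le> qint q d * (qint q d * (G / real q ^ (2 * d)))"
  proof -
    have i: "real (card (\<Union>g'\<in>{g' \<in> G2. \<not> g' \<preceq> g \<curlyvee> l}. {B \<in> lev (d + 1). g \<curlyvee> l \<curlyvee> g' \<preceq> B}))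
        \<le> qint q d * (G / real q ^ (2 * d))" if g: "g \<in> G1 - {l}" for g
    proof -
      have "real (card {B \<in> lev (d + 1). g \<curlyvee> l \<curlyvee> g' \<preceq> B}) \<le> G / real q ^ (2 * d)"
        if "g' \<in> {g' \<in> G2. \<not> g' \<preceq> g \<curlyvee> l}" for g'
      proof -
        have "P \<preceq> g \<curlyvee> l"
          using g l P le_trans[of P l "g \<curlyvee> l"] by (auto simp: G1_def)
        then have "rk (g \<curlyvee> l \<curlyvee> g') = 4"
          using rk_jn_line[of P g' "g \<curlyvee> l"] that g l P rk3[of g] by (auto simp: G1_def G2_def)
        then show ?thesis
          using that g l by (intro card_big_above_solid levI) (auto simp: G1_def G2_def)
      qed
      then have "real (card (\<Union>g'\<in>{g' \<in> G2. \<not> g' \<preceq> g \<curlyvee> l}. {B \<in> lev (d + 1). g \<curlyvee> l \<curlyvee> g' \<preceq> B}))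
        \<le> real (card {g' \<in> G2. \<not> g' \<preceq> g \<curlyvee> l}) * (G / real q ^ (2 * d))"
        using fin' by (intro card_UN_le_mult) auto
      also have "\<dots> \<le> qint q d * (G / real q ^ (2 * d))"
      proof -
        have "real (card {g' \<in> G2. \<not> g' \<preceq> g \<curlyvee> l}) \<le> real (card G2)"
          using fin' by (intro of_nat_mono card_mono) auto
        then show ?thesis
          using G_pos cards by (intro mult_right_mono) auto
      qed
      finally show ?thesis .
    qed
    have "real (card S4) \<le> real (card (G1 - {l})) * (qint q d * (G / real q ^ (2 * d)))"
      unfolding S4_def using fin' i by (intro card_UN_le_mult) auto
    also have "\<dots> \<le> qint q d * (qint q d * (G / real q ^ (2 * d)))"
    proof -
      have "real (card (G1 - {l})) \<le> real (card G1)"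
        using fin' by (intro of_nat_mono card_mono) auto
      then show ?thesis
        using G_pos cards by (intro mult_right_mono) auto
    qed
    finally show ?thesis .
  qed
  obtain n where n: "d = Suc (Suc (Suc n))"
    by (rule d_Suc)
  define m where "m = Suc n"
  have m: "d = Suc (Suc m)"
    by (simp add: n m_def)
  have q2d: "real q ^ (2 * d) = (real q ^ Suc m * real q ^ Suc m) * (real q)\<^sup>2"
    unfolding m by (simp add: power2_eq_square power_add mult_2)
  have "real (card {B \<in> BB. l \<preceq> B}) \<le> real (card (S3 \<union> S4))"
  proof -
    have "finite (S3 \<union> S4)"
      unfolding S3_def S4_def using fin' by auto
    then show ?thesis
      using sub by (intro of_nat_mono card_mono)
  qed
  also have "\<dots> \<le> real (card S3) + real (card S4)"
    using card_Un_le[of S3 S4] by (metis of_nat_add of_nat_mono)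
  also have "\<dots> \<le> (2 * real q ^ m) * (G / real q ^ d) + (2 * real q ^ Suc m) * ((2 * real q ^ Suc m) * (G / real q ^ (2 * d)))"
  proof (rule add_mono)
    have a: "qint q (d - 1) \<le> 2 * real q ^ m" "qint q d \<le> 2 * real q ^ Suc m"
      using qint_le_2power[of q m] qint_le_2power[of q "Suc m"] q2 m by auto
    show "real (card S3) \<le> (2 * real q ^ m) * (G / real q ^ d)"
      using c3 a(1) G_pos by (elim order_trans) (intro mult_right_mono, auto)
    show "real (card S4) \<le> (2 * real q ^ Suc m) * ((2 * real q ^ Suc m) * (G / real q ^ (2 * d)))"
      using c4 a(2) G_pos by (elim order_trans) (intro mult_mono, auto intro!: mult_mono mult_nonneg_nonneg)
  qed
  \<comment> \<open>The planes contribute 2 G / q^2 and the elements of rank 4 contribute 4 G /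
    q^2.\<close>
  also have "\<dots> = 6 * G / (real q)\<^sup>2"
    unfolding q2d unfolding m by (simp add: field_simps power2_eq_square)
  finally show ?thesis
    by simp
next
  case False
  show ?thesis
  proof (cases "\<exists>B0\<in>BB. \<not> l \<preceq> B0")
    case True
    then obtain B0 where B0: "B0 \<in> BB" "\<not> l \<preceq> B0" "B0 \<in> lev (d + 1)" "P \<preceq> B0"
      using BB by blast
    have rk: "rk (B0 \<curlyvee> l) = d + 2"
      using rk_jn_line[OF P l] B0 by auto
    have "{B \<in> BB. \<not> l \<preceq> B} \<subseteq> {B \<in> lev (d + 1). P \<preceq> B \<and> B \<preceq> B0 \<curlyvee> l}"
      using False B0 BB by blast
    then have "real (card {B \<in> BB. \<not> l \<preceq> B}) \<le> real (card {B \<in> lev (d + 1). P \<preceq> B \<and> B \<preceq> B0 \<curlyvee> l})"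
      by (intro of_nat_mono card_mono) auto
    also have "\<dots> = qint q (d + 1)"
      using card_coatoms_between[of P "B0 \<curlyvee> l" "d + 1"] rk P l B0 le_trans[of P l "B0 \<curlyvee> l"] by auto
    finally show ?thesis ..
  next
    case False
    then have "{B \<in> BB. \<not> l \<preceq> B} = {}"
      by blast
    then show ?thesis
      by (metis card.empty of_nat_0 qint_nonneg)
  qed
qed

end

context qflag
begin

lemma q_ge: "10000000000000000 \<le> real q" "10000000000000000 * (real d + 1) \<le> real q"
proof -
  have "real d + 1 \<le> (real d + 1)\<^sup>2"
    by (simp add: power2_eq_square algebra_simps)
  then have "10000000000000000 * (real d + 1) \<le> 10000000000000000 * (real d + 1)\<^sup>2"
    by (rule mult_left_mono) simp
  then show "10000000000000000 * (real d + 1) \<le> real q"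
    using q_big by (rule order_trans)
  then show "10000000000000000 \<le> real q"
    by (elim order_trans[rotated]) simp
qed

lemma qint_d1_le_G: "qint q (d + 1) \<le> G"
proof -
  have "qint q (d + 1) \<le> 2 * real q ^ d"
    using qint_le_2power[of q d] q2 by simp
  also have "\<dots> \<le> real q * real q ^ d"
    by (intro mult_right_mono) auto
  also have "\<dots> = real q ^ Suc d"
    by simp
  also have "\<dots> \<le> real q ^ (d * (d - 1))"
  proof (rule power_increasing)
    obtain m where m: "d = Suc (Suc (Suc m))"
      by (rule d_Suc)
    show "Suc d \<le> d * (d - 1)"
      unfolding m by simp
  qed simp
  also have "\<dots> \<le> G"
    by (rule G_ge)
  finally show ?thesis .
qed

text \<open>By the dichotomy there are two cases for the large members of the extra flags. Either
  all but [d+1] of them share a line, and there are at most 2 G of them; or every line through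
  \<open>P\<close> lies in at most 6 G / q^2 of them, and each of them contains one of the [d] lines
  through \<open>P\<close> in a fixed member \<open>B0\<close>. Every large member belongs to [d+1]
  flags.\<close>

lemma card_extra_le:
  assumes C: "indep C" "pencil P \<subseteq> C" and P: "P \<in> lev 1"
  shows "real (card (C - pencil P)) \<le> 24 * fl / (real q)\<^sup>2"
proof (cases "C - pencil P = {}")
  case True
  show ?thesis
    unfolding True using fl_pos by simp
next
  case False
  obtain n where n: "d = Suc (Suc (Suc n))"
    by (rule d_Suc)
  define BB where "BB = snd ` (C - pencil P)"
  have E: "A \<in> lev d" "B \<in> lev (d + 1)" "P \<preceq> B" "\<not> P \<preceq> A" "A \<preceq> B" "(A, B) \<in> C" if "(A, B) \<in> C - pencil P" for A B
    using that indep_FL[OF C(1)] indep_pencil_le[OF C P, of A B] by (auto simp: FL_def pencil_def)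
  have exA: "\<exists>A. (A, B) \<in> C - pencil P" if "B \<in> BB" for B
    using that unfolding BB_def by (metis imageE prod.collapse)
  have BB: "BB \<subseteq> lev (d + 1)" "\<And>B. B \<in> BB \<Longrightarrow> P \<preceq> B"
    "\<And>B B'. B \<in> BB \<Longrightarrow> B' \<in> BB \<Longrightarrow> 2 \<le> rk (B \<curlywedge> B')"
  proof -
    show "BB \<subseteq> lev (d + 1)" "\<And>B. B \<in> BB \<Longrightarrow> P \<preceq> B"
      using E(2,3) exA by (meson subsetI)+
    fix B B' assume "B \<in> BB" "B' \<in> BB"
    then obtain A A' where "(A, B) \<in> C - pencil P" "(A', B') \<in> C - pencil P"
      using exA by meson
    then show "2 \<le> rk (B \<curlywedge> B')"
      using indep_pencil_mt[OF C P] E(4,6) by meson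
  qed
  have finBB: "finite BB"
    using BB(1) finite_lev finite_subset by blast
  have "C - pencil P \<subseteq> {(A, B) \<in> FL. B \<in> BB}"
    using indep_FL[OF C(1)] unfolding BB_def by force
  then have "card (C - pencil P) \<le> card {(A, B) \<in> FL. B \<in> BB}"
    by (intro card_mono) (auto intro: finite_subset[OF _ finite_FL])
  then have "real (card (C - pencil P)) \<le> real (card {(A, B) \<in> FL. B \<in> BB})"
    by simp
  also have "\<dots> = real (card {B \<in> lev (d + 1). B \<in> BB}) * qint q (d + 1)"
    by (rule card_flags_B_le)
  also have "{B \<in> lev (d + 1). B \<in> BB} = BB"
    using BB(1) by blast
  finally have le: "real (card (C - pencil P)) \<le> real (card BB) * qint q (d + 1)" .
  have q1: "qint q (d + 1) \<le> 2 * real q ^ d" "qint q d \<le> 2 * real q ^ (d - 1)"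
    using qint_le_2power[of q d] qint_le_2power[of q "d - 1"] q2 d3 by auto
  have fl_ge: "G * real q ^ (2 * d - 1) \<le> fl"
  proof -
    have "Suc (2 * d - 1) = 2 * d"
      using d3 by simp
    then have "real q ^ (2 * d - 1) \<le> qint q (2 * d)"
      using qint_ge_power[of q "2 * d - 1"] by metis
    then show ?thesis
      unfolding fl_def using G_pos by (intro mult_left_mono) auto
  qed
  obtain B0 where B0: "B0 \<in> BB" "B0 \<in> lev (d + 1)" "P \<preceq> B0"
  proof -
    have "BB \<noteq> {}"
      using False unfolding BB_def by simp
    then show thesis
      using that BB(1,2) by (meson all_not_in_conv subsetD)
  qed
  show ?thesis
  proof (cases "\<exists>l\<in>lev 2. P \<preceq> l \<and> real (card {B \<in> BB. \<not> l \<preceq> B}) \<le> qint q (d + 1)")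
    case True
    then obtain l where l: "l \<in> lev 2" "P \<preceq> l" "real (card {B \<in> BB. \<not> l \<preceq> B}) \<le> qint q (d + 1)"
      by blast
    have "BB \<subseteq> {B \<in> lev (d + 1). l \<preceq> B} \<union> {B \<in> BB. \<not> l \<preceq> B}"
      using BB by blast
    then have "card BB \<le> card ({B \<in> lev (d + 1). l \<preceq> B} \<union> {B \<in> BB. \<not> l \<preceq> B})"
      using finBB by (intro card_mono) auto
    also have "\<dots> \<le> card {B \<in> lev (d + 1). l \<preceq> B} + card {B \<in> BB. \<not> l \<preceq> B}"
      by (rule card_Un_le)
    finally have "real (card BB) \<le> real (card {B \<in> lev (d + 1). l \<preceq> B}) + real (card {B \<in> BB. \<not> l \<preceq> B})"
      by (metis of_nat_add of_nat_mono)
    then have "real (card BB) \<le> 2 * G"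
      using l card_big_above_line[OF l(1)] qint_d1_le_G by linarith
    then have "real (card (C - pencil P)) \<le> (2 * G) * (2 * real q ^ d)"
      using le q1(1) G_pos by (elim order_trans) (intro mult_mono, auto)
    also have "\<dots> = 4 * (G * real q ^ d)"
      by simp
    \<comment> \<open>The comparison of exponents d \<le> 2 d - 3 is \<open>d3\<close>, with
      equality for d = 3.\<close>
    also have "\<dots> \<le> 24 * (G * real q ^ (2 * d - 3))"
      using G_pos d3 by (intro mult_mono) (auto intro!: mult_left_mono power_increasing)
    also have "\<dots> = 24 * (G * real q ^ (2 * d - 1)) / (real q)\<^sup>2"
      unfolding n by (simp add: power2_eq_square)
    also have "\<dots> \<le> 24 * fl / (real q)\<^sup>2"
      using fl_ge by (intro divide_right_mono) auto
    finally show ?thesis .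
  next
    case False
    define LL where "LL = {g \<in> lev 2. P \<preceq> g \<and> g \<preceq> B0}"
    have "BB \<subseteq> (\<Union>g\<in>LL. {B \<in> BB. g \<preceq> B})"
    proof
      fix B assume B: "B \<in> BB"
      then have B': "B \<in> lev (d + 1)" "P \<preceq> B"
        using BB by auto
      obtain g where g: "g \<in> lev 2" "P \<preceq> g" "g \<preceq> B \<curlywedge> B0"
        using ex_line_below[of P "B \<curlywedge> B0"] BB(3)[OF B B0(1)] B' B0 P by (auto intro: mt_greatest)
      then show "B \<in> (\<Union>g\<in>LL. {B \<in> BB. g \<preceq> B})"
        using B B' B0 by (auto simp: LL_def le_mt_iff)
    qed
    then have "card BB \<le> card (\<Union>g\<in>LL. {B \<in> BB. g \<preceq> B})"
      using finBB by (intro card_mono) (auto simp: LL_def)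
    then have "real (card BB) \<le> real (card (\<Union>g\<in>LL. {B \<in> BB. g \<preceq> B}))"
      by simp
    also have "\<dots> \<le> real (card LL) * (6 * G / (real q)\<^sup>2)"
    proof (rule card_UN_le_mult)
      fix g assume "g \<in> LL"
      then have "g \<in> lev 2" "P \<preceq> g"
        by (auto simp: LL_def)
      then show "real (card {B \<in> BB. g \<preceq> B}) \<le> 6 * G / (real q)\<^sup>2"
        using intersecting_dichotomy[OF BB P] False by blast
    qed (auto simp: LL_def)
    also have "real (card LL) = qint q d"
      using card_covers_between[of P B0 2] B0 P unfolding LL_def by auto
    also have "\<dots> * (6 * G / (real q)\<^sup>2) \<le> 2 * real q ^ (d - 1) * (6 * G / (real q)\<^sup>2)"
      using q1 G_pos by (intro mult_right_mono) auto
    finally have "real (card BB) * qint q (d + 1) \<le> (2 * real q ^ (d - 1) * (6 * G / (real q)\<^sup>2)) * (2 * real q ^ d)"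
      using q1 G_pos by (intro mult_mono) auto
    with le have "real (card (C - pencil P)) \<le> (2 * real q ^ (d - 1) * (6 * G / (real q)\<^sup>2)) * (2 * real q ^ d)"
      by (rule order_trans)
    also have "\<dots> = 24 * (G * real q ^ (2 * d - 1)) / (real q)\<^sup>2"
    proof -
      have "2 * d - 1 = (d - 1) + d"
        using d3 by simp
      then have "real q ^ (2 * d - 1) = real q ^ (d - 1) * real q ^ d"
        by (simp only: power_add)
      then show ?thesis
        by simp
    qed
    also have "\<dots> \<le> 24 * fl / (real q)\<^sup>2"
      using fl_ge by (intro divide_right_mono) auto
    finally show ?thesis .
  qed
qed

definition crk :: "'a \<Rightarrow> nat" where "crk x = rk tp - rk x"

lemma dual_flag: "qflag L (\<lambda>x y. y \<preceq> x) (\<curlyvee>) (\<curlywedge>) tp bt crk q d"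
proof -
  have crk: "crk = (\<lambda>x. rk tp - rk x)"
    by (auto simp: crk_def)
  interpret dual: qlat L "\<lambda>x y. y \<preceq> x" "(\<curlyvee>)" "(\<curlywedge>)" tp bt crk q
    unfolding crk by (rule dual)
  show ?thesis
    by unfold_locales (use d3 q_big in \<open>auto simp: crk_def\<close>)
qed

end

text \<open>A copy of \<open>qflag\<close> is needed to host its dual: a sublocale relation from
  \<open>qflag\<close> to itself would ask for the dual of the dual, and so on without end.\<close>

locale qflag_dual = qflag
begin

sublocale dual: qflag L "\<lambda>x y. y \<preceq> x" "(\<curlyvee>)" "(\<curlywedge>)" tp bt crk q d
  by (rule dual_flag)

lemma dual_lev: "k \<le> 2 * d + 1 \<Longrightarrow> dual.lev k = lev (2 * d + 1 - k)"
  unfolding dual.lev_def lev_def crk_def using rk_le_tp by auto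

lemma dual_FL: "dual.FL = prod.swap ` FL"
proof -
  have "2 * d + 1 - d = d + 1" "2 * d + 1 - (d + 1) = d"
    by auto
  then show ?thesis
    unfolding dual.FL_def FL_def by (subst (1 2) dual_lev) (auto simp: image_iff)
qed

text \<open>The ranks d and d + 1 add up to the rank of the top, so a trivial meet and a full join
  are the same condition. This makes the notion of independence self-dual.\<close>

lemma jn_eq_tp_iff:
  assumes "A \<in> lev d" "B \<in> lev (d + 1)"
  shows "B \<curlyvee> A = tp \<longleftrightarrow> A \<curlywedge> B = bt"
  using modular[of A B] assms rk_eq_0_iff[of "A \<curlywedge> B"] rk_eq_tp_iff[of "A \<curlyvee> B"]
  by (auto simp: jn_comm)

lemma dual_indep: "C \<subseteq> FL \<Longrightarrow> dual.indep (prod.swap ` C) \<longleftrightarrow> indep C"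
proof -
  assume C: "C \<subseteq> FL"
  have "A \<in> lev d" "B \<in> lev (d + 1)" if "(A, B) \<in> C" for A B
    using C that by (auto simp: FL_def)
  note lv = this
  have eq: "B \<curlyvee> A' = tp \<longleftrightarrow> A' \<curlywedge> B = bt" if "(A, B) \<in> C" "(A', B') \<in> C" for A B A' B'
    using jn_eq_tp_iff[of A' B] lv that by blast
  have sw: "(B, A) \<in> prod.swap ` C \<longleftrightarrow> (A, B) \<in> C" for A B
    by auto
  have "(prod.swap ` C \<subseteq> dual.FL) = (C \<subseteq> FL)"
    unfolding dual_FL by (auto simp: image_iff)
  then show ?thesis
    unfolding dual.indep_def indep_def sw by (metis eq)
qed

lemma dual_pencil: "dual.pencil H = prod.swap ` dpencil H"
  unfolding dual.pencil_def dpencil_def dual_FL by (auto simp: image_iff)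

lemma dual_dpencil: "dual.dpencil P = prod.swap ` pencil P"
  unfolding dual.dpencil_def pencil_def dual_FL by (auto simp: image_iff)

lemma card_dextra_le:
  assumes C: "indep C" "dpencil H \<subseteq> C" and H: "H \<in> lev (2 * d)"
  shows "real (card (C - dpencil H)) \<le> 24 * fl / (real q)\<^sup>2"
proof -
  have "real (card (prod.swap ` C - prod.swap ` dpencil H)) \<le> 24 * fl / (real q)\<^sup>2"
    using dual.card_extra_le[of "prod.swap ` C" H] C H dual_lev[of 1] dual_indep indep_FL[OF C(1)]
    by (simp add: dual_pencil image_mono)
  moreover have "prod.swap ` C - prod.swap ` dpencil H = prod.swap ` (C - dpencil H)"
    by (simp add: image_set_diff)
  ultimately show ?thesis
    by (simp add: card_image)
qed

end

section \<open>Variance of the number of hyperplanes above a random element\<close>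

lemma Cauchy_Schwarz_sum:
  fixes a b :: "'b \<Rightarrow> real"
  shows "(\<Sum>i\<in>I. a i * b i)\<^sup>2 \<le> (\<Sum>i\<in>I. (a i)\<^sup>2) * (\<Sum>i\<in>I. (b i)\<^sup>2)"
proof -
  have "0 \<le> (\<Sum>i\<in>I. \<Sum>j\<in>I. (a i * b j - a j * b i)\<^sup>2)"
    by (intro sum_nonneg) auto
  also have "\<dots> = (\<Sum>i\<in>I. \<Sum>j\<in>I. (a i)\<^sup>2 * (b j)\<^sup>2 + (b i)\<^sup>2 * (a j)\<^sup>2 - 2 * ((a i * b i) * (a j * b j)))"
    by (intro sum.cong refl) (simp add: power2_eq_square algebra_simps)
  also have "\<dots> = 2 * ((\<Sum>i\<in>I. (a i)\<^sup>2) * (\<Sum>i\<in>I. (b i)\<^sup>2) - (\<Sum>i\<in>I. a i * b i)\<^sup>2)"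
    by (simp add: sum.distrib sum_subtractf sum_distrib_left[symmetric] sum_distrib_right[symmetric]
        power2_eq_square[of "sum _ _"])
  finally show ?thesis
    by simp
qed

lemma qbin_ratio:
  assumes "k \<le> m"
  shows "qbin q (Suc m) k * qint q (Suc m - k) = qint q (Suc m) * qbin q m k"
proof -
  have "Suc m - k = Suc (m - k)"
    using assms by simp
  then show ?thesis
    using assms qfact_pos[of q k] qfact_pos[of q "m - k"] qint_pos[of "Suc (m - k)" q]
    by (simp add: qbin_qfact field_simps)
qed

lemma qbin_shift:
  assumes "k < m"
  shows "qbin q m (Suc k) * qint q (Suc k) = qbin q m k * qint q (m - k)"
proof -
  have e: "m - k = Suc (m - Suc k)"
    using assms by simp
  have "qfact q (m - k) = qint q (m - k) * qfact q (m - Suc k)"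
    unfolding e by simp
  then show ?thesis
    using assms qfact_pos[of q k] qfact_pos[of q "m - k"] qfact_pos[of q "m - Suc k"]
      qint_pos[of "Suc k" q] qint_pos[of "m - k" q]
    unfolding qbin_qfact[OF Suc_leI[OF assms]] qbin_qfact[OF less_imp_le[OF assms]]
    by (simp add: field_simps)
qed

text \<open>In \<open>hyperplane_discrepancy\<close> this becomes h2 / N \<le> (h1 / N)^2: lying
  below two different hyperplanes is a negatively correlated pair of events.\<close>

lemma qint_cross_le:
  assumes "a \<le> b"
  shows "qint q a * qint q (Suc b) \<le> qint q (Suc a) * qint q b"
  using qint_mono[OF assms, of q] by (simp add: qint_Suc' algebra_simps)

context qflag
begin

lemma rk_mt_hyperplanes:
  assumes "H \<in> lev (2 * d)" "H' \<in> lev (2 * d)" "H \<noteq> H'"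
  shows "rk (H \<curlywedge> H') = 2 * d - 1"
proof -
  have "\<not> H' \<preceq> H"
    using rk_eqD[of H' H] assms by auto
  then have "H \<curlyvee> H' \<noteq> H"
    using assms jn2[of H H'] by (metis levD)
  then have "2 * d < rk (H \<curlyvee> H')"
    using rk_strict[of H "H \<curlyvee> H'"] assms by auto
  moreover have "rk (H \<curlyvee> H') \<le> 2 * d + 1"
    using rk_le_tp[of "H \<curlyvee> H'"] assms by auto
  ultimately show ?thesis
    using modular[of H H'] assms by simp
qed

text \<open>The number of members of \<open>HH\<close> above a random element of rank \<open>k\<close> has variance at most its mean.\<close>
lemma hyperplane_discrepancy:
  fixes HH :: "'a set" and k :: nat
  defines "Z \<equiv> \<lambda>A. real (card {H \<in> HH. A \<preceq> H})"
    and "y \<equiv> real (card HH)"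
  assumes HH: "HH \<subseteq> lev (2 * d)" and k: "k \<le> 2 * d - 1" and S: "S \<subseteq> lev k"
  shows "\<bar>(\<Sum>A\<in>S. Z A) - real (card S) * (y * qint q (2 * d + 1 - k) / qint q (2 * d + 1))\<bar>
           \<le> sqrt (real (card S) * (y * qbin q (2 * d) k))"
proof -
  define N where "N = qbin q (2 * d + 1) k"
  define h1 where "h1 = qbin q (2 * d) k"
  define h2 where "h2 = qbin q (2 * d - 1) k"
  define m where "m = y * qint q (2 * d + 1 - k) / qint q (2 * d + 1)"
  have finH: "finite HH"
    using HH finite_lev finite_subset by blast
  have finS: "finite S"
    using S finite_lev finite_subset by blast
  have pos: "0 < qint q (2 * d + 1)" "0 < qint q (2 * d)" "0 < qint q (2 * d + 1 - k)" "0 < N" "0 < h1"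
    using k d3 by (auto simp: N_def h1_def intro!: qint_pos qbin_pos)
  have r1: "N * qint q (2 * d + 1 - k) = qint q (2 * d + 1) * h1"
    using qbin_ratio[of k "2 * d" q] k by (simp add: N_def h1_def)
  have r2: "h1 * qint q (2 * d - k) = qint q (2 * d) * h2"
    using qbin_ratio[of k "2 * d - 1" q] k d3 by (simp add: h1_def h2_def)
  have mN: "m * N = y * h1"
    using r1 pos by (simp add: m_def field_simps)
  have h2: "h2 * N \<le> h1 * h1"
  proof -
    have "Suc (2 * d - k) = 2 * d + 1 - k"
      using k by simp
    then have "qint q (2 * d - k) * qint q (2 * d + 1) \<le> qint q (2 * d + 1 - k) * qint q (2 * d)"
      using qint_cross_le[of "2 * d - k" "2 * d" q] by simp
    then have "(h1 * h1) * (qint q (2 * d - k) * qint q (2 * d + 1)) \<le> (h1 * h1) * (qint q (2 * d + 1 - k) * qint q (2 * d))"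
      using pos by (intro mult_left_mono) auto
    moreover have e: "(h1 * h1) * (qint q (2 * d - k) * qint q (2 * d + 1)) = (h1 * qint q (2 * d - k)) * (qint q (2 * d + 1) * h1)"
      by simp
    ultimately have "(qint q (2 * d) * h2) * (N * qint q (2 * d + 1 - k)) \<le> (h1 * h1) * (qint q (2 * d + 1 - k) * qint q (2 * d))"
      by (simp only: e r2 r1[symmetric])
    then have "(h2 * N) * (qint q (2 * d + 1 - k) * qint q (2 * d)) \<le> (h1 * h1) * (qint q (2 * d + 1 - k) * qint q (2 * d))"
      by (simp add: ac_simps)
    then show ?thesis
      using pos by (simp add: mult_le_cancel_right)
  qed
  have sumZ: "(\<Sum>A\<in>lev k. Z A) = y * h1"
  proof -
    have "(\<Sum>A\<in>lev k. Z A) = (\<Sum>H\<in>HH. real (card {A \<in> lev k. A \<preceq> H}))"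
      unfolding Z_def using finH by (intro real_card_swap) auto
    also have "\<dots> = (\<Sum>H\<in>HH. h1)"
      using HH by (intro sum.cong) (auto simp: card_lev_below h1_def)
    finally show ?thesis
      by (simp add: y_def)
  qed
  have sumZZ: "(\<Sum>A\<in>lev k. Z A * Z A) \<le> y * h1 + y * y * h2"
  proof -
    have "Z A * Z A = (\<Sum>H\<in>HH. \<Sum>H'\<in>HH. of_bool (A \<preceq> H \<and> A \<preceq> H'))" for A
    proof -
      have "Z A = (\<Sum>H\<in>HH. of_bool (A \<preceq> H))"
        unfolding Z_def using finH by (simp add: of_bool_def sum.If_cases Int_def)
      then show ?thesis
        by (simp add: sum_product of_bool_conj)
    qed
    then have "(\<Sum>A\<in>lev k. Z A * Z A) = (\<Sum>A\<in>lev k. \<Sum>H\<in>HH. \<Sum>H'\<in>HH. of_bool (A \<preceq> H \<and> A \<preceq> H'))"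
      by simp
    also have "\<dots> = (\<Sum>H\<in>HH. \<Sum>H'\<in>HH. \<Sum>A\<in>lev k. of_bool (A \<preceq> H \<and> A \<preceq> H'))"
      by (subst sum.swap, rule sum.cong[OF refl], rule sum.swap)
    also have "\<dots> \<le> (\<Sum>H\<in>HH. \<Sum>H'\<in>HH. (if H = H' then h1 else 0) + h2)"
    proof (intro sum_mono)
      fix H H' assume H: "H \<in> HH" "H' \<in> HH"
      then have lv: "H \<in> lev (2 * d)" "H' \<in> lev (2 * d)"
        using HH by auto
      have "(\<Sum>A\<in>lev k. of_bool (A \<preceq> H \<and> A \<preceq> H')) = real (card {A \<in> lev k. A \<preceq> H \<curlywedge> H'})"
      proof -
        have "{A \<in> lev k. A \<preceq> H \<curlywedge> H'} = lev k \<inter> {A. A \<preceq> H \<and> A \<preceq> H'}"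
          using lv by (auto simp: le_mt_iff)
        then show ?thesis
          by (simp add: of_bool_def sum.If_cases)
      qed
      also have "\<dots> = qbin q (rk (H \<curlywedge> H')) k"
        using lv by (simp add: card_lev_below)
      also have "\<dots> \<le> (if H = H' then h1 else 0) + h2"
      proof (cases "H = H'")
        case True
        then have "H \<curlywedge> H' = H"
          using lv rk_eqD[of "H \<curlywedge> H" H] le_antisym[of "H \<curlywedge> H" H] mt_greatest[of H H H] by auto
        then show ?thesis
          using True lv by (simp add: h1_def h2_def)
      next
        case False
        then show ?thesis
          using rk_mt_hyperplanes[OF lv] by (simp add: h2_def)
      qed
      finally show "(\<Sum>A\<in>lev k. of_bool (A \<preceq> H \<and> A \<preceq> H')) \<le> (if H = H' then h1 else 0) + h2" .
    qed
    also have "\<dots> = y * h1 + y * y * h2"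
      using finH by (simp add: sum.distrib y_def distrib_left)
    finally show ?thesis .
  qed
  have "(\<Sum>A\<in>lev k. (Z A - m)\<^sup>2) \<le> y * h1"
  proof -
    have "(\<Sum>A\<in>lev k. (Z A - m)\<^sup>2) = (\<Sum>A\<in>lev k. Z A * Z A) - 2 * m * (\<Sum>A\<in>lev k. Z A) + N * (m * m)"
      using card_lev[of k]
      by (simp add: power2_eq_square algebra_simps sum.distrib sum_subtractf sum_distrib_left N_def)
    also have "\<dots> \<le> y * h1 + y * y * h2 - m * (y * h1)"
    proof -
      have "N * (m * m) = m * (y * h1)"
        unfolding mN[symmetric] by (simp add: ac_simps)
      moreover have "2 * m * (\<Sum>A\<in>lev k. Z A) = 2 * (m * (y * h1))"
        by (simp add: sumZ)
      ultimately show ?thesis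
        using sumZZ by linarith
    qed
    \<comment> \<open>By negative correlation the off-diagonal part y^2 h2 is at most the square of
      the mean, summed over the level; only the diagonal y h1 is left of the variance.\<close>
    also have "\<dots> \<le> y * h1"
    proof -
      have "y * y * h2 * N \<le> m * (y * h1) * N"
      proof -
        have "m * (y * h1) * N = y * y * (h1 * h1)"
        proof -
          have "m * (y * h1) * N = (m * N) * (y * h1)"
            by simp
          then show ?thesis
            unfolding mN by simp
        qed
        moreover have "y * y * (h2 * N) \<le> y * y * (h1 * h1)"
          using h2 by (intro mult_left_mono) auto
        ultimately show ?thesis
          unfolding mult.assoc[of "y * y" h2 N] by linarith
      qed
      then have "y * y * h2 \<le> m * (y * h1)"
        using pos by (simp add: mult_le_cancel_right)
      then show ?thesis
        by simp
    qed
    finally show ?thesis .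
  qed
  moreover have "(\<Sum>A\<in>S. (Z A - m)\<^sup>2) \<le> (\<Sum>A\<in>lev k. (Z A - m)\<^sup>2)"
    using S by (intro sum_mono2) auto
  moreover have "(\<Sum>A\<in>S. Z A - m)\<^sup>2 \<le> real (card S) * (\<Sum>A\<in>S. (Z A - m)\<^sup>2)"
    using Cauchy_Schwarz_sum[of "\<lambda>_. 1" "\<lambda>A. Z A - m" S] by simp
  ultimately have "(\<Sum>A\<in>S. Z A - m)\<^sup>2 \<le> real (card S) * (y * h1)"
    by (meson mult_left_mono of_nat_0_le_iff order_trans)
  then have "\<bar>\<Sum>A\<in>S. Z A - m\<bar> \<le> sqrt (real (card S) * (y * h1))"
    by (metis power2_abs real_le_rsqrt)
  then show ?thesis
    by (simp add: sum_subtractf m_def h1_def)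
qed

end

section \<open>Covers by pencils, dual pencils and small sets\<close>

text \<open>The classes are indexed rather than collected in a set, since different colours may end
  up with the same class and several indices may have the same point. A class of \<open>I3\<close>
  enters only through its size, which is a small fraction of a pencil.\<close>

locale qcover = qflag_dual +
  fixes I1 I2 I3 :: "'i set" and C :: "'i \<Rightarrow> ('a \<times> 'a) set" and pt hp :: "'i \<Rightarrow> 'a"
  assumes fin_I: "finite I1" "finite I2" "finite I3"
    and card_I: "real (card I1) + real (card I2) + real (card I3) \<le> qint q (d + 2) - real q"
    and indep_C: "i \<in> I1 \<union> I2 \<Longrightarrow> indep (C i)"
    and pt: "i \<in> I1 \<Longrightarrow> pt i \<in> lev 1" "i \<in> I1 \<Longrightarrow> pencil (pt i) \<subseteq> C i"
    and hp: "i \<in> I2 \<Longrightarrow> hp i \<in> lev (2 * d)" "i \<in> I2 \<Longrightarrow> dpencil (hp i) \<subseteq> C i"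
    and small_C: "i \<in> I3 \<Longrightarrow> real (card (C i)) \<le> fl / 1000000"
    and finite_C: "i \<in> I3 \<Longrightarrow> finite (C i)"
    and cover: "FL \<subseteq> (\<Union>i\<in>I1 \<union> I2 \<union> I3. C i)"
begin

text \<open>The numbers \<open>cvA\<close>, \<open>cvB\<close>, \<open>bb\<close> and \<open>T\<close> count flags in multiples of \<open>fl\<close>, the size of one pencil:
  those hit by a point of \<open>M\<close>, those hit by a hyperplane of \<open>HH\<close>, those hit by both, and all of them.\<close>

definition M :: "'a set" where "M = pt ` I1"
definition HH :: "'a set" where "HH = hp ` I2"
definition covA :: "'a set" where "covA = {A \<in> lev d. \<exists>P\<in>M. P \<preceq> A}"
definition covB :: "'a set" where "covB = {B \<in> lev (d + 1). \<exists>H\<in>HH. B \<preceq> H}"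
definition a1 :: real where "a1 = qbin q (2 * d) (d - 1)"
definition T :: real where "T = qint q (2 * d + 1) / qint q d"
definition cvA :: real where "cvA = real (card covA) / a1"
definition cvB :: real where "cvB = real (card covB) / a1"
definition bb :: real where "bb = real (card {(A, B) \<in> FL. A \<in> covA \<and> B \<in> covB}) / fl"

lemma finite_M [simp]: "finite M" and finite_HH [simp]: "finite HH"
  and finite_covA [simp]: "finite covA" and finite_covB [simp]: "finite covB"
  by (simp_all add: M_def HH_def covA_def covB_def fin_I)

lemma M_lev: "M \<subseteq> lev 1" and HH_lev: "HH \<subseteq> lev (2 * d)"
  using pt hp by (auto simp: M_def HH_def)

lemma a1_pos: "0 < a1"
  by (simp add: a1_def qbin_pos)

lemma fl_a1: "fl = a1 * qint q (d + 1)"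
proof -
  have "2 * d - (d - 1) = d + 1" "Suc (d - 1) = d"
    using d3 by auto
  then have "qbin q (2 * d) d * qint q d = qbin q (2 * d) (d - 1) * qint q (d + 1)"
    using qbin_shift[of "d - 1" "2 * d" q] d3 by simp
  then show ?thesis
    by (simp add: qbin_2d_d a1_def)
qed

lemma card_A_above_point: "P \<in> lev 1 \<Longrightarrow> real (card {A \<in> lev d. P \<preceq> A}) = a1"
  using card_lev_above[of P d] d3 by (simp add: a1_def)

lemma card_B_below_hyperplane: "H \<in> lev (2 * d) \<Longrightarrow> real (card {B \<in> lev (d + 1). B \<preceq> H}) = a1"
  using card_lev_below[of H "d + 1"] qbin_sym[of "d - 1" "2 * d" q] d3 by (simp add: a1_def)

lemma card_FL: "real (card FL) = T * fl"
proof -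
  have "real (card FL) = qbin q (2 * d + 1) d * qint q (d + 1)"
    using card_flags_A[of "\<lambda>_. True"] card_lev[of d] by simp
  moreover have "qbin q (2 * d + 1) d = T * a1"
  proof -
    obtain m where m: "d = Suc (Suc (Suc m))"
      by (rule d_Suc)
    show ?thesis
      unfolding T_def a1_def unfolding m by simp
  qed
  ultimately show ?thesis
    by (simp add: fl_a1)
qed

lemma cvA_le: "cvA \<le> real (card M)"
proof -
  have "covA = (\<Union>P\<in>M. {A \<in> lev d. P \<preceq> A})"
    by (auto simp: covA_def)
  then have "real (card covA) \<le> real (card M) * a1"
    using M_lev card_A_above_point by (auto intro!: card_UN_le_mult)
  then show ?thesis
    using a1_pos by (simp add: cvA_def pos_divide_le_eq)
qed

lemma cvB_le: "cvB \<le> real (card HH)"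
proof -
  have "covB = (\<Union>H\<in>HH. {B \<in> lev (d + 1). B \<preceq> H})"
    by (auto simp: covB_def)
  then have "real (card covB) \<le> real (card HH) * a1"
    using HH_lev card_B_below_hyperplane by (auto intro!: card_UN_le_mult)
  then show ?thesis
    using a1_pos by (simp add: cvB_def pos_divide_le_eq)
qed

lemma card_M_le: "real (card M) \<le> real (card I1)" and card_HH_le: "real (card HH) \<le> real (card I2)"
  unfolding M_def HH_def using fin_I by (simp_all add: card_image_le)

lemma cvA_nonneg: "0 \<le> cvA" and cvB_nonneg: "0 \<le> cvB" and bb_nonneg: "0 \<le> bb"
  using a1_pos fl_pos by (auto simp: cvA_def cvB_def bb_def)

text \<open>Inclusion and exclusion for the flags that meet the point condition or the hyperplane
  condition, measured in pencils. Each class of \<open>I1\<close> or \<open>I2\<close> adds at most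
  24 / q^2 by \<open>card_extra_le\<close> or its dual, each class of \<open>I3\<close> at most one
  millionth.\<close>

lemma cover_count:
  "T \<le> cvA + cvB - bb + (real (card I1) + real (card I2)) * (24 / (real q)\<^sup>2) + real (card I3) / 1000000"
proof -
  define FA where "FA = {(A, B) \<in> FL. A \<in> covA}"
  define FB where "FB = {(A, B) \<in> FL. B \<in> covB}"
  define E1 where "E1 = (\<Union>i\<in>I1. C i - pencil (pt i))"
  define E2 where "E2 = (\<Union>i\<in>I2. C i - dpencil (hp i))"
  define E3 where "E3 = (\<Union>i\<in>I3. C i)"
  have fC: "finite (C i)" if "i \<in> I1 \<union> I2" for i
    using indep_FL[OF indep_C[OF that]] finite_FL finite_subset by blast
  have fins: "finite FA" "finite FB" "finite E1" "finite E2" "finite E3"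
    using fin_I fC finite_C unfolding FA_def FB_def E1_def E2_def E3_def
    by (auto intro: finite_subset[OF _ finite_FL])
  have "FL \<subseteq> (FA \<union> FB) \<union> (E1 \<union> (E2 \<union> E3))"
  proof
    fix F assume F: "F \<in> FL"
    obtain A B where AB: "F = (A, B)" "A \<in> lev d" "B \<in> lev (d + 1)"
      using F by (auto simp: FL_def)
    obtain i where i: "i \<in> I1 \<union> I2 \<union> I3" "F \<in> C i"
      using F cover by blast
    then consider "i \<in> I1" | "i \<in> I2" | "i \<in> I3"
      by blast
    then show "F \<in> (FA \<union> FB) \<union> (E1 \<union> (E2 \<union> E3))"
    proof cases
      case 1
      have "F \<in> pencil (pt i) \<Longrightarrow> F \<in> FA"
        using 1 AB F by (auto simp: FA_def covA_def pencil_def M_def)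
      then show ?thesis
        using 1 i by (auto simp: E1_def)
    next
      case 2
      have "F \<in> dpencil (hp i) \<Longrightarrow> F \<in> FB"
        using 2 AB F by (auto simp: FB_def covB_def dpencil_def HH_def)
      then show ?thesis
        using 2 i by (auto simp: E2_def)
    next
      case 3
      then show ?thesis
        using i by (auto simp: E3_def)
    qed
  qed
  then have "card FL \<le> card ((FA \<union> FB) \<union> (E1 \<union> (E2 \<union> E3)))"
    using fins by (intro card_mono) auto
  also have "\<dots> \<le> card (FA \<union> FB) + (card E1 + (card E2 + card E3))"
    by (meson add_mono card_Un_le order_refl order_trans)
  finally have "real (card FL) \<le> real (card (FA \<union> FB)) + (real (card E1) + (real (card E2) + real (card E3)))"
    by (metis of_nat_add of_nat_mono)
  moreover have "real (card (FA \<union> FB)) = real (card FA) + real (card FB) - real (card (FA \<inter> FB))"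
    using card_Un_Int[OF fins(1,2)] by linarith
  moreover have "real (card FA) = cvA * fl"
  proof -
    have "{A \<in> lev d. A \<in> covA} = covA"
      by (auto simp: covA_def)
    then show ?thesis
      using card_flags_A[of "\<lambda>A. A \<in> covA"] a1_pos by (simp add: FA_def cvA_def fl_a1)
  qed
  moreover have "real (card FB) = cvB * fl"
  proof -
    have "{A \<in> lev (d + 1). A \<in> covB} = covB"
      by (auto simp: covB_def)
    then show ?thesis
      using card_flags_B_le[of "\<lambda>A. A \<in> covB"] a1_pos by (simp add: FB_def cvB_def fl_a1)
  qed
  moreover have "real (card (FA \<inter> FB)) = bb * fl"
  proof -
    have "FA \<inter> FB = {(A, B) \<in> FL. A \<in> covA \<and> B \<in> covB}"
      by (auto simp: FA_def FB_def)
    then show ?thesis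
      using fl_pos by (simp add: bb_def)
  qed
  moreover have "real (card E1) \<le> real (card I1) * (24 * fl / (real q)\<^sup>2)"
    unfolding E1_def using fin_I indep_C pt by (intro card_UN_le_mult card_extra_le) auto
  moreover have "real (card E2) \<le> real (card I2) * (24 * fl / (real q)\<^sup>2)"
    unfolding E2_def using fin_I indep_C hp by (intro card_UN_le_mult card_dextra_le) auto
  moreover have "real (card E3) \<le> real (card I3) * (fl / 1000000)"
    unfolding E3_def using fin_I small_C by (intro card_UN_le_mult) auto
  ultimately have "T * fl \<le> cvA * fl + cvB * fl - bb * fl + (real (card I1) * (24 * fl / (real q)\<^sup>2)
      + (real (card I2) * (24 * fl / (real q)\<^sup>2) + real (card I3) * (fl / 1000000)))"
    unfolding card_FL by linarith
  also have "\<dots> = (cvA + cvB - bb + (real (card I1) + real (card I2)) * (24 / (real q)\<^sup>2) + real (card I3) / 1000000) * fl"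
    by (simp add: algebra_simps add_divide_distrib)
  finally have "T * fl \<le> (cvA + cvB - bb + (real (card I1) + real (card I2)) * (24 / (real q)\<^sup>2) + real (card I3) / 1000000) * fl" .
  then show ?thesis
    using fl_pos by (simp add: mult_le_cancel_right)
qed

text \<open>Points and hyperplanes cannot be placed independently of each other without doubly covering
  many flags.\<close>
lemma both_ge:
  "cvA * real (card HH) / T - sqrt (cvA * real (card HH) / real q) - (real (card HH) - cvB) \<le> bb"
proof -
  define y where "y = real (card HH)"
  define Y where "Y = (\<lambda>B. real (card {H \<in> HH. B \<preceq> H}))"
  have y: "0 \<le> y"
    by (simp add: y_def)
  have pos: "0 < qint q d" "0 < qint q (d + 1)" "0 < qint q (2 * d + 1)"
    using d3 by (auto intro: qint_pos)
  have Tpos: "0 < T"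
    using pos by (simp add: T_def)
  \<comment> \<open>For a fixed small member \<open>A\<close>, each hyperplane above
    \<open>A\<close> has exactly [d] large members between \<open>A\<close> and itself.\<close>
  have S1: "(\<Sum>(A, B)\<in>{(A, B) \<in> FL. A \<in> covA}. Y B) = qint q d * (\<Sum>A\<in>covA. Y A)"
  proof -
    have e: "{(A, B) \<in> FL. A \<in> covA} = (SIGMA A:covA. {B \<in> lev (d + 1). A \<preceq> B})"
      by (auto simp: FL_def covA_def)
    have "(\<Sum>B\<in>{B \<in> lev (d + 1). A \<preceq> B}. Y B) = qint q d * Y A" if A: "A \<in> covA" for A
    proof -
      have Al: "A \<in> lev d"
        using A by (simp add: covA_def)
      have "(\<Sum>B\<in>{B \<in> lev (d + 1). A \<preceq> B}. Y B)
          = (\<Sum>H\<in>HH. real (card {B \<in> {B \<in> lev (d + 1). A \<preceq> B}. B \<preceq> H}))"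
        unfolding Y_def by (rule real_card_swap) auto
      also have "\<dots> = (\<Sum>H\<in>HH. if A \<preceq> H then qint q d else 0)"
      proof (rule sum.cong[OF refl])
        fix H assume "H \<in> HH"
        then have H: "H \<in> lev (2 * d)"
          using HH_lev by blast
        have e': "{B \<in> {B \<in> lev (d + 1). A \<preceq> B}. B \<preceq> H} = {B \<in> lev (d + 1). A \<preceq> B \<and> B \<preceq> H}"
          by auto
        show "real (card {B \<in> {B \<in> lev (d + 1). A \<preceq> B}. B \<preceq> H}) = (if A \<preceq> H then qint q d else 0)"
        proof (cases "A \<preceq> H")
          case True
          then show ?thesis
            unfolding e' using card_covers_between[of A H "d + 1"] Al H by simp
        next
          case False
          then have "{B \<in> lev (d + 1). A \<preceq> B \<and> B \<preceq> H} = {}"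
            using le_trans[of A _ H] Al H by blast
          then show ?thesis
            unfolding e' using False by simp
        qed
      qed
      also have "\<dots> = qint q d * Y A"
        by (simp add: Y_def sum.If_cases Int_def)
      finally show ?thesis .
    qed
    then show ?thesis
      unfolding e by (subst sum.Sigma[symmetric]) (auto simp: sum_distrib_left)
  qed
  \<comment> \<open>\<open>Y B\<close> is split into the indicator of \<open>covB\<close> and a
    nonnegative excess. The excess may be summed over all flags, where its total (y - cvB) fl is
    known, however the points are placed.\<close>
  have S2: "(\<Sum>(A, B)\<in>{(A, B) \<in> FL. A \<in> covA}. Y B)
      \<le> real (card {(A, B) \<in> FL. A \<in> covA \<and> B \<in> covB}) + (\<Sum>(A, B)\<in>FL. Y B - of_bool (B \<in> covB))"
  proof -
    have ge: "0 \<le> Y B - of_bool (B \<in> covB)" if "B \<in> lev (d + 1)" for B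
    proof (cases "B \<in> covB")
      case True
      then have "{H \<in> HH. B \<preceq> H} \<noteq> {}"
        by (auto simp: covB_def)
      then have "0 < card {H \<in> HH. B \<preceq> H}"
        by (simp add: card_gt_0_iff)
      then show ?thesis
        unfolding Y_def using True by simp
    qed (simp add: Y_def)
    have fA: "finite {(A, B) \<in> FL. A \<in> covA}"
      by (rule finite_subset[OF _ finite_FL]) auto
    have s1: "(\<Sum>(A, B)\<in>{(A, B) \<in> FL. A \<in> covA}. Y B)
      = (\<Sum>(A, B)\<in>{(A, B) \<in> FL. A \<in> covA}. of_bool (B \<in> covB)) + (\<Sum>(A, B)\<in>{(A, B) \<in> FL. A \<in> covA}. Y B - of_bool (B \<in> covB))"
      by (simp add: sum.distrib[symmetric] split_beta)
    have s2: "(\<Sum>(A, B)\<in>{(A, B) \<in> FL. A \<in> covA}. of_bool (B \<in> covB) :: real) = real (card {(A, B) \<in> FL. A \<in> covA \<and> B \<in> covB})"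
    proof -
      have "{(A, B) \<in> FL. A \<in> covA} \<inter> {F. snd F \<in> covB} = {(A, B) \<in> FL. A \<in> covA \<and> B \<in> covB}"
        by auto
      then show ?thesis
        using fA by (simp add: of_bool_def sum.If_cases split_beta)
    qed
    have s3: "(\<Sum>(A, B)\<in>{(A, B) \<in> FL. A \<in> covA}. Y B - of_bool (B \<in> covB)) \<le> (\<Sum>(A, B)\<in>FL. Y B - of_bool (B \<in> covB))"
    proof (rule sum_mono2[OF finite_FL])
      fix F assume "F \<in> FL - {(A, B) \<in> FL. A \<in> covA}"
      then have "snd F \<in> lev (d + 1)"
        by (auto simp: FL_def)
      then show "0 \<le> (case F of (A, B) \<Rightarrow> Y B - of_bool (B \<in> covB))"
        using ge by (simp add: split_beta)
    qed auto
    show ?thesis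
      using s1 s2 s3 by linarith
  qed
  have S3: "(\<Sum>(A, B)\<in>FL. Y B - of_bool (B \<in> covB)) = (y - cvB) * fl"
  proof -
    have e: "FL = prod.swap ` (SIGMA B:lev (d + 1). {A \<in> lev d. A \<preceq> B})"
      by (auto simp: FL_def image_iff)
    have "(\<Sum>(A, B)\<in>FL. Y B - of_bool (B \<in> covB)) = (\<Sum>(B, A)\<in>(SIGMA B:lev (d + 1). {A \<in> lev d. A \<preceq> B}). Y B - of_bool (B \<in> covB))"
      unfolding e by (subst sum.reindex) (auto simp: split_beta)
    also have "\<dots> = (\<Sum>B\<in>lev (d + 1). (\<Sum>A\<in>{A \<in> lev d. A \<preceq> B}. Y B - of_bool (B \<in> covB)))"
      by (subst sum.Sigma[symmetric]) auto
    also have "\<dots> = (\<Sum>B\<in>lev (d + 1). qint q (d + 1) * (Y B - of_bool (B \<in> covB)))"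
    proof (rule sum.cong[OF refl])
      fix B assume "B \<in> lev (d + 1)"
      then have "real (card {A \<in> lev d. A \<preceq> B}) = qint q (d + 1)"
        using card_lev_below[of B d] qbin_sym[of 1 "Suc d" q] by simp
      then show "(\<Sum>A\<in>{A \<in> lev d. A \<preceq> B}. Y B - of_bool (B \<in> covB)) = qint q (d + 1) * (Y B - of_bool (B \<in> covB))"
        by simp
    qed
    also have "\<dots> = qint q (d + 1) * ((\<Sum>B\<in>lev (d + 1). Y B) - (\<Sum>B\<in>lev (d + 1). of_bool (B \<in> covB)))"
      by (simp add: sum_distrib_left[symmetric] sum_subtractf)
    also have "(\<Sum>B\<in>lev (d + 1). Y B) = y * a1"
    proof -
      have "(\<Sum>B\<in>lev (d + 1). Y B) = (\<Sum>H\<in>HH. real (card {B \<in> lev (d + 1). B \<preceq> H}))"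
        unfolding Y_def by (rule real_card_swap) auto
      also have "\<dots> = (\<Sum>H\<in>HH. a1)"
        using HH_lev card_B_below_hyperplane by (intro sum.cong) auto
      finally show ?thesis
        by (simp add: y_def)
    qed
    also have "(\<Sum>B\<in>lev (d + 1). of_bool (B \<in> covB) :: real) = cvB * a1"
    proof -
      have "lev (d + 1) \<inter> {B. B \<in> covB} = covB"
        by (auto simp: covB_def)
      then show ?thesis
        using a1_pos by (simp add: of_bool_def sum.If_cases cvB_def)
    qed
    finally show ?thesis
      by (simp add: fl_a1 algebra_simps)
  qed
  have S4: "real (card covA) * (y * qint q (d + 1) / qint q (2 * d + 1)) - sqrt (real (card covA) * (y * qbin q (2 * d) d)) \<le> (\<Sum>A\<in>covA. Y A)"
  proof -
    have e: "2 * d + 1 - d = d + 1"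
      by simp
    have "covA \<subseteq> lev d" "d \<le> 2 * d - 1"
      using d3 by (auto simp: covA_def)
    then show ?thesis
      using hyperplane_discrepancy[OF HH_lev, of d covA] unfolding e Y_def y_def by linarith
  qed
  have q1: "sqrt (real (card covA) * (y * qbin q (2 * d) d)) * qint q d \<le> sqrt (cvA * y / real q) * fl"
  proof -
    have h: "qbin q (2 * d) d * qint q d = a1 * qint q (d + 1)"
      using qbin_2d_d fl_a1 by simp
    have le: "real q * qint q d \<le> qint q (d + 1)"
      by (simp add: qint_Suc')
    have "sqrt (real (card covA) * (y * qbin q (2 * d) d)) * qint q d
        = sqrt (real (card covA) * (y * qbin q (2 * d) d)) * sqrt ((qint q d)\<^sup>2)"
      using pos by simp
    also have "\<dots> = sqrt (real (card covA) * (y * qbin q (2 * d) d) * (qint q d)\<^sup>2)"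
      by (simp add: real_sqrt_mult)
    also have "\<dots> \<le> sqrt (cvA * y / real q * fl\<^sup>2)"
    proof (rule real_sqrt_le_mono)
      have "real (card covA) * (y * qbin q (2 * d) d) * (qint q d)\<^sup>2 = cvA * y * a1 * (qbin q (2 * d) d * qint q d) * qint q d"
        using a1_pos by (simp add: cvA_def power2_eq_square)
      also have "\<dots> = cvA * y * a1 * (a1 * qint q (d + 1)) * qint q d"
        by (simp only: h)
      also have "\<dots> \<le> cvA * y * a1 * (a1 * qint q (d + 1)) * (qint q (d + 1) / real q)"
        using le cvA_nonneg y a1_pos by (intro mult_left_mono) (auto simp: field_simps)
      also have "\<dots> = cvA * y / real q * fl\<^sup>2"
        by (simp add: fl_a1 power2_eq_square)
      finally show "real (card covA) * (y * qbin q (2 * d) d) * (qint q d)\<^sup>2 \<le> cvA * y / real q * fl\<^sup>2" .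
    qed
    also have "\<dots> = sqrt (cvA * y / real q) * sqrt (fl\<^sup>2)"
      by (rule real_sqrt_mult)
    also have "sqrt (fl\<^sup>2) = fl"
      using fl_pos by simp
    finally show ?thesis .
  qed
  have q2: "qint q d * (real (card covA) * (y * qint q (d + 1) / qint q (2 * d + 1))) = cvA * y / T * fl"
    using pos a1_pos by (simp add: T_def cvA_def fl_a1 field_simps)
  have "cvA * y / T * fl - sqrt (cvA * y / real q) * fl \<le> qint q d * (\<Sum>A\<in>covA. Y A)"
    using mult_left_mono[OF S4, of "qint q d"] q1 q2 pos by (simp add: algebra_simps)
  also have "\<dots> \<le> bb * fl + (y - cvB) * fl"
    using S1 S2 S3 fl_pos by (simp add: bb_def)
  finally have "(cvA * y / T - sqrt (cvA * y / real q) - (y - cvB)) * fl \<le> bb * fl"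
    by (simp add: algebra_simps)
  then show ?thesis
    using fl_pos by (simp add: y_def mult_le_cancel_right)
qed

end

text \<open>Here Q is q^d; n1, n2, n3 are the numbers of classes, cA, cB, b stand for
  \<open>cvA\<close>, \<open>cvB\<close>, \<open>bb\<close>, and x, y are the numbers of different
  points and hyperplanes. All waste together is at most Q + 50 Q / q. As points are in the majority,
  cA has order q Q, and then \<open>both_ge\<close> would force too much double covering unless y is
  O(Q).\<close>

lemma cover_arith:
  fixes q Q :: real
  assumes Q: "0 < Q" and q: "10000000000000000 \<le> q"
    and n: "n1 + n2 + n3 \<le> q * Q + Q + 2 * (Q / q)" "0 \<le> n1" "0 \<le> n2" "0 \<le> n3" "n2 \<le> n1"
    and T: "q * Q \<le> T" "T \<le> 2 * (q * Q)"
      "T \<le> cA + cB - b + (n1 + n2) * (24 / q\<^sup>2) + n3 / 1000000"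
    and b: "0 \<le> b" and cA: "0 \<le> cA" "cA \<le> x" "x \<le> n1" and cB: "cB \<le> y" "y \<le> n2" "0 \<le> y"
    and both: "cA * y / T - sqrt (cA * y / q) - (y - cB) \<le> b"
  shows "q * Q - 70 * Q \<le> cA" "x - cA \<le> Q + 50 * (Q / q)" "x \<le> 2 * (q * Q)"
proof -
  define P where "P = q * Q"
  define R where "R = Q / q"
  have P: "10000000000000000 * Q \<le> P" "0 < P"
    unfolding P_def using Q q by (auto intro: mult_right_mono)
  have R: "10000000000000000 * R \<le> Q" "0 < R"
    unfolding R_def using Q q by (auto simp: field_simps)
  have n': "n1 + n2 + n3 \<le> P + Q + 2 * R"
    using n(1) by (simp add: P_def R_def)
  have ex: "(n1 + n2) * (24 / q\<^sup>2) \<le> 48 * R"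
  proof -
    have "n1 + n2 \<le> 2 * P"
      using n n' P R Q by linarith
    then have "(n1 + n2) * (24 / q\<^sup>2) \<le> 2 * P * (24 / q\<^sup>2)"
      by (intro mult_right_mono) auto
    also have "\<dots> = 48 * R"
      unfolding P_def R_def using q by (simp add: power2_eq_square field_simps)
    finally show ?thesis .
  qed
  have T': "P \<le> T" "T \<le> 2 * P" "0 < T"
    using T P by (auto simp: P_def)
  \<comment> \<open>A small class contributes only a millionth of a pencil to the cover but a full
    unit to the budget, so their number is essentially the slack.\<close>
  have n3: "n3 \<le> 2 * Q"
    using T(3) T' ex n n' cA cB b P R Q by linarith
  have sum: "(n1 - cA) + (n2 - cB) + b \<le> Q + 50 * R"
    using T(3) T' ex n n' by linarith
  show x1: "x - cA \<le> Q + 50 * (Q / q)"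
    using sum cA cB b unfolding R_def by linarith
  show "x \<le> 2 * (q * Q)"
    using cA n n' P R Q unfolding P_def R_def by linarith
  have cA4: "P / 4 \<le> cA"
    using T(3) T' ex n n' n3 sum cA cB b P R Q by linarith
  define w where "w = sqrt (cA * y / q)"
  have w: "0 \<le> w" "cA * y = q * w\<^sup>2"
    unfolding w_def using cA cB q by auto
  have "w \<le> 4 * Q"
  proof (rule ccontr)
    \<comment> \<open>In terms of w, the inequality \<open>both\<close> reads w^2 / (2 Q) \<le> w +
      2 Q up to the bound on T, and for w > 4 Q its left side is at least 2 w. The bound on w gives
      y \<le> 4 * 16 * Q, since cA is at least q Q / 4.\<close>
    assume "\<not> w \<le> 4 * Q"
    then have gt: "4 * Q < w"
      by simp
    have "w * w / (2 * Q) = (q * w\<^sup>2) / (2 * P)"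
      unfolding P_def using q Q by (simp add: power2_eq_square)
    also have "\<dots> \<le> (q * w\<^sup>2) / T"
      using T' P q by (intro divide_left_mono) auto
    also have "\<dots> \<le> w + 2 * Q"
      using both sum cA cB b n w P R Q unfolding w(2)[symmetric] w_def[symmetric] by linarith
    finally have "w * w / (2 * Q) \<le> w + 2 * Q" .
    moreover have "2 * w \<le> w * w / (2 * Q)"
    proof -
      have "2 * w * (2 * Q) \<le> w * w"
        using mult_right_mono[of "4 * Q" w w] gt w by (simp add: ac_simps)
      then show ?thesis
        using Q by (simp add: pos_le_divide_eq)
    qed
    ultimately show False
      using gt Q by linarith
  qed
  then have "w\<^sup>2 \<le> (4 * Q)\<^sup>2"
    using w by (intro power_mono) auto
  then have "cA * y \<le> q * (4 * Q)\<^sup>2"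
    unfolding w(2) using q by (intro mult_left_mono) auto
  moreover have "P / 4 * y \<le> cA * y"
    using cA4 cB by (intro mult_right_mono) auto
  ultimately have "P / 4 * y \<le> q * (4 * Q)\<^sup>2"
    by linarith
  also have "\<dots> = P / 4 * (64 * Q)"
    by (simp add: P_def power2_eq_square)
  finally have "y \<le> 64 * Q"
    using P by simp
  then show "q * Q - 70 * Q \<le> cA"
    using T(3) T' ex n3 cB b P R Q unfolding P_def by linarith
qed

section \<open>Moments of the number of points in a random element of rank d\<close>

context qcover
begin

definition X :: "'a \<Rightarrow> real" where "X A = real (card {P \<in> M. P \<preceq> A})"
definition onl :: "'a \<Rightarrow> 'a \<Rightarrow> real" where "onl P P' = real (card {R \<in> M. R \<preceq> P \<curlyvee> P'})"
definition PP :: "('a \<times> 'a) set" where "PP = {(P, P'). P \<in> M \<and> P' \<in> M \<and> P \<noteq> P'}"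
text \<open>With \<open>a1\<close> these are the numbers of rank d elements above a point, a line
  and a plane; each step divides by about q^(d+1).\<close>

definition a2 :: real where "a2 = qbin q (2 * d - 1) (d - 2)"
definition a3 :: real where "a3 = qbin q (2 * d - 2) (d - 3)"

lemma finite_PP [simp]: "finite PP"
  by (rule finite_subset[of _ "M \<times> M"]) (auto simp: PP_def)

lemma card_PP: "real (card PP) = real (card M) * (real (card M) - 1)"
proof -
  have "PP = M \<times> M - (\<lambda>P. (P, P)) ` M"
    by (auto simp: PP_def)
  moreover have "card ((\<lambda>P. (P, P)) ` M) = card M"
    by (intro card_image inj_onI) auto
  ultimately have "card PP = card M * card M - card M"
    by (simp add: card_Diff_subset card_cartesian_product image_subset_iff)
  then show ?thesis
    by (cases "card M") (auto simp: algebra_simps)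
qed

lemma a23_pos: "0 < a2" "0 < a3"
  using d3 by (auto simp: a2_def a3_def intro!: qbin_pos)

lemma a2_a1: "a1 * qint q (d - 1) = qint q (2 * d) * a2"
proof -
  obtain m where m: "d = Suc (Suc (Suc m))"
    by (rule d_Suc)
  have "a1 = qint q (2 * d) * a2 / qint q (d - 1)"
    unfolding a1_def a2_def unfolding m by simp
  then show ?thesis
    using qint_pos[of "d - 1" q] d3 by simp
qed

lemma a3_a2: "a2 * qint q (d - 2) = qint q (2 * d - 1) * a3"
proof -
  obtain m where m: "d = Suc (Suc (Suc m))"
    by (rule d_Suc)
  have "a2 = qint q (2 * d - 1) * a3 / qint q (d - 2)"
    unfolding a2_def a3_def unfolding m by simp
  then show ?thesis
    using qint_pos[of "d - 2" q] d3 by simp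
qed

lemma line_lev: "(P, P') \<in> PP \<Longrightarrow> P \<curlyvee> P' \<in> lev 2"
  using rk_line[of P P'] M_lev by (intro levI) (auto simp: PP_def)

lemma card_A_above_line: "l \<in> lev 2 \<Longrightarrow> real (card {A \<in> lev d. l \<preceq> A}) = a2"
  using card_lev_above[of l d] d3 by (simp add: a2_def)

lemma card_A_above_plane: "l \<in> lev 3 \<Longrightarrow> real (card {A \<in> lev d. l \<preceq> A}) = a3"
  using card_lev_above[of l d] d3 by (simp add: a3_def)

lemma X_pairs: "X A * (X A - 1) = real (card {p \<in> PP. fst p \<preceq> A \<and> snd p \<preceq> A})"
proof -
  define N where "N = {P \<in> M. P \<preceq> A}"
  have "{p \<in> PP. fst p \<preceq> A \<and> snd p \<preceq> A} = N \<times> N - (\<lambda>P. (P, P)) ` N"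
    by (auto simp: PP_def N_def)
  moreover have "card ((\<lambda>P. (P, P)) ` N) = card N"
    by (intro card_image inj_onI) auto
  moreover have "finite N"
    by (simp add: N_def)
  ultimately have "card {p \<in> PP. fst p \<preceq> A \<and> snd p \<preceq> A} = card N * card N - card N"
    by (simp add: card_Diff_subset card_cartesian_product image_subset_iff)
  then show ?thesis
    by (cases "card N") (auto simp: X_def N_def algebra_simps)
qed

lemma pair_le_iff:
  "p \<in> PP \<Longrightarrow> A \<in> L \<Longrightarrow> fst p \<preceq> A \<and> snd p \<preceq> A \<longleftrightarrow> fst p \<curlyvee> snd p \<preceq> A"
  using M_lev by (intro jn_le_iff[symmetric]) (auto simp: PP_def)

text \<open>Any two points span a line and all lines have the same number of rank d elements above
  them, so this moment depends on the number of points alone.\<close>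

lemma sum_X2: "(\<Sum>A\<in>lev d. X A * (X A - 1)) = real (card PP) * a2"
proof -
  have "(\<Sum>A\<in>lev d. X A * (X A - 1)) = (\<Sum>p\<in>PP. real (card {A \<in> lev d. fst p \<preceq> A \<and> snd p \<preceq> A}))"
    unfolding X_pairs by (rule real_card_swap) auto
  also have "\<dots> = (\<Sum>p\<in>PP. a2)"
  proof (rule sum.cong[OF refl])
    fix p assume p: "p \<in> PP"
    have "{A \<in> lev d. fst p \<preceq> A \<and> snd p \<preceq> A} = {A \<in> lev d. fst p \<curlyvee> snd p \<preceq> A}"
      using pair_le_iff[OF p] by auto
    then show "real (card {A \<in> lev d. fst p \<preceq> A \<and> snd p \<preceq> A}) = a2"
      using card_A_above_line line_lev p by (metis prod.collapse)
  qed
  finally show ?thesis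
    by simp
qed

text \<open>A third point on the line of the first two imposes no new condition on \<open>A\<close>,
  any other one prescribes a plane. This is the moment that sees collinearity.\<close>

lemma sum_X3:
  "(\<Sum>A\<in>lev d. X A * (X A - 1) * X A)
     \<le> (\<Sum>p\<in>PP. onl (fst p) (snd p)) * a2 + real (card PP) * real (card M) * a3"
proof -
  have "(\<Sum>A\<in>lev d. X A * (X A - 1) * X A) = (\<Sum>A\<in>lev d. \<Sum>p\<in>PP. \<Sum>R\<in>M. of_bool ((fst p \<preceq> A \<and> snd p \<preceq> A) \<and> R \<preceq> A))"
  proof (rule sum.cong[OF refl])
    fix A
    have "X A = (\<Sum>R\<in>M. of_bool (R \<preceq> A))" "X A * (X A - 1) = (\<Sum>p\<in>PP. of_bool (fst p \<preceq> A \<and> snd p \<preceq> A))"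
      unfolding X_pairs unfolding X_def by (simp_all add: of_bool_def sum.If_cases Int_def)
    then show "X A * (X A - 1) * X A = (\<Sum>p\<in>PP. \<Sum>R\<in>M. of_bool ((fst p \<preceq> A \<and> snd p \<preceq> A) \<and> R \<preceq> A))"
      by (simp only: sum_product of_bool_conj)
  qed
  also have "\<dots> = (\<Sum>p\<in>PP. \<Sum>R\<in>M. \<Sum>A\<in>lev d. of_bool ((fst p \<preceq> A \<and> snd p \<preceq> A) \<and> R \<preceq> A))"
    by (subst sum.swap, rule sum.cong[OF refl], rule sum.swap)
  also have "\<dots> \<le> (\<Sum>p\<in>PP. \<Sum>R\<in>M. (if R \<preceq> fst p \<curlyvee> snd p then a2 else 0) + a3)"
  proof (intro sum_mono)
    fix p R assume p: "p \<in> PP" and R: "R \<in> M"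
    define l where "l = fst p \<curlyvee> snd p"
    have l: "l \<in> lev 2"
      using line_lev[of "fst p" "snd p"] p by (simp add: l_def)
    have R': "R \<in> lev 1"
      using R M_lev by blast
    have "(\<Sum>A\<in>lev d. of_bool ((fst p \<preceq> A \<and> snd p \<preceq> A) \<and> R \<preceq> A) :: real) = real (card {A \<in> lev d. l \<preceq> A \<and> R \<preceq> A})"
    proof -
      have "lev d \<inter> {A. (fst p \<preceq> A \<and> snd p \<preceq> A) \<and> R \<preceq> A} = {A \<in> lev d. l \<preceq> A \<and> R \<preceq> A}"
        using pair_le_iff[OF p] by (auto simp: l_def)
      then show ?thesis
        by (simp add: of_bool_def sum.If_cases)
    qed
    also have "\<dots> \<le> (if R \<preceq> l then a2 else 0) + a3"
    proof (cases "R \<preceq> l")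
      case True
      have "card {A \<in> lev d. l \<preceq> A \<and> R \<preceq> A} \<le> card {A \<in> lev d. l \<preceq> A}"
        by (rule card_mono) auto
      then have "real (card {A \<in> lev d. l \<preceq> A \<and> R \<preceq> A}) \<le> a2"
        using card_A_above_line[OF l] by linarith
      then show ?thesis
        using True a23_pos by simp
    next
      case False
      have "{A \<in> lev d. l \<preceq> A \<and> R \<preceq> A} = {A \<in> lev d. l \<curlyvee> R \<preceq> A}"
        using l R' by (auto simp: jn_le_iff)
      moreover have "l \<curlyvee> R \<in> lev 3"
        using rk_jn_point[OF R' _ False] l R' by (intro levI) auto
      ultimately show ?thesis
        using card_A_above_plane False by simp
    qed
    finally show "(\<Sum>A\<in>lev d. of_bool ((fst p \<preceq> A \<and> snd p \<preceq> A) \<and> R \<preceq> A)) \<le> (if R \<preceq> fst p \<curlyvee> snd p then a2 else 0) + a3"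
      by (simp add: l_def)
  qed
  also have "\<dots> = (\<Sum>p\<in>PP. onl (fst p) (snd p) * a2 + real (card M) * a3)"
    by (simp add: sum.distrib sum.If_cases onl_def Int_def)
  also have "\<dots> = (\<Sum>p\<in>PP. onl (fst p) (snd p)) * a2 + real (card PP) * real (card M) * a3"
    by (simp add: sum.distrib sum_distrib_right)
  finally show ?thesis .
qed

lemma X_nonneg: "0 \<le> X A"
  by (simp add: X_def)

lemma covA_iff: "A \<in> lev d \<Longrightarrow> A \<in> covA \<longleftrightarrow> 1 \<le> X A"
proof -
  assume A: "A \<in> lev d"
  have "A \<in> covA \<longleftrightarrow> {P \<in> M. P \<preceq> A} \<noteq> {}"
    using A by (auto simp: covA_def)
  also have "\<dots> \<longleftrightarrow> 0 < card {P \<in> M. P \<preceq> A}"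
    by (simp add: card_gt_0_iff)
  finally show ?thesis
    by (simp add: X_def) linarith
qed

text \<open>Cauchy--Schwarz with the weight \<open>max 0 (X - 1)\<close>, whose total is small because little is covered twice
  while the second factorial moment of \<open>X\<close> does not depend on the position of the points: hence
  many triples of points of \<open>M\<close> are collinear.\<close>
lemma second_moment:
  "(real (card PP) * a2)\<^sup>2 \<le> (real (card M) - cvA) * a1 *
     ((\<Sum>p\<in>PP. onl (fst p) (snd p)) * a2 + real (card PP) * real (card M) * a3)"
proof -
  define w where "w = (\<lambda>A. X A - of_bool (A \<in> covA))"
  have w0: "0 \<le> w A" if "A \<in> lev d" for A
    using covA_iff[OF that] X_nonneg by (auto simp: w_def of_bool_def)
  have wX: "w A * X A = X A * (X A - 1)" if "A \<in> lev d" for A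
  proof (cases "A \<in> covA")
    case False
    have less1: "real n < 1 \<Longrightarrow> real n = 0" for n
      by simp
    have "X A < 1"
      using covA_iff[OF that] False by simp
    then have "X A = 0"
      unfolding X_def by (rule less1)
    then show ?thesis
      by simp
  qed (simp add: w_def)
  have sum_w: "(\<Sum>A\<in>lev d. w A) = (real (card M) - cvA) * a1"
  proof -
    have "(\<Sum>A\<in>lev d. X A) = (\<Sum>P\<in>M. real (card {A \<in> lev d. P \<preceq> A}))"
      unfolding X_def by (rule real_card_swap) auto
    also have "\<dots> = (\<Sum>P\<in>M. a1)"
      using M_lev card_A_above_point by (intro sum.cong) auto
    finally have "(\<Sum>A\<in>lev d. X A) = real (card M) * a1"
      by simp
    moreover have "(\<Sum>A\<in>lev d. of_bool (A \<in> covA) :: real) = cvA * a1"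
    proof -
      have "lev d \<inter> {A. A \<in> covA} = covA"
        by (auto simp: covA_def)
      then show ?thesis
        using a1_pos by (simp add: of_bool_def sum.If_cases cvA_def)
    qed
    ultimately show ?thesis
      by (simp add: w_def sum_subtractf algebra_simps)
  qed
  have "(\<Sum>A\<in>lev d. sqrt (w A) * (sqrt (w A) * X A))\<^sup>2
      \<le> (\<Sum>A\<in>lev d. (sqrt (w A))\<^sup>2) * (\<Sum>A\<in>lev d. (sqrt (w A) * X A)\<^sup>2)"
    by (rule Cauchy_Schwarz_sum)
  also have "(\<Sum>A\<in>lev d. sqrt (w A) * (sqrt (w A) * X A)) = real (card PP) * a2"
  proof -
    have "(\<Sum>A\<in>lev d. sqrt (w A) * (sqrt (w A) * X A)) = (\<Sum>A\<in>lev d. X A * (X A - 1))"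
      using w0 wX by (intro sum.cong) (auto simp: mult.assoc[symmetric])
    then show ?thesis
      by (simp add: sum_X2)
  qed
  also have "(\<Sum>A\<in>lev d. (sqrt (w A))\<^sup>2) = (real (card M) - cvA) * a1"
    unfolding sum_w[symmetric] using w0 by (intro sum.cong) auto
  also have "(\<Sum>A\<in>lev d. (sqrt (w A) * X A)\<^sup>2) = (\<Sum>A\<in>lev d. X A * (X A - 1) * X A)"
    using w0 wX by (intro sum.cong) (auto simp: power_mult_distrib power2_eq_square mult.assoc[symmetric])
  finally show ?thesis
    using sum_X3 cvA_le a1_pos by (elim order_trans) (intro mult_left_mono, auto)
qed

end

text \<open>Here c is \<open>cvA\<close>, x the number of points and s the sum of \<open>onl\<close>
  over ordered pairs. The constant is 195 = 2 * 71 + 1 + 50 + 2: twice the relative deficit of x and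
  x - 1 against q Q, then the factor 1 - 1/q, the waste Q + 50 Q / q, and the triples that are not
  collinear.\<close>

lemma moment_arith:
  fixes q Q :: real
  assumes Q: "1 \<le> Q" and q: "10000000000000000 \<le> q"
    and x: "(q - 70) * Q \<le> c" "c \<le> x" "x - c \<le> Q + 50 * (Q / q)" "x \<le> 2 * (q * Q)"
    and a: "0 < a1" "0 < a2" "0 \<le> a3" "a1 * (1 - 1 / q) \<le> q * Q * a2" "q * Q * a3 \<le> a2"
    and m: "(x * (x - 1) * a2)\<^sup>2 \<le> (x - c) * a1 * (s * a2 + x * (x - 1) * x * a3)" and s: "0 \<le> s"
  shows "x * (x - 1) * (q - 195) \<le> s"
proof -
  define N where "N = x * (x - 1)"
  have qQ: "q \<le> q * Q"
    using Q q by simp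
  have bigQ: "(q - 71) * Q \<le> x - 1" "(q - 70) * Q \<le> x"
    using x Q by (auto simp: algebra_simps)
  have pos: "0 < (q - 71) * Q"
    using Q q by simp
  have x0: "0 < x" "0 < x - 1"
    using bigQ pos by linarith+
  have N0: "0 < N"
    using x0 by (simp add: N_def)
  have Nge: "(q - 142) * q * (Q * Q) \<le> N"
  proof -
    have "(q - 142) * q * (Q * Q) \<le> ((q - 71) * Q) * ((q - 71) * Q)"
    proof -
      have "(q - 142) * q \<le> (q - 71) * (q - 71)"
        by (simp add: algebra_simps)
      then have "(q - 142) * q * (Q * Q) \<le> (q - 71) * (q - 71) * (Q * Q)"
        by (intro mult_right_mono) auto
      then show ?thesis
        by (simp add: ac_simps)
    qed
    also have "\<dots> \<le> x * (x - 1)"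
    proof (rule mult_mono)
      show "(q - 71) * Q \<le> x"
        using bigQ by linarith
    qed (use bigQ pos x0 in auto)
    finally show ?thesis
      by (simp add: N_def)
  qed
  have t3: "N * x * a3 \<le> 2 * N * a2"
  proof -
    have "x * (q * Q * a3) \<le> 2 * (q * Q) * a2"
      using x x0 a by (intro mult_mono) auto
    then have "(q * Q) * (x * a3) \<le> (q * Q) * (2 * a2)"
      by (simp add: ac_simps)
    then have "x * a3 \<le> 2 * a2"
      using q Q by simp
    then have "N * (x * a3) \<le> N * (2 * a2)"
      using N0 by (intro mult_left_mono) auto
    then show ?thesis
      by (simp add: ac_simps)
  qed
  have "(N * a2)\<^sup>2 \<le> (x - c) * a1 * (s * a2 + N * x * a3)"
    using m by (simp add: N_def)
  also have "\<dots> \<le> (Q + 50 * (Q / q)) * a1 * ((s + 2 * N) * a2)"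
  proof (rule mult_mono)
    show "(x - c) * a1 \<le> (Q + 50 * (Q / q)) * a1"
      using x a by (intro mult_right_mono) auto
    show "s * a2 + N * x * a3 \<le> (s + 2 * N) * a2"
      using t3 by (simp add: algebra_simps)
    show "0 \<le> (Q + 50 * (Q / q)) * a1"
      using Q q a by simp
    show "0 \<le> s * a2 + N * x * a3"
      using s a N0 x0 by simp
  qed
  finally have "N * N * a2 * a2 \<le> (Q * (1 + 50 / q) * a1 * (s + 2 * N)) * a2"
    by (simp add: power2_eq_square algebra_simps)
  then have i: "N * N * a2 \<le> Q * (1 + 50 / q) * a1 * (s + 2 * N)"
    using a by (simp only: mult_le_cancel_right)
  have "N * N * (a1 * (1 - 1 / q)) \<le> N * N * (q * Q * a2)"
    using a by (intro mult_left_mono) auto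
  also have "\<dots> = (q * Q) * (N * N * a2)"
    by (simp add: ac_simps)
  also have "\<dots> \<le> (q * Q) * (Q * (1 + 50 / q) * a1 * (s + 2 * N))"
    using i Q q by (intro mult_left_mono) auto
  also have "\<dots> = Q * Q * (q * (1 + 50 / q)) * (s + 2 * N) * a1"
    by (simp only: ac_simps)
  also have "q * (1 + 50 / q) = q + 50"
    using q by (simp add: field_simps)
  finally have "(N * N * (1 - 1 / q)) * a1 \<le> (Q * Q * (q + 50) * (s + 2 * N)) * a1"
    by (simp only: ac_simps)
  then have "N * N * (1 - 1 / q) \<le> Q * Q * (q + 50) * (s + 2 * N)"
    using a by simp
  moreover have "(q - 142) * q * (Q * Q) * (N * (1 - 1 / q)) \<le> N * (N * (1 - 1 / q))"
    using Nge N0 q by (intro mult_right_mono) auto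
  ultimately have "(Q * Q) * ((q - 142) * q * (1 - 1 / q) * N) \<le> (Q * Q) * ((q + 50) * (s + 2 * N))"
    by (simp add: ac_simps)
  then have f1: "(q - 142) * q * (1 - 1 / q) * N \<le> (q + 50) * (s + 2 * N)"
    using Q by (simp only: mult_le_cancel_left) (auto simp: zero_less_mult_iff)
  have f2: "(q - 142) * q * (1 - 1 / q) = (q - 142) * (q - 1)"
    using q by (simp add: field_simps)
  have "(q + 50) * (q - 193) * N \<le> (q - 142) * (q - 1) * N"
    using N0 q by (intro mult_right_mono) (auto simp: algebra_simps)
  also have "\<dots> \<le> (q + 50) * (s + 2 * N)"
    using f1 unfolding f2 .
  finally have "(q + 50) * ((q - 193) * N) \<le> (q + 50) * (s + 2 * N)"
    by (simp only: mult.assoc)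
  then have "(q - 193) * N \<le> s + 2 * N"
    using q by simp
  then show ?thesis
    unfolding N_def[symmetric] by (simp add: algebra_simps)
qed

context qcover
begin

abbreviation Q :: real where "Q \<equiv> real q ^ d"

lemma Q_ge: "1 \<le> Q"
  by simp

lemma T_bounds: "real q * Q \<le> T" "T \<le> 2 * (real q * Q)"
proof -
  have "0 < qint q d"
    using d3 by (intro qint_pos) simp
  moreover have "real q ^ (d + 1) * qint q d \<le> qint q (2 * d + 1)"
    using qint_power_mult_le[of q "d + 1" d] by (simp add: mult_2)
  ultimately show "real q * Q \<le> T"
    by (simp add: T_def pos_le_divide_eq)
  have "real q ^ (d - 1) \<le> qint q d"
    using qint_ge_power[of q "d - 1"] d3 by simp
  then have "2 * (real q * Q) * real q ^ (d - 1) \<le> 2 * (real q * Q) * qint q d"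
    by (intro mult_left_mono) auto
  moreover have "2 * (real q * Q) * real q ^ (d - 1) = 2 * real q ^ (2 * d)"
  proof -
    have "2 * d = Suc d + (d - 1)"
      using d3 by simp
    then have "real q ^ (2 * d) = real q ^ Suc d * real q ^ (d - 1)"
      by (simp only: power_add)
    then show ?thesis
      by simp
  qed
  moreover have "qint q (2 * d + 1) \<le> 2 * real q ^ (2 * d)"
    using qint_le_2power[of q "2 * d"] by simp
  ultimately have "qint q (2 * d + 1) \<le> 2 * (real q * Q) * qint q d"
    by linarith
  then show "T \<le> 2 * (real q * Q)"
    using \<open>0 < qint q d\<close> by (simp add: T_def pos_divide_le_eq)
qed

lemma qint_d_le: "qint q d \<le> 2 * (Q / real q)"
proof -
  obtain m where m: "d = Suc m"
    using d_Suc by blast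
  show ?thesis
    using qint_le_2power[of q m] unfolding m by simp
qed

lemma colours_le: "qint q (d + 2) - real q \<le> real q * Q + Q + 2 * (Q / real q)"
proof -
  have "qint q (d + 2) = qint q d + Q + real q * Q"
    by (simp add: qint_Suc)
  then show ?thesis
    using qint_d_le by simp
qed

end

text \<open>The reduction up to duality: if hyperplanes are in the majority, the same locale is used
  for the dual lattice with \<open>I1\<close> and \<open>I2\<close> exchanged.\<close>

locale qcover_points = qcover +
  assumes more_points: "card I2 \<le> card I1"
begin

lemma cover_consequences:
  "real q * Q - 70 * Q \<le> cvA" "real (card M) - cvA \<le> Q + 50 * (Q / real q)"
  "real (card M) \<le> 2 * (real q * Q)"
proof -
  have "real (card I1) + real (card I2) + real (card I3) \<le> real q * Q + Q + 2 * (Q / real q)"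
    using card_I colours_le by linarith
  note * = cover_arith[of Q "real q" "real (card I1)" "real (card I2)" "real (card I3)" T cvA cvB bb
      "real (card M)" "real (card HH)", OF _ q_ge(1) this _ _ _ _ T_bounds cover_count bb_nonneg cvA_nonneg
      cvA_le card_M_le cvB_le card_HH_le _ both_ge]
  show "real q * Q - 70 * Q \<le> cvA" "real (card M) - cvA \<le> Q + 50 * (Q / real q)"
    "real (card M) \<le> 2 * (real q * Q)"
    using * more_points by auto
qed

lemma sum_onl_ge: "real (card PP) * (real q - 195) \<le> (\<Sum>p\<in>PP. onl (fst p) (snd p))"
  unfolding card_PP
proof (rule moment_arith[OF Q_ge q_ge(1), of cvA "real (card M)" a1 a2 a3])
  show "(real q - 70) * Q \<le> cvA"
    using cover_consequences(1) by (simp add: algebra_simps)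
  show "0 < a1" "0 < a2" "0 \<le> a3"
    using a1_pos a23_pos by auto
  show "(real (card M) * (real (card M) - 1) * a2)\<^sup>2 \<le> (real (card M) - cvA) * a1 *
    ((\<Sum>p\<in>PP. onl (fst p) (snd p)) * a2 + real (card M) * (real (card M) - 1) * real (card M) * a3)"
    using second_moment by (simp add: card_PP)
  show "0 \<le> (\<Sum>p\<in>PP. onl (fst p) (snd p))"
    by (intro sum_nonneg) (simp add: onl_def)
  have pos: "0 < qint q (d - 1)" "0 < qint q (2 * d)" "0 < qint q (d - 2)" "0 < qint q (2 * d - 1)"
    using d3 by (auto intro!: qint_pos)
  have l1: "qint q (2 * d) = qint q (d + 1) + real q ^ (d + 1) * qint q (d - 1)"
  proof -
    have "qint q (d + 1 + j) = qint q (d + 1) + real q ^ (d + 1) * qint q j" for j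
      by (induction j) (simp_all add: qint_Suc algebra_simps power_add)
    from this[of "d - 1"] show ?thesis
      using d3 by (simp add: mult_2)
  qed
  have "real q * qint q (d + 1) \<le> qint q (2 * d)"
  proof -
    have "real q * qint q (d + 1) \<le> qint q (Suc (d + 1))"
      by (simp only: qint_Suc')
    also have "\<dots> \<le> qint q (2 * d)"
      using d3 by (intro qint_mono) simp
    finally show ?thesis .
  qed
  then have "qint q (d + 1) \<le> qint q (2 * d) / real q"
    by (simp add: field_simps)
  then have "qint q (2 * d) * (1 - 1 / real q) \<le> real q ^ (d + 1) * qint q (d - 1)"
    using l1 by (simp add: algebra_simps add_divide_distrib)
  then have "a2 * (qint q (2 * d) * (1 - 1 / real q)) \<le> a2 * (real q ^ (d + 1) * qint q (d - 1))"
    using a23_pos by (intro mult_left_mono) auto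
  then have "(a1 * qint q (d - 1)) * (1 - 1 / real q) \<le> a2 * (real q ^ (d + 1) * qint q (d - 1))"
    unfolding a2_a1 by (simp add: ac_simps)
  then have "(a1 * (1 - 1 / real q)) * qint q (d - 1) \<le> (real q * Q * a2) * qint q (d - 1)"
    by (simp add: ac_simps)
  then show "a1 * (1 - 1 / real q) \<le> real q * Q * a2"
    using pos by (simp add: mult_le_cancel_right)
  have e: "d - 2 + (d + 1) = 2 * d - 1"
    using d3 by simp
  have "real q ^ (d + 1) * qint q (d - 2) \<le> qint q (2 * d - 1)"
    using qint_power_mult_le[of q "d + 1" "d - 2"] unfolding e .
  then have "a3 * (real q ^ (d + 1) * qint q (d - 2)) \<le> a3 * qint q (2 * d - 1)"
    using a23_pos by (intro mult_left_mono) auto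
  then have "(real q * Q * a3) * qint q (d - 2) \<le> a2 * qint q (d - 2)"
    unfolding a3_a2 by (simp add: ac_simps)
  then show "real q * Q * a3 \<le> a2"
    using pos by (simp add: mult_le_cancel_right)
qed (use cover_consequences cvA_le in auto)

lemma sum_deficit: "(\<Sum>p\<in>PP. real q + 1 - onl (fst p) (snd p)) \<le> 200 * real (card PP)"
  using sum_onl_ge by (simp add: sum_subtractf algebra_simps)

end

section \<open>Growing an element of rank d + 2 nearly filled with points\<close>

lemma ex_le_average:
  fixes f :: "'b \<Rightarrow> real"
  assumes "finite S" "(\<Sum>x\<in>S. f x) \<le> b" "n \<le> real (card S)" "0 < n" "0 \<le> b"
  obtains x where "x \<in> S" "f x \<le> b / n"
proof -
  have "\<exists>x\<in>S. f x \<le> b / n"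
  proof (rule ccontr)
    assume "\<not> (\<exists>x\<in>S. f x \<le> b / n)"
    then have gt: "b / n < f x" if "x \<in> S" for x
      using that by force
    have "S \<noteq> {}"
      using assms(3,4) by auto
    then have "real (card S) * (b / n) < (\<Sum>x\<in>S. f x)"
      using sum_strict_mono[of S "\<lambda>_. b / n" f] gt assms(1) by simp
    moreover have "n * (b / n) \<le> real (card S) * (b / n)"
      using assms(3-5) by (intro mult_right_mono) auto
    ultimately show False
      using assms(2,4) by simp
  qed
  then show thesis
    using that by blast
qed

context qcover_points
begin

text \<open>This balances the two errors of \<open>greedy_step\<close>. After d + 1 steps 2 (d+1) /
  L0 has to be small, so L0 is a large multiple of d + 1; then 800 (d+1) L0 / q is small if q is a
  large multiple of (d+1)^2, whence the square in \<open>q_big\<close>.\<close>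

definition L0 :: real where "L0 = 100000 * (real d + 1)"
definition dfc :: "'a \<Rightarrow> 'a \<Rightarrow> real" where "dfc P P' = real q + 1 - onl P P'"
text \<open>The points whose lines to the other points are nearly full on average. The growth stays
  inside this set because every step averages over the lines through each point already collected,
  so each of them has to be good individually.\<close>

definition M1 :: "'a set" where
  "M1 = {P \<in> M. (\<Sum>P'\<in>M - {P}. dfc P P') \<le> 200 * L0 * real (card M)}"

lemma L0_pos: "1 \<le> L0" "0 < L0"
  by (simp_all add: L0_def)

lemma M1_sub: "M1 \<subseteq> M" "M1 \<subseteq> lev 1"
  using M_lev by (auto simp: M1_def)

lemma finite_M1 [simp]: "finite M1"
  using M1_sub(1) finite_M finite_subset by blast

lemma dfc_sym:
  assumes "P \<in> M" "P' \<in> M"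
  shows "dfc P P' = dfc P' P"
proof -
  have "P \<in> L" "P' \<in> L"
    using assms M_lev by auto
  then show ?thesis
    by (simp add: dfc_def onl_def jn_comm[of P P'])
qed

lemma dfc_nonneg:
  assumes "P \<in> M" "P' \<in> M" "P \<noteq> P'"
  shows "0 \<le> dfc P P'"
proof -
  have lv: "P \<in> lev 1" "P' \<in> lev 1"
    using assms M_lev by auto
  have "{R \<in> M. R \<preceq> P \<curlyvee> P'} \<subseteq> {R \<in> lev 1. R \<preceq> P \<curlyvee> P'}"
    using M_lev by auto
  then have "card {R \<in> M. R \<preceq> P \<curlyvee> P'} \<le> card {R \<in> lev 1. R \<preceq> P \<curlyvee> P'}"
    by (intro card_mono) auto
  then have "onl P P' \<le> real (card {R \<in> lev 1. R \<preceq> P \<curlyvee> P'})"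
    by (simp add: onl_def)
  also have "\<dots> = qint q 2"
    using card_points_below[of "P \<curlyvee> P'"] rk_line[OF lv assms(3)] lv by simp
  also have "\<dots> = real q + 1"
    by (simp add: qint_def numeral_2_eq_2)
  finally show ?thesis
    by (simp add: dfc_def)
qed

lemma card_M_ge: "(real q - 70) * Q \<le> real (card M)" "0 < real (card M)"
proof -
  show g: "(real q - 70) * Q \<le> real (card M)"
    using cover_consequences(1) cvA_le by (simp add: algebra_simps)
  have "0 < (real q - 70) * Q"
    using q_ge(1) by simp
  then show "0 < real (card M)"
    using g by linarith
qed

text \<open>Markov's inequality for the deficit of a point.\<close>

lemma card_bad: "real (card (M - M1)) \<le> real (card M) / L0"
proof -
  let ?x = "real (card M)"
  have "PP = (SIGMA P:M. M - {P})"
    by (auto simp: PP_def)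
  then have "(\<Sum>p\<in>PP. dfc (fst p) (snd p)) = (\<Sum>P\<in>M. \<Sum>P'\<in>M - {P}. dfc P P')"
    by (simp add: sum.Sigma split_beta)
  moreover have "real (card (M - M1)) * (200 * L0 * ?x) \<le> (\<Sum>P\<in>M - M1. \<Sum>P'\<in>M - {P}. dfc P P')"
  proof -
    have "(\<Sum>P\<in>M - M1. 200 * L0 * ?x) \<le> (\<Sum>P\<in>M - M1. \<Sum>P'\<in>M - {P}. dfc P P')"
      by (rule sum_mono) (auto simp: M1_def)
    then show ?thesis
      by simp
  qed
  moreover have "(\<Sum>P\<in>M - M1. \<Sum>P'\<in>M - {P}. dfc P P') \<le> (\<Sum>P\<in>M. \<Sum>P'\<in>M - {P}. dfc P P')"
    using dfc_nonneg by (intro sum_mono2) (auto intro!: sum_nonneg)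
  moreover have "(\<Sum>p\<in>PP. dfc (fst p) (snd p)) \<le> 200 * (?x * (?x - 1))"
    using sum_deficit by (simp add: dfc_def card_PP)
  moreover have "200 * (?x * (?x - 1)) \<le> 200 * (?x * ?x)"
    by (simp add: algebra_simps)
  ultimately have "real (card (M - M1)) * (200 * L0 * ?x) \<le> 200 * (?x * ?x)"
    by linarith
  then have "(real (card (M - M1)) * L0) * (200 * ?x) \<le> ?x * (200 * ?x)"
    by (simp add: ac_simps)
  then have "real (card (M - M1)) * L0 \<le> ?x"
    using card_M_ge(2) by (simp add: mult_le_cancel_right)
  then show ?thesis
    using L0_pos by (simp add: pos_le_divide_eq)
qed

lemma card_points_outside:
  assumes W: "W \<in> L" and Z: "Z \<in> lev 1" "\<not> Z \<preceq> W"
  shows "real (card {P \<in> lev 1. P \<preceq> W \<curlyvee> Z \<and> \<not> P \<preceq> W}) = real q ^ rk W"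
proof -
  have rk: "rk (W \<curlyvee> Z) = Suc (rk W)"
    using rk_jn_point[OF Z(1) W Z(2)] .
  have "{P \<in> lev 1. P \<preceq> W} \<union> {P \<in> lev 1. P \<preceq> W \<curlyvee> Z \<and> \<not> P \<preceq> W} = {P \<in> lev 1. P \<preceq> W \<curlyvee> Z}"
    using W Z le_trans[of _ W "W \<curlyvee> Z"] by auto
  then have "card {P \<in> lev 1. P \<preceq> W \<curlyvee> Z} = card {P \<in> lev 1. P \<preceq> W} + card {P \<in> lev 1. P \<preceq> W \<curlyvee> Z \<and> \<not> P \<preceq> W}"
    by (subst card_Un_disjoint[symmetric]) auto
  then have "qint q (Suc (rk W)) = qint q (rk W) + real (card {P \<in> lev 1. P \<preceq> W \<curlyvee> Z \<and> \<not> P \<preceq> W})"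
    using card_points_below[of "W \<curlyvee> Z"] card_points_below[of W] rk W Z by (simp flip: of_nat_add)
  then show ?thesis
    by (simp add: qint_Suc)
qed

lemma exchange:
  assumes W: "W \<in> L" and Z: "Z \<in> lev 1" "\<not> Z \<preceq> W" and P: "P \<in> lev 1" "\<not> P \<preceq> W" "Z \<preceq> W \<curlyvee> P"
  shows "P \<preceq> W \<curlyvee> Z"
proof -
  have "W \<curlyvee> Z = W \<curlyvee> P"
    using rk_jn_point[OF Z(1) W Z(2)] rk_jn_point[OF P(1) W P(2)] W Z P by (intro jn_eqI) auto
  then show ?thesis
    using W P jn2[of W P] by simp
qed

text \<open>For a random point \<open>P\<close> of \<open>M1\<close> outside \<open>W\<close>, almost all points of the lines joining \<open>P\<close> to the points of
  \<open>M1\<close> below \<open>W\<close> belong to \<open>M1\<close> again.\<close>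
lemma greedy_step:
  assumes W: "W \<in> lev j" and j: "1 \<le> j" "j \<le> d + 1"
  obtains W' where "W' \<in> lev (j + 1)"
    "real q * real (card {P \<in> M1. P \<preceq> W}) - (800 * L0 * real q ^ (j - 1) + 2 * real q ^ j / L0)
       \<le> real (card {P \<in> M1. P \<preceq> W'})"
proof -
  let ?x = "real (card M)"
  define MW where "MW = {P \<in> M1. P \<preceq> W}"
  define S where "S = {P \<in> M1. \<not> P \<preceq> W}"
  define bad where "bad P = {Z \<in> M - M1. \<not> Z \<preceq> W \<and> Z \<preceq> W \<curlyvee> P}" for P
  have WL: "W \<in> L" "rk W = j"
    using W by auto
  have fin': "finite MW" "finite S"
    by (simp_all add: MW_def S_def)
  have subs: "MW \<subseteq> M" "S \<subseteq> M" "MW \<subseteq> lev 1" "S \<subseteq> lev 1" "MW \<inter> S = {}"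
    using M1_sub by (auto simp: MW_def S_def)
  have cMW: "real (card MW) \<le> 2 * real q ^ (j - 1)"
  proof -
    have "card MW \<le> card {P \<in> lev 1. P \<preceq> W}"
      using M1_sub by (intro card_mono) (auto simp: MW_def)
    then have "real (card MW) \<le> qint q j"
      using card_points_below[of W] WL by simp
    also have "\<dots> \<le> 2 * real q ^ (j - 1)"
      using qint_le_2power[of q "j - 1"] j by simp
    finally show ?thesis .
  qed
  \<comment> \<open>At least half of the points of \<open>M\<close> are candidates for
    \<open>P\<close>, which is why averages below are taken with the denominator x / 2. The points
    below \<open>W\<close> are few because j \<le> d + 1.\<close>
  have cS: "?x / 2 \<le> real (card S)"
  proof -
    have "M = S \<union> MW \<union> (M - M1)"
      using M1_sub(1) by (auto simp: S_def MW_def)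
    then have "card M \<le> card S + card MW + card (M - M1)"
      by (metis add.assoc card_Un_le add_le_mono1 order_trans)
    then have "?x \<le> real (card S) + real (card MW) + real (card (M - M1))"
      by (metis of_nat_add of_nat_mono)
    moreover have "real (card (M - M1)) \<le> ?x / 4"
    proof -
      have "?x / L0 \<le> ?x / 4"
        using L0_def by (intro divide_left_mono) auto
      then show ?thesis
        using card_bad by linarith
    qed
    moreover have "real (card MW) \<le> ?x / 4"
    proof -
      have "real q ^ (j - 1) \<le> Q"
        using j by (intro power_increasing) auto
      moreover have "8 * Q \<le> (real q - 70) * Q"
        using q_ge(1) by (intro mult_right_mono) auto
      ultimately show ?thesis
        using cMW card_M_ge(1) by linarith
    qed
    ultimately show ?thesis
      by linarith
  qed
  have t1: "(\<Sum>P\<in>S. \<Sum>P'\<in>MW. dfc P P') \<le> real (card MW) * (200 * L0 * ?x)"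
  proof -
    have "(\<Sum>P\<in>S. \<Sum>P'\<in>MW. dfc P P') = (\<Sum>P'\<in>MW. \<Sum>P\<in>S. dfc P P')"
      by (rule sum.swap)
    also have "\<dots> \<le> (\<Sum>P'\<in>MW. 200 * L0 * ?x)"
    proof (rule sum_mono)
      fix P' assume P': "P' \<in> MW"
      have "(\<Sum>P\<in>S. dfc P P') = (\<Sum>P\<in>S. dfc P' P)"
        using P' subs by (intro sum.cong refl dfc_sym) auto
      also have "\<dots> \<le> (\<Sum>P\<in>M - {P'}. dfc P' P)"
        using P' subs dfc_nonneg by (intro sum_mono2) auto
      also have "\<dots> \<le> 200 * L0 * ?x"
        using P' by (simp add: MW_def M1_def)
      finally show "(\<Sum>P\<in>S. dfc P P') \<le> 200 * L0 * ?x" .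
    qed
    finally show ?thesis
      by simp
  qed
  \<comment> \<open>A point \<open>Z\<close> outside \<open>W\<close> is swept up exactly by those
    \<open>P\<close> that lie in \<open>W \<curlyvee> Z\<close> but not in \<open>W\<close>, and
    there are only q^j points of that kind.\<close>
  have t2: "(\<Sum>P\<in>S. real (card (bad P))) \<le> real (card (M - M1)) * real q ^ j"
  proof -
    have "(\<Sum>P\<in>S. real (card (bad P))) = (\<Sum>Z\<in>M - M1. real (card {P \<in> S. \<not> Z \<preceq> W \<and> Z \<preceq> W \<curlyvee> P}))"
      unfolding bad_def using fin' by (intro real_card_swap) auto
    also have "\<dots> \<le> (\<Sum>Z\<in>M - M1. real q ^ j)"
    proof (rule sum_mono)
      fix Z assume "Z \<in> M - M1"
      then have Z: "Z \<in> lev 1"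
        using M_lev by auto
      show "real (card {P \<in> S. \<not> Z \<preceq> W \<and> Z \<preceq> W \<curlyvee> P}) \<le> real q ^ j"
      proof (cases "Z \<preceq> W")
        case True
        then have "{P \<in> S. \<not> Z \<preceq> W \<and> Z \<preceq> W \<curlyvee> P} = {}"
          by simp
        then show ?thesis
          by (metis card.empty of_nat_0 zero_le_power of_nat_0_le_iff)
      next
        case False
        have "{P \<in> S. \<not> Z \<preceq> W \<and> Z \<preceq> W \<curlyvee> P} \<subseteq> {P \<in> lev 1. P \<preceq> W \<curlyvee> Z \<and> \<not> P \<preceq> W}"
          using exchange[OF WL(1) Z False] subs by (auto simp: S_def)
        then have "card {P \<in> S. \<not> Z \<preceq> W \<and> Z \<preceq> W \<curlyvee> P} \<le> card {P \<in> lev 1. P \<preceq> W \<curlyvee> Z \<and> \<not> P \<preceq> W}"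
          by (intro card_mono) auto
        then show ?thesis
          using card_points_outside[OF WL(1) Z False] WL by simp
      qed
    qed
    finally show ?thesis
      by simp
  qed
  define b where "b = ?x * (400 * L0 * real q ^ (j - 1) + real q ^ j / L0)"
  have "(\<Sum>P\<in>S. (\<Sum>P'\<in>MW. dfc P P') + real (card (bad P))) \<le> b"
  proof -
    have "real (card MW) * (200 * L0 * ?x) \<le> 2 * real q ^ (j - 1) * (200 * L0 * ?x)"
      using cMW L0_pos by (intro mult_right_mono) auto
    moreover have "real (card (M - M1)) * real q ^ j \<le> ?x / L0 * real q ^ j"
      using card_bad by (intro mult_right_mono) auto
    moreover have "b = 2 * real q ^ (j - 1) * (200 * L0 * ?x) + ?x / L0 * real q ^ j"
      by (simp add: b_def algebra_simps)
    ultimately show ?thesis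
      using t1 t2 unfolding sum.distrib by linarith
  qed
  moreover have "0 \<le> b"
    using L0_pos by (simp add: b_def)
  ultimately obtain P where P: "P \<in> S" "(\<Sum>P'\<in>MW. dfc P P') + real (card (bad P)) \<le> b / (?x / 2)"
    using ex_le_average[of S "\<lambda>P. (\<Sum>P'\<in>MW. dfc P P') + real (card (bad P))" b "?x / 2"] fin' cS card_M_ge(2)
    by auto
  have b': "b / (?x / 2) = 800 * L0 * real q ^ (j - 1) + 2 * real q ^ j / L0"
  proof -
    have "y * c / (y / 2) = 2 * c" if "0 < y" for y c :: real
      using that by simp
    then have "b / (?x / 2) = 2 * (400 * L0 * real q ^ (j - 1) + real q ^ j / L0)"
      unfolding b_def using card_M_ge(2) by blast
    then show ?thesis
      by simp
  qed
  have P': "P \<in> lev 1" "\<not> P \<preceq> W" "P \<in> M1" "P \<in> M"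
    using P subs by (auto simp: S_def)
  define W' where "W' = W \<curlyvee> P"
  have W': "W' \<in> lev (j + 1)"
    using rk_jn_point[OF P'(1) WL(1) P'(2)] WL P' by (intro levI) (auto simp: W'_def)
  define ln where "ln R = {Z \<in> M. Z \<preceq> P \<curlyvee> R} - {P}" for R
  have lineeq: "P \<curlyvee> R = Z \<curlyvee> R" if "R \<in> MW" "Z \<in> ln R" "Z \<noteq> R" for R Z
  proof -
    have lv: "R \<in> lev 1" "Z \<in> lev 1" "Z \<preceq> P \<curlyvee> R"
      using that subs M_lev by (auto simp: ln_def)
    have "P \<noteq> R"
      using P' that by (auto simp: MW_def)
    then show ?thesis
      using points_eq_line[of Z R "P \<curlyvee> R"] rk_line[of P R] lv P' that by auto
  qed
  have nle: "\<not> Z \<preceq> W" if "R \<in> MW" "Z \<in> ln R" "Z \<noteq> R" for R Z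
  proof
    assume "Z \<preceq> W"
    have lv: "R \<in> lev 1" "Z \<in> lev 1" "R \<preceq> W"
      using that subs M_lev by (auto simp: ln_def MW_def)
    have "Z \<curlyvee> R \<preceq> W"
      using \<open>Z \<preceq> W\<close> lv WL by (intro jn_least) auto
    then have "P \<curlyvee> R \<preceq> W"
      using lineeq[OF that] by simp
    then show False
      using P' lv WL by (auto simp: jn_le_iff)
  qed
  \<comment> \<open>Two such lines meet in \<open>P\<close> only: otherwise they coincide, and
    \<open>R'\<close> would be a point of the line through \<open>P\<close> and \<open>R\<close>,
    different from \<open>R\<close> but below \<open>W\<close>.\<close>
  have disj: "ln R \<inter> ln R' = {}" if "R \<in> MW" "R' \<in> MW" "R \<noteq> R'" for R R'
  proof (rule ccontr)
    assume "ln R \<inter> ln R' \<noteq> {}"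
    then obtain Z where Z: "Z \<in> ln R" "Z \<in> ln R'"
      by blast
    have lv: "R \<in> lev 1" "R' \<in> lev 1" "Z \<in> lev 1" "R \<preceq> W" "R' \<preceq> W"
      using that Z subs M_lev by (auto simp: ln_def MW_def)
    have ZP: "Z \<noteq> P" "Z \<preceq> P \<curlyvee> R" "Z \<preceq> P \<curlyvee> R'"
      using Z by (auto simp: ln_def)
    have PR: "P \<noteq> R" "P \<noteq> R'"
      using P' lv by auto
    have "P \<curlyvee> R = P \<curlyvee> Z" "P \<curlyvee> R' = P \<curlyvee> Z"
      using points_eq_line[of P Z "P \<curlyvee> R"] points_eq_line[of P Z "P \<curlyvee> R'"]
        rk_line[of P R] rk_line[of P R'] lv P' ZP PR by auto
    then have "R' \<preceq> P \<curlyvee> R"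
      using lv P' by (metis jn2 levD)
    then have "R' \<in> ln R"
      using that(2) subs PR by (auto simp: ln_def)
    then show False
      using nle[OF that(1)] that(3) lv by blast
  qed
  define Y where "Y = (\<Union>R\<in>MW. ln R)"
  have finln: "finite (ln R)" for R
    by (simp add: ln_def)
  have cardY: "real (card Y) = (\<Sum>R\<in>MW. real q - dfc P R)"
  proof -
    have "real (card Y) = (\<Sum>R\<in>MW. real (card (ln R)))"
      unfolding Y_def using fin' finln disj by (subst card_UN_disjoint) auto
    also have "\<dots> = (\<Sum>R\<in>MW. real q - dfc P R)"
    proof (rule sum.cong[OF refl])
      fix R assume "R \<in> MW"
      then have R: "R \<in> lev 1"
        using subs by auto
      have "P \<in> {Z \<in> M. Z \<preceq> P \<curlyvee> R}"
        using P' R by simp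
      then have "card {Z \<in> M. Z \<preceq> P \<curlyvee> R} = Suc (card (ln R))"
        unfolding ln_def by (intro card.remove) auto
      then show "real (card (ln R)) = real q - dfc P R"
        by (simp add: dfc_def onl_def)
    qed
    finally show ?thesis .
  qed
  have "Y \<subseteq> {Z \<in> M1. Z \<preceq> W'} \<union> bad P"
  proof
    fix Z assume "Z \<in> Y"
    then obtain R where R: "R \<in> MW" "Z \<in> ln R"
      by (auto simp: Y_def)
    have lv: "R \<in> lev 1" "Z \<in> lev 1" "R \<preceq> W" "Z \<in> M" "Z \<preceq> P \<curlyvee> R"
      using R subs M_lev by (auto simp: ln_def MW_def)
    have "P \<curlyvee> R \<preceq> W'"
      unfolding W'_def using lv P' WL le_trans[of R W "W \<curlyvee> P"] by (intro jn_least) auto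
    then have ZW': "Z \<preceq> W'"
      using lv P' W' le_trans[of Z "P \<curlyvee> R" W'] by auto
    show "Z \<in> {Z \<in> M1. Z \<preceq> W'} \<union> bad P"
    proof (cases "Z \<in> M1")
      case True
      then show ?thesis
        using ZW' by simp
    next
      case False
      then have "Z \<noteq> R"
        using R by (auto simp: MW_def)
      then show ?thesis
        using nle[OF R] False lv ZW' by (simp add: bad_def W'_def)
    qed
  qed
  then have "card Y \<le> card ({Z \<in> M1. Z \<preceq> W'} \<union> bad P)"
    by (intro card_mono) (auto simp: bad_def)
  also have "\<dots> \<le> card {Z \<in> M1. Z \<preceq> W'} + card (bad P)"
    by (rule card_Un_le)
  finally have "real (card Y) \<le> real (card {Z \<in> M1. Z \<preceq> W'}) + real (card (bad P))"
    by (metis of_nat_add of_nat_mono)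
  moreover have "(\<Sum>R\<in>MW. real q - dfc P R) = real q * real (card MW) - (\<Sum>R\<in>MW. dfc P R)"
    by (simp add: sum_subtractf)
  ultimately have "real q * real (card MW) - (800 * L0 * real q ^ (j - 1) + 2 * real q ^ j / L0)
       \<le> real (card {P \<in> M1. P \<preceq> W'})"
    using cardY P(2) b' by linarith
  then show thesis
    using that[OF W'] by (simp add: MW_def)
qed

text \<open>Joining one point multiplies the collected set by q, up to a relative loss of 800 L0 / q
  + 2 / L0; these losses add up.\<close>

lemma greedy:
  "j \<le> d + 1 \<Longrightarrow> \<exists>W\<in>lev (j + 1).
     real q ^ j * (1 - real j * (800 * L0 / real q + 2 / L0)) \<le> real (card {P \<in> M1. P \<preceq> W})"
proof (induction j)
  case 0
  have "M1 \<noteq> {}"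
  proof
    assume "M1 = {}"
    then have "real (card M) \<le> real (card M) / L0"
      using card_bad by simp
    moreover have "real (card M) / L0 \<le> real (card M) / 2"
      using L0_def by (intro divide_left_mono) auto
    ultimately show False
      using card_M_ge(2) by simp
  qed
  then obtain P where P: "P \<in> M1"
    by blast
  then have "P \<in> {P' \<in> M1. P' \<preceq> P}"
    using M1_sub(2) by auto
  then have "0 < card {P' \<in> M1. P' \<preceq> P}"
    by (auto simp: card_gt_0_iff)
  then have "1 \<le> real (card {P' \<in> M1. P' \<preceq> P})"
    by linarith
  then show ?case
    using P M1_sub(2) by auto
next
  case (Suc j)
  let ?e = "800 * L0 / real q + 2 / L0"
  obtain W where W: "W \<in> lev (j + 1)" "real q ^ j * (1 - real j * ?e) \<le> real (card {P \<in> M1. P \<preceq> W})"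
    using Suc by auto
  obtain W' where W': "W' \<in> lev (j + 1 + 1)"
    "real q * real (card {P \<in> M1. P \<preceq> W}) - (800 * L0 * real q ^ (j + 1 - 1) + 2 * real q ^ (j + 1) / L0)
       \<le> real (card {P \<in> M1. P \<preceq> W'})"
    using greedy_step[OF W(1)] Suc.prems by auto
  have "real q ^ Suc j * (1 - real (Suc j) * ?e) = real q * (real q ^ j * (1 - real j * ?e)) - (800 * L0 * real q ^ (j + 1 - 1) + 2 * real q ^ (j + 1) / L0)"
    by (simp add: field_simps) (simp add: add_divide_distrib)
  also have "\<dots> \<le> real q * real (card {P \<in> M1. P \<preceq> W}) - (800 * L0 * real q ^ (j + 1 - 1) + 2 * real q ^ (j + 1) / L0)"
    using W(2) by (intro diff_right_mono mult_left_mono) auto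
  also have "\<dots> \<le> real (card {P \<in> M1. P \<preceq> W'})"
    by (rule W'(2))
  finally show ?case
    using W'(1) by auto
qed

lemma ex_rich_subspace:
  obtains U where "U \<in> lev (d + 2)" "real q * Q * (1 - 1 / 1000) \<le> real (card {P \<in> M. P \<preceq> U})"
proof -
  obtain U where U: "U \<in> lev (d + 2)"
    "real q ^ (d + 1) * (1 - real (d + 1) * (800 * L0 / real q + 2 / L0)) \<le> real (card {P \<in> M1. P \<preceq> U})"
    using greedy[of "d + 1"] by auto
  have "real (d + 1) * (800 * L0 / real q) \<le> 1 / 2000"
  proof -
    have "160000000000 * (real d + 1)\<^sup>2 \<le> 10000000000000000 * (real d + 1)\<^sup>2"
      by (intro mult_right_mono) auto
    then have "160000000000 * (real d + 1)\<^sup>2 \<le> real q"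
      using q_big by linarith
    then show ?thesis
      by (simp add: L0_def power2_eq_square field_simps)
  qed
  moreover have "real (d + 1) * (2 / L0) \<le> 1 / 2000"
    by (simp add: L0_def field_simps)
  ultimately have "1 - 1 / 1000 \<le> 1 - real (d + 1) * (800 * L0 / real q + 2 / L0)"
    unfolding distrib_left by linarith
  then have "real q * Q * (1 - 1 / 1000) \<le> real q ^ (d + 1) * (1 - real (d + 1) * (800 * L0 / real q + 2 / L0))"
    by (simp add: mult_left_mono)
  also have "\<dots> \<le> real (card {P \<in> M1. P \<preceq> U})"
    by (rule U(2))
  also have "\<dots> \<le> real (card {P \<in> M. P \<preceq> U})"
    using M1_sub(1) by (intro of_nat_mono card_mono) auto
  finally show thesis
    using that U(1) by blast
qed

end

text \<open>Here t is the number of holes and k = [d+1]; nB and nR count \<open>Big\<close> and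
  \<open>MU - Big\<close>; o1, o2, o3 count \<open>O1\<close>, \<open>I2\<close>, \<open>I3\<close>;
  a and cD count \<open>prs - free\<close> and \<open>free\<close>; h is \<open>hsum\<close> and w
  is [d+1]^2 / u. For t < 8 q the bound a \<le> nB + t^2 is exact enough to detect a surplus of a
  single hole. For larger t it suffices that a is at most half of t Q, but then the hyperplanes
  require the discrepancy bound on h.\<close>

lemma holes_arith:
  fixes q Q t :: real
  assumes q: "10000000000000000 \<le> q" and Q: "q * q * q \<le> Q" and t: "q + 1 \<le> t" "t \<le> q * Q / 500"
    and n: "0 \<le> nB" "0 \<le> nR" "nB + nR = q * k + 1 - t" and k: "Q \<le> k" "k \<le> Q + 2 * (Q / q)"
    and o: "0 \<le> o1" "0 \<le> o2" "0 \<le> o3" "o1 + o2 + o3 \<le> t - q"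
    and w: "0 \<le> w" "w \<le> 4 / (q * q)"
    and cD: "t * k - a \<le> cD" "a \<le> nB + t * t" "a \<le> nB * (q + 1)"
    and h: "h \<le> o2 * t" "h \<le> t * o2 / q + sqrt (t * o2 * (2 * (Q * Q) / q))"
    and main: "cD / 2 \<le> nB * (t / Q + w) + nR * (6 * t / (q * q)) + o1 * (2 * t / q + 48 * Q / (q * q)) + h
      + o2 * (48 * Q / (q * q)) + o3 * (2 * Q / 1000000)"
  shows False
proof -
  define R where "R = Q / q"
  define R2 where "R2 = Q / (q * q)"
  have q0: "0 < q"
    using q by linarith
  then have "0 < q * q * q"
    by simp
  then have Q0: "0 < Q"
    using Q by linarith
  have R: "q * R = Q" "q * R2 = R" "10000000000000000 * R \<le> Q" "0 < R" "10000000000000000 * R2 \<le> R" "0 < R2"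
    unfolding R_def R2_def using q0 Q0 q by (auto simp: field_simps)
  have qR: "q * q \<le> R"
    unfolding R_def using q0 Q by (simp add: field_simps)
  have kR: "k \<le> Q + 2 * R"
    using k by (simp add: R_def)
  have qk: "q * k \<le> q * Q + 2 * Q" "q * Q \<le> q * k"
  proof -
    have "q * k \<le> q * (Q + 2 * R)"
      using kR q0 by (intro mult_left_mono) auto
    also have "\<dots> = q * Q + 2 * Q"
      unfolding R(1)[symmetric] by (simp add: algebra_simps)
    finally show "q * k \<le> q * Q + 2 * Q" .
    show "q * Q \<le> q * k"
      using k q0 by (intro mult_left_mono) auto
  qed
  have qQ: "10000000000000000 * Q \<le> q * Q"
    using q Q0 by (intro mult_right_mono) auto
  have t0: "0 < t" "1 \<le> t"
    using t q by linarith+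
  have m: "nB \<le> 2 * (q * Q)" "nR \<le> 2 * (q * Q)"
    using n qk qQ t0 Q0 by linarith+
  have B1: "nB * (t / Q + w) \<le> 2 * q * t + 8 * R"
  proof -
    have "nB * (t / Q + w) \<le> 2 * (q * Q) * (t / Q + 4 / (q * q))"
      using m w t0 Q0 q0 n by (intro mult_mono add_mono) auto
    also have "\<dots> = 2 * q * t + 8 * R"
      unfolding R_def using q0 Q0 by (simp add: field_simps)
    finally show ?thesis .
  qed
  have h48: "48 * Q / (q * q) = 48 * R2"
    by (simp add: R2_def)
  have O3: "o3 * (2 * Q / 1000000) \<le> o3 * (Q / 500000)"
    using o Q0 by simp
  show False
  proof (cases "t < 8 * q")
    case True
    define i where "i = t - q"
    have i1: "1 \<le> i" "t = q + i"
      using t by (auto simp: i_def)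
    have iQ: "Q \<le> i * Q" "i * Q \<le> i * k"
      using i1 Q0 k by (auto intro: mult_left_mono)
    have tt: "t * t \<le> 64 * (q * q)"
    proof -
      have "t * t \<le> (8 * q) * (8 * q)"
        using True t0 by (intro mult_mono) auto
      then show ?thesis
        by simp
    qed
    have "t * k = q * k + i * k"
      unfolding i1(2) by (simp add: algebra_simps)
    \<comment> \<open>Since nB = q k + 1 - t - nR, the leading term q k cancels in t k - nB. What
      survives is i k for the surplus and nR for the points that serve no line; t^2 is only of order
      q^2.\<close>
    then have cD': "i * Q / 2 + nR \<le> cD"
      using cD n tt iQ qR R t0 by linarith
    have B2: "nR * (6 * t / (q * q)) \<le> nR / 100"
    proof -
      have "6 * t / (q * q) \<le> 1 / 100"
      proof -
        have "600 * t \<le> 4800 * q"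
          using True by simp
        also have "\<dots> \<le> q * q"
          using q q0 by (intro mult_right_mono) auto
        finally show ?thesis
          using q0 by (simp add: field_simps)
      qed
      then have "nR * (6 * t / (q * q)) \<le> nR * (1 / 100)"
        using n by (intro mult_left_mono) auto
      then show ?thesis
        by simp
    qed
    have tq: "2 * t / q \<le> 16"
      using True q0 by (simp add: field_simps)
    have q1: "1 \<le> R" "8 * q \<le> R"
    proof -
      have "8 * q \<le> q * q"
        using q q0 by (intro mult_right_mono) auto
      then show "8 * q \<le> R" "1 \<le> R"
        using qR q by linarith+
    qed
    have c1: "o1 * (2 * t / q + 48 * Q / (q * q)) \<le> o1 * (Q / 1000)"
      unfolding h48 using o tq R q1 by (intro mult_left_mono) linarith+
    have c2: "o2 * t + o2 * (48 * Q / (q * q)) \<le> o2 * (Q / 1000)"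
    proof -
      have "t + 48 * R2 \<le> Q / 1000"
        using True R q1 by linarith
      then have "o2 * (t + 48 * R2) \<le> o2 * (Q / 1000)"
        using o by (intro mult_left_mono) auto
      then show ?thesis
        unfolding h48 by (simp add: algebra_simps)
    qed
    have c3: "o3 * (2 * Q / 1000000) \<le> o3 * (Q / 1000)"
      using o Q0 by (intro mult_left_mono) auto
    have "(o1 + o2 + o3) * (Q / 1000) \<le> i * (Q / 1000)"
      using o Q0 by (intro mult_right_mono) (auto simp: i_def)
    then have oth: "o1 * (Q / 1000) + o2 * (Q / 1000) + o3 * (Q / 1000) \<le> i * Q / 1000"
      by (simp add: algebra_simps)
    have "2 * q * t \<le> 2 * q * (8 * q)"
      using True q0 by (intro mult_left_mono) auto
    then have "2 * q * t \<le> 16 * (q * q)"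
      by simp
    then have B1': "nB * (t / Q + w) \<le> 24 * R"
      using B1 qR by linarith
    have "cD / 2 \<le> 24 * R + nR / 100 + i * Q / 1000"
      using main B1' B2 c1 c2 c3 oth h(1) by linarith
    then show False
      using cD' iQ R n(2) Q0 by linarith
  next
    case False
    have t8: "8 * q \<le> t"
      using False by simp
    have tQ: "t * Q \<le> t * k" "8 * (q * Q) \<le> t * Q"
      using t0 k Q0 mult_right_mono[OF t8, of Q] by (auto intro: mult_left_mono)
    \<comment> \<open>The threshold 8 q makes nB \<le> 2 q Q at most a quarter of t Q. The term t^2
      is harmless for t \<le> Q / 8; beyond that the cruder bound of q + 1 holes per line is good
      enough because t exceeds 4 q^2 by far.\<close>
    have a: "a \<le> t * Q / 2"
    proof (cases "8 * t \<le> Q")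
      case True
      then have "8 * t * t \<le> Q * t"
        using t0 by (intro mult_right_mono) auto
      then have "t * t \<le> t * Q / 8"
        by (simp add: ac_simps)
      then show ?thesis
        using cD(2) m tQ mult_pos_pos[OF t0(1) Q0] by linarith
    next
      case False
      have "nB * (q + 1) \<le> 2 * (q * Q) * (2 * q)"
        using m n q by (intro mult_mono) auto
      also have "\<dots> = 4 * (q * q) * Q"
        by simp
      also have "\<dots> \<le> t / 2 * Q"
      proof (rule mult_right_mono)
        have "64 * (q * q) \<le> q * (q * q)"
          using q q0 by (intro mult_right_mono) auto
        then show "4 * (q * q) \<le> t / 2"
          using False Q by (simp add: ac_simps)
      qed (use Q0 in simp)
      finally show ?thesis
        using cD(3) by linarith
    qed
    have cD': "t * Q / 2 \<le> cD"
      using cD(1) a tQ by linarith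
    have ot: "o1 \<le> t" "o2 \<le> t" "o3 \<le> t"
      using o q0 by linarith+
    have tR: "q * (t * R) = t * Q" "q * (t * R2) = t * R" "0 < t * R" "0 < t * R2"
      using R t0 by (auto simp: ac_simps)
    have tR': "10000000000000000 * (t * R) \<le> t * Q" "10000000000000000 * (t * R2) \<le> t * R"
      using R t0 by (auto simp: mult.left_commute[of _ t] intro: mult_left_mono)
    have B2: "nR * (6 * t / (q * q)) \<le> 12 * (t * R)"
    proof -
      have "nR * (6 * t / (q * q)) \<le> 2 * (q * Q) * (6 * t / (q * q))"
        using m t0 q0 by (intro mult_right_mono) auto
      also have "\<dots> = 12 * (t * R)"
        unfolding R_def using q0 by (simp add: field_simps)
      finally show ?thesis .
    qed
    have tt: "t * t / q \<le> t * Q / 500"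
    proof -
      have "t * t \<le> t * (q * Q / 500)"
        using t t0 by (intro mult_left_mono) auto
      then show ?thesis
        using q0 by (simp add: field_simps)
    qed
    have c1: "o1 * (2 * t / q + 48 * Q / (q * q)) \<le> t * Q / 250 + 48 * (t * R2)"
    proof -
      have "o1 * (2 * t / q + 48 * Q / (q * q)) \<le> t * (2 * t / q + 48 * Q / (q * q))"
        using ot t0 q0 Q0 by (intro mult_right_mono) auto
      also have "\<dots> = 2 * (t * t / q) + 48 * (t * R2)"
        by (simp add: R2_def algebra_simps)
      finally show ?thesis
        using tt by linarith
    qed
    have c2: "o2 * (48 * Q / (q * q)) \<le> 48 * (t * R2)"
    proof -
      have "o2 * (48 * Q / (q * q)) \<le> t * (48 * Q / (q * q))"
        using ot q0 Q0 by (intro mult_right_mono) auto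
      then show ?thesis
        by (simp add: R2_def algebra_simps)
    qed
    have c3: "o3 * (2 * Q / 1000000) \<le> t * Q / 500000"
      using mult_right_mono[OF ot(3), of "2 * Q / 1000000"] Q0 by simp
    have h': "h \<le> t * Q / 500 + t * Q / 1000"
    proof -
      have "t * o2 / q \<le> t * t / q"
        using ot t0 q0 by (intro divide_right_mono mult_left_mono) auto
      moreover have "sqrt (t * o2 * (2 * (Q * Q) / q)) \<le> t * Q / 1000"
      proof (rule real_le_lsqrt)
        have "t * o2 * (2 * (Q * Q) / q) \<le> t * t * (2 * (Q * Q) / q)"
          using ot t0 q0 Q0 by (intro mult_right_mono mult_left_mono) auto
        also have "\<dots> = (t * t * Q * Q) * (2 / q)"
          by simp
        also have "\<dots> \<le> (t * t * Q * Q) * (1 / 1000000)"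
          using q q0 t0 Q0 by (intro mult_left_mono) (auto simp: field_simps)
        also have "\<dots> = (t * Q / 1000)\<^sup>2"
          by (simp add: power2_eq_square)
        finally show "t * o2 * (2 * (Q * Q) / q) \<le> (t * Q / 1000)\<^sup>2" .
      qed (use t0 Q0 o q0 in auto)
      ultimately show ?thesis
        using h(2) tt by linarith
    qed
    have q4: "10000000000000000 * (2 * q * t) \<le> 2 * (t * Q)"
    proof -
      have "10000000000000000 * q \<le> q * q"
        using q q0 by (intro mult_right_mono) auto
      then have "10000000000000000 * q \<le> Q"
        using qR R by linarith
      then have "10000000000000000 * q * (2 * t) \<le> Q * (2 * t)"
        using t0 by (intro mult_right_mono) auto
      then show ?thesis
        by (simp add: ac_simps)
    qed
    have Rt: "R \<le> t * R"
      using t0 R by simp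
    have "cD / 2 \<le> 2 * q * t + 8 * (t * R) + 12 * (t * R) + (t * Q / 250 + 48 * (t * R2)) + (t * Q / 500 + t * Q / 1000)
      + 48 * (t * R2) + t * Q / 500000"
      using main B1 B2 c1 c2 c3 h' Rt by linarith
    then show False
      using cD' tR' tR q4 t0 Q0 by linarith
  qed
qed

context qcover_points
begin

lemma a2_le: "real q * Q * a2 \<le> a1"
proof -
  have e: "d - 1 + (d + 1) = 2 * d"
    using d3 by simp
  have "real q ^ (d + 1) * qint q (d - 1) \<le> qint q (2 * d)"
    using qint_power_mult_le[of q "d + 1" "d - 1"] unfolding e .
  then have "a2 * (real q ^ (d + 1) * qint q (d - 1)) \<le> a2 * qint q (2 * d)"
    using a23_pos by (intro mult_left_mono) auto
  then have "(real q * Q * a2) * qint q (d - 1) \<le> a1 * qint q (d - 1)"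
    unfolding a2_a1 by (simp add: ac_simps)
  moreover have "0 < qint q (d - 1)"
    using d3 by (intro qint_pos) simp
  ultimately show ?thesis
    by (simp add: mult_le_cancel_right)
qed

text \<open>This counts the flags whose small member contains a given point and whose large member
  contains a given line through it. It is also the number of flags with a given point in the small
  member and the large member in a given hyperplane through that point.\<close>

definition u :: real where "u = G * qint q d"

lemma u_pos: "0 < u"
  using G_pos d3 by (simp add: u_def qint_pos)

lemma fl_u: "fl = u * (Q + 1)"
proof -
  have "qint q (2 * d) = qint q d * (Q + 1)"
  proof -
    have "qint q (d + j) = qint q d + Q * qint q j" for j
      by (induction j) (simp_all add: qint_Suc algebra_simps power_add)
    then show ?thesis
      unfolding mult_2 by (simp add: distrib_left mult.commute)
  qed
  then show ?thesis
    by (simp add: fl_def u_def)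
qed

lemma fl_le: "fl \<le> 2 * Q * u"
proof -
  have "u * (Q + 1) \<le> u * (2 * Q)"
    using u_pos by (intro mult_left_mono) auto
  then show ?thesis
    by (simp add: fl_u ac_simps)
qed

lemma w_le: "(qint q (d + 1))\<^sup>2 / u \<le> 4 / (real q * real q)"
proof -
  have "(qint q (d + 1))\<^sup>2 \<le> (2 * Q)\<^sup>2"
    using qint_le_2power[of q d] by (intro power_mono) auto
  then have 1: "(qint q (d + 1))\<^sup>2 * (real q * real q) \<le> 4 * (Q * Q * (real q * real q))"
    by (simp add: power2_eq_square)
  have "Q * Q * (real q * real q) = real q ^ (2 * d + 2)"
    by (simp add: power_add[symmetric] mult_2)
  also have "\<dots> \<le> real q ^ (d * (d - 1) + (d - 1))"
  proof (rule power_increasing)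
    obtain m where m: "d = Suc (Suc (Suc m))"
      by (rule d_Suc)
    \<comment> \<open>This is (d - 3) (d + 1) \<ge> 0, so d = 3 is the extreme case.\<close>
    show "2 * d + 2 \<le> d * (d - 1) + (d - 1)"
      unfolding m by simp
  qed simp
  also have "\<dots> = real q ^ (d * (d - 1)) * real q ^ (d - 1)"
    by (rule power_add)
  also have "\<dots> \<le> G * qint q d"
    using G_ge qint_ge_power[of q "d - 1"] d3 G_pos by (intro mult_mono) auto
  finally have "Q * Q * (real q * real q) \<le> u"
    by (simp add: u_def)
  then have "(qint q (d + 1))\<^sup>2 * (real q * real q) \<le> 4 * u"
    using 1 by linarith
  then show ?thesis
    using u_pos by (simp add: field_simps)
qed

end

section \<open>Holes of the rich subspace\<close>

locale qcover_rich = qcover_points +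
  fixes U :: 'a
  assumes U: "U \<in> lev (d + 2)"
    and rich: "real q * Q * (1 - 1 / 1000) \<le> real (card {P \<in> M. P \<preceq> U})"
begin

text \<open>\<open>S\<close> is the set of holes, \<open>O1\<close> the members of \<open>I1\<close> not chosen to represent a point of \<open>MU\<close>.  Flags whose
  members meet \<open>U\<close> in a hole and in a line \<open>l\<close> can be covered efficiently only by the part of \<open>C (ch P)\<close>
  beyond its pencil, for a point \<open>P\<close> of \<open>l\<close>; by \<open>intersecting_dichotomy\<close> each \<open>P\<close> serves at
  most one line \<open>lP P\<close>.  The pairs in \<open>free\<close> are those whose line is served by no point.\<close>

definition MU :: "'a set" where "MU = {P \<in> M. P \<preceq> U}"
definition S :: "'a set" where "S = {P \<in> lev 1. P \<preceq> U \<and> P \<notin> M}"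
definition ch :: "'a \<Rightarrow> 'b" where "ch P = (SOME i. i \<in> I1 \<and> pt i = P)"
definition O1 :: "'b set" where "O1 = I1 - ch ` MU"
definition prs :: "('a \<times> 'a) set" where
  "prs = {(Q, l). Q \<in> S \<and> l \<in> lev 2 \<and> Q \<preceq> l \<and> l \<preceq> U}"
definition Fp :: "'a \<times> 'a \<Rightarrow> ('a \<times> 'a) set" where
  "Fp p = {(A, B) \<in> FL. A \<curlywedge> U = fst p \<and> B \<curlywedge> U = snd p}"
definition BBP :: "'a \<Rightarrow> 'a set" where "BBP P = snd ` (C (ch P) - pencil P)"
definition heavy :: "'a \<Rightarrow> 'a \<Rightarrow> bool" where
  "heavy P l \<longleftrightarrow> l \<in> lev 2 \<and> P \<preceq> l \<and> real (card {B \<in> BBP P. \<not> l \<preceq> B}) \<le> qint q (d + 1)"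
definition Big :: "'a set" where "Big = {P \<in> MU. \<exists>l. heavy P l}"
definition lP :: "'a \<Rightarrow> 'a" where "lP P = (SOME l. heavy P l)"
definition free :: "('a \<times> 'a) set" where "free = {p \<in> prs. \<forall>P\<in>Big. snd p \<noteq> lP P}"
definition TT :: "('a \<times> 'a) set" where "TT = (\<Union>p\<in>free. Fp p)"

lemma U_L [simp]: "U \<in> L" "rk U = d + 2"
  using U by auto

lemma ch: "P \<in> MU \<Longrightarrow> ch P \<in> I1" "P \<in> MU \<Longrightarrow> pt (ch P) = P"
proof -
  assume "P \<in> MU"
  then have "\<exists>i. i \<in> I1 \<and> pt i = P"
    by (auto simp: MU_def M_def)
  then have "ch P \<in> I1 \<and> pt (ch P) = P"
    unfolding ch_def by (rule someI_ex)
  then show "ch P \<in> I1" "pt (ch P) = P"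
    by auto
qed

lemma MU_lev: "MU \<subseteq> lev 1" "MU \<subseteq> M" and S_lev: "S \<subseteq> lev 1" and MU_S: "MU \<inter> S = {}"
  using M_lev by (auto simp: MU_def S_def)

lemma finite_MU [simp]: "finite MU" and finite_S [simp]: "finite S" and finite_Big [simp]: "finite Big"
  by (simp_all add: MU_def S_def Big_def)

lemma finite_prs [simp]: "finite prs"
proof -
  have "prs \<subseteq> S \<times> lev 2"
    by (auto simp: prs_def)
  then show ?thesis
    by (rule finite_subset) auto
qed

lemma finite_free [simp]: "finite free"
  by (simp add: free_def)

lemma finite_Fp [simp]: "finite (Fp p)"
  by (rule finite_subset[OF _ finite_FL]) (auto simp: Fp_def)

lemma finite_TT [simp]: "finite TT"
  by (simp add: TT_def)

lemma C_ch: "P \<in> MU \<Longrightarrow> indep (C (ch P))" "P \<in> MU \<Longrightarrow> pencil P \<subseteq> C (ch P)"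
  using ch indep_C pt by fastforce+

lemma card_MU_S: "real (card MU) + real (card S) = qint q (d + 2)"
proof -
  have "{P \<in> lev 1. P \<preceq> U} = MU \<union> S"
    using M_lev by (auto simp: MU_def S_def)
  then have "card {P \<in> lev 1. P \<preceq> U} = card MU + card S"
    using MU_S by (simp add: card_Un_disjoint)
  then show ?thesis
    using card_points_below[of U] by simp
qed

lemma card_others:
  "real (card O1) + real (card I2) + real (card I3) \<le> real (card S) - real q"
proof -
  have "inj_on ch MU"
    by (intro inj_onI) (metis ch(2))
  then have "card (ch ` MU) = card MU"
    by (rule card_image)
  moreover have "ch ` MU \<subseteq> I1"
    using ch by auto
  ultimately have "card I1 = card O1 + card MU"
    unfolding O1_def using fin_I by (metis card_Diff_subset card_mono finite_imageI finite_MU le_add_diff_inverse2)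
  then show ?thesis
    using card_I card_MU_S by simp
qed

lemma card_prs: "real (card prs) = real (card S) * qint q (d + 1)"
proof -
  have "prs = (SIGMA Q:S. {l \<in> lev 2. Q \<preceq> l \<and> l \<preceq> U})"
    by (auto simp: prs_def)
  then have "real (card prs) = (\<Sum>Q\<in>S. real (card {l \<in> lev 2. Q \<preceq> l \<and> l \<preceq> U}))"
    by simp
  also have "\<dots> = (\<Sum>Q\<in>S. qint q (d + 1))"
  proof (rule sum.cong[OF refl])
    fix R assume "R \<in> S"
    then have "R \<in> lev 1" "R \<preceq> U"
      by (auto simp: S_def)
    then show "real (card {l \<in> lev 2. R \<preceq> l \<and> l \<preceq> U}) = qint q (d + 1)"
      using card_covers_between[of R U 2] by simp
  qed
  finally show ?thesis
    by simp
qed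

text \<open>Of the G large members above \<open>l\<close>, those meeting \<open>U\<close> in more
  than \<open>l\<close> contain one of the [d] planes of \<open>U\<close> through \<open>l\<close>,
  which are at most 2 G / q. Each of the others carries q^(d-1) suitable small members.\<close>

lemma card_Fp:
  assumes p: "p \<in> prs"
  shows "u / 2 \<le> real (card (Fp p))"
proof -
  obtain R l where p': "p = (R, l)" "R \<in> S" "l \<in> lev 2" "R \<preceq> l" "l \<preceq> U"
    using p by (auto simp: prs_def)
  have R: "R \<in> lev 1" "R \<preceq> U"
    using p'(2) by (auto simp: S_def)
  define BL where "BL = {B \<in> lev (d + 1). l \<preceq> B}"
  define E where "E = {e \<in> lev 3. l \<preceq> e \<and> e \<preceq> U}"
  define bad where "bad = (\<Union>e\<in>E. {B \<in> lev (d + 1). e \<preceq> B})"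
  define gd where "gd = {B \<in> BL. B \<curlywedge> U = l}"
  have fin': "finite BL" "finite E" "finite bad"
    by (auto simp: BL_def E_def bad_def)
  have sub: "BL - gd \<subseteq> bad"
  proof
    fix B assume "B \<in> BL - gd"
    then have B: "B \<in> lev (d + 1)" "l \<preceq> B" "B \<curlywedge> U \<noteq> l"
      by (auto simp: BL_def gd_def)
    have lBU: "l \<preceq> B \<curlywedge> U"
      using B p' by (auto intro: mt_greatest)
    have "\<not> B \<curlywedge> U \<preceq> l"
      using le_antisym[OF lBU] B p' by auto
    then obtain e where "e \<in> L" "l \<preceq> e" "e \<preceq> B \<curlywedge> U" "rk e = Suc (rk l)"
      using ex_cover_not_le[of l l "B \<curlywedge> U"] lBU B p' by auto
    then show "B \<in> bad"
      using B p' unfolding bad_def E_def by (auto simp: le_mt_iff intro!: levI)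
  qed
  have "real (card bad) \<le> real (card E) * (G / Q)"
    unfolding bad_def using card_big_above_plane fin' by (intro card_UN_le_mult) (auto simp: E_def)
  moreover have "real (card E) = qint q d"
    unfolding E_def using card_covers_between[of l U 3] p' by simp
  ultimately have "real (card bad) \<le> (2 * (Q / real q)) * (G / Q)"
    using qint_d_le G_pos mult_right_mono[of "qint q d" "2 * (Q / real q)" "G / Q"] by simp
  then have bad: "real (card bad) \<le> 2 * G / real q"
    by (simp add: field_simps)
  have "card BL \<le> card (gd \<union> bad)"
    using sub fin' by (intro card_mono) (auto simp: gd_def)
  then have "card BL \<le> card gd + card bad"
    using card_Un_le[of gd bad] by linarith
  then have "G \<le> real (card gd) + real (card bad)"
    using card_big_above_line[OF p'(3)] unfolding BL_def by linarith
  then have gd: "G * (1 - 2 / real q) \<le> real (card gd)"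
    using bad by (simp add: algebra_simps)
  have gdl: "B \<in> lev (d + 1)" "l \<preceq> B" "B \<curlywedge> U = l" if "B \<in> gd" for B
    using that by (auto simp: gd_def BL_def)
  define AA where "AA = (\<lambda>B. {A \<in> lev d. R \<preceq> A \<and> A \<preceq> B \<and> \<not> l \<preceq> A})"
  \<comment> \<open>Small members in \<open>B\<close> through \<open>R\<close> number [d], those
    through all of \<open>l\<close> number [d-1].\<close>
  have cA: "real (card (AA B)) = real q ^ (d - 1)" if B: "B \<in> gd" for B
  proof -
    have RB: "R \<preceq> B"
      using le_trans[of R l B] p' R gdl[OF B] by auto
    have "{A \<in> lev d. R \<preceq> A \<and> A \<preceq> B} = AA B \<union> {A \<in> lev d. l \<preceq> A \<and> A \<preceq> B}"
      using le_trans[of R l] p' R by (auto simp: AA_def)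
    then have "card {A \<in> lev d. R \<preceq> A \<and> A \<preceq> B} = card (AA B) + card {A \<in> lev d. l \<preceq> A \<and> A \<preceq> B}"
      by (simp, subst card_Un_disjoint) (auto simp: AA_def)
    moreover have "real (card {A \<in> lev d. R \<preceq> A \<and> A \<preceq> B}) = qint q d"
      using card_coatoms_between[of R B d] R RB gdl[OF B] d3 by simp
    moreover have "real (card {A \<in> lev d. l \<preceq> A \<and> A \<preceq> B}) = qint q (d - 1)"
      using card_coatoms_between[of l B d] p' gdl[OF B] d3 by simp
    moreover have "qint q d = qint q (d - 1) + real q ^ (d - 1)"
      using qint_Suc[of q "d - 1"] d3 by simp
    ultimately show ?thesis
      by simp
  qed
  have "prod.swap ` (SIGMA B:gd. AA B) \<subseteq> Fp p"
  proof
    fix F assume "F \<in> prod.swap ` (SIGMA B:gd. AA B)"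
    then obtain A B where F: "F = (A, B)" "B \<in> gd" "A \<in> AA B"
      by auto
    have A: "A \<in> lev d" "R \<preceq> A" "A \<preceq> B" "\<not> l \<preceq> A"
      using F by (auto simp: AA_def)
    note B = gdl[OF F(2)]
    have 1: "A \<curlywedge> U \<preceq> l"
      unfolding B(3)[symmetric] using A B by (intro mt_mono) auto
    have 2: "R \<preceq> A \<curlywedge> U"
      using A R by (auto intro: mt_greatest)
    have "A \<curlywedge> U \<noteq> l"
      using A p' mt1[of A U] by auto
    then have "rk (A \<curlywedge> U) < 2"
      using rk_strict[OF 1] A p' by auto
    then have "R = A \<curlywedge> U"
      using rk_eqD[OF 2] A R by auto
    then show "F \<in> Fp p"
      using F A B p' by (auto simp: Fp_def FL_def)
  qed
  then have "card (prod.swap ` (SIGMA B:gd. AA B)) \<le> card (Fp p)"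
    by (intro card_mono) auto
  moreover have "card (prod.swap ` (SIGMA B:gd. AA B)) = (\<Sum>B\<in>gd. card (AA B))"
    using fin' by (simp add: card_image gd_def AA_def)
  ultimately have "(\<Sum>B\<in>gd. real (card (AA B))) \<le> real (card (Fp p))"
    by (metis of_nat_mono of_nat_sum)
  then have "real (card gd) * real q ^ (d - 1) \<le> real (card (Fp p))"
    using cA by simp
  moreover have "G * (1 - 2 / real q) * real q ^ (d - 1) \<le> real (card gd) * real q ^ (d - 1)"
    using gd by (intro mult_right_mono) auto
  moreover have "u / 2 \<le> G * (1 - 2 / real q) * real q ^ (d - 1)"
  proof -
    obtain n where n: "d = Suc (Suc n)"
      using d_Suc by blast
    have "qint q d \<le> 2 * real q ^ n + real q ^ Suc n"
      using qint_le_2power[of q n] unfolding n by (simp add: qint_Suc[of q "Suc n"])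
    also have "\<dots> \<le> 2 * ((1 - 2 / real q) * real q ^ Suc n)"
    proof -
      have "6 * real q ^ n \<le> real q * real q ^ n"
        using q_ge(1) by (intro mult_right_mono) auto
      then show ?thesis
        by (simp add: algebra_simps)
    qed
    finally have "G * qint q d \<le> G * (2 * ((1 - 2 / real q) * real q ^ (d - 1)))"
      using G_pos by (intro mult_left_mono) (auto simp: n)
    then show ?thesis
      by (simp add: u_def)
  qed
  ultimately show ?thesis
    by linarith
qed

lemma card_TT: "real (card free) * (u / 2) \<le> real (card TT)"
proof -
  have "card TT = (\<Sum>p\<in>free. card (Fp p))"
    unfolding TT_def
  proof (rule card_UN_disjoint)
    show "finite free" "\<forall>p\<in>free. finite (Fp p)"
      by simp_all
    show "\<forall>p\<in>free. \<forall>p'\<in>free. p \<noteq> p' \<longrightarrow> Fp p \<inter> Fp p' = {}"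
      by (auto simp: Fp_def)
  qed
  then have "real (card TT) = (\<Sum>p\<in>free. real (card (Fp p)))"
    by simp
  moreover have "(\<Sum>p\<in>free. u / 2) \<le> (\<Sum>p\<in>free. real (card (Fp p)))"
    using card_Fp by (intro sum_mono) (auto simp: free_def)
  ultimately show ?thesis
    by simp
qed

lemma lP: "P \<in> Big \<Longrightarrow> heavy P (lP P)"
  unfolding Big_def lP_def by (auto intro: someI_ex)

text \<open>For few holes a served line should count for one pair: m holes on a line are at most 1 +
  m (m - 1), and the ordered pairs of distinct holes, each on one line only, number at most the
  square of the number of holes. The second bound just uses that a line has q + 1 points.\<close>

lemma card_assigned:
  "real (card (prs - free)) \<le> real (card Big) + real (card S) * real (card S)"
  "real (card (prs - free)) \<le> real (card Big) * (real q + 1)"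
proof -
  define LL where "LL = {l \<in> lP ` Big. l \<preceq> U}"
  define h where "h l = {R \<in> S. R \<preceq> l}" for l
  have LL_lev: "LL \<subseteq> lev 2"
    using lP by (auto simp: LL_def heavy_def)
  have finL: "finite LL" "finite (h l)" for l
    by (simp_all add: LL_def h_def)
  have sub: "prs - free \<subseteq> prod.swap ` (SIGMA l:LL. h l)"
    by (auto simp: prs_def free_def LL_def h_def image_iff)
  have "card (prs - free) \<le> card (prod.swap ` (SIGMA l:LL. h l))"
    using finL by (intro card_mono[OF _ sub]) auto
  also have "\<dots> = (\<Sum>l\<in>LL. card (h l))"
    using finL by (simp add: card_image)
  finally have le: "real (card (prs - free)) \<le> (\<Sum>l\<in>LL. real (card (h l)))"
    by (metis of_nat_mono of_nat_sum)
  have cL: "real (card LL) \<le> real (card Big)"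
    unfolding LL_def by (intro of_nat_mono order_trans[OF card_mono card_image_le]) auto
  have "real (card (h l)) \<le> real q + 1" if "l \<in> LL" for l
  proof -
    have l: "l \<in> lev 2"
      using that LL_lev by auto
    have "card (h l) \<le> card {R \<in> lev 1. R \<preceq> l}"
      using S_lev by (intro card_mono) (auto simp: h_def)
    then have "real (card (h l)) \<le> qint q 2"
      using card_points_below[of l] l by simp
    also have "\<dots> = real q + 1"
      by (simp add: qint_def numeral_2_eq_2)
    finally show ?thesis .
  qed
  then have "(\<Sum>l\<in>LL. real (card (h l))) \<le> (\<Sum>l\<in>LL. real q + 1)"
    by (intro sum_mono)
  also have "\<dots> \<le> real (card Big) * (real q + 1)"
    using cL by (simp add: mult_right_mono)
  finally show "real (card (prs - free)) \<le> real (card Big) * (real q + 1)"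
    using le by linarith
  have "(\<Sum>l\<in>LL. real (card (h l))) \<le> (\<Sum>l\<in>LL. 1 + real (card {p \<in> h l \<times> h l. fst p \<noteq> snd p}))"
  proof (rule sum_mono)
    fix l
    show "real (card (h l)) \<le> 1 + real (card {p \<in> h l \<times> h l. fst p \<noteq> snd p})"
    proof (cases "h l = {}")
      case False
      then obtain R where R: "R \<in> h l"
        by blast
      have "(\<lambda>R'. (R, R')) ` (h l - {R}) \<subseteq> {p \<in> h l \<times> h l. fst p \<noteq> snd p}"
        using R by auto
      then have "card ((\<lambda>R'. (R, R')) ` (h l - {R})) \<le> card {p \<in> h l \<times> h l. fst p \<noteq> snd p}"
        using finL by (intro card_mono) auto
      moreover have "card ((\<lambda>R'. (R, R')) ` (h l - {R})) = card (h l - {R})"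
        by (intro card_image inj_onI) auto
      moreover have "card (h l) = Suc (card (h l - {R}))"
        using R finL by (intro card.remove) auto
      ultimately show ?thesis
        by linarith
    qed simp
  qed
  also have "\<dots> = real (card LL) + (\<Sum>l\<in>LL. real (card {p \<in> h l \<times> h l. fst p \<noteq> snd p}))"
    by (simp add: sum.distrib)
  also have "(\<Sum>l\<in>LL. real (card {p \<in> h l \<times> h l. fst p \<noteq> snd p})) \<le> real (card S) * real (card S)"
  proof -
    have "(\<Sum>l\<in>LL. card {p \<in> h l \<times> h l. fst p \<noteq> snd p}) = card (\<Union>l\<in>LL. {p \<in> h l \<times> h l. fst p \<noteq> snd p})"
    proof (rule card_UN_disjoint[symmetric])
      show "\<forall>l\<in>LL. \<forall>l'\<in>LL. l \<noteq> l' \<longrightarrow> {p \<in> h l \<times> h l. fst p \<noteq> snd p} \<inter> {p \<in> h l' \<times> h l'. fst p \<noteq> snd p} = {}"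
      proof (intro ballI impI, rule ccontr)
        fix l l' assume ll: "l \<in> LL" "l' \<in> LL" "l \<noteq> l'"
          and "{p \<in> h l \<times> h l. fst p \<noteq> snd p} \<inter> {p \<in> h l' \<times> h l'. fst p \<noteq> snd p} \<noteq> {}"
        then obtain R R' where "R \<in> h l" "R' \<in> h l" "R \<in> h l'" "R' \<in> h l'" "R \<noteq> R'"
          by fastforce
        then have "l = R \<curlyvee> R'" "l' = R \<curlyvee> R'"
          using points_eq_line[of R R' l] points_eq_line[of R R' l'] ll LL_lev S_lev by (auto simp: h_def)
        then show False
          using ll by simp
      qed
    qed (use finL in auto)
    also have "\<dots> \<le> card (S \<times> S)"
      by (intro card_mono) (auto simp: h_def)
    finally show ?thesis
      by (simp add: card_cartesian_product flip: of_nat_sum of_nat_mult)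
  qed
  finally show "real (card (prs - free)) \<le> real (card Big) + real (card S) * real (card S)"
    using le cL by linarith
qed

end

context qcover_rich
begin

lemma TT_cases:
  assumes "(A, B) \<in> TT"
  obtains R l where "(R, l) \<in> free" "R \<in> S" "R \<in> lev 1" "l \<in> lev 2" "R \<preceq> l" "l \<preceq> U" "A \<curlywedge> U = R" "B \<curlywedge> U = l"
    "A \<in> lev d" "B \<in> lev (d + 1)" "A \<preceq> B" "(A, B) \<in> FL" "R \<preceq> A" "l \<preceq> B"
proof -
  obtain R l where p: "(R, l) \<in> free" "(A, B) \<in> Fp (R, l)"
    using assms by (auto simp: TT_def)
  have AB: "A \<in> lev d" "B \<in> lev (d + 1)" "A \<preceq> B" "A \<curlywedge> U = R" "B \<curlywedge> U = l" "(A, B) \<in> FL"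
    using p by (auto simp: Fp_def FL_def)
  have Rl: "R \<in> S" "l \<in> lev 2" "R \<preceq> l" "l \<preceq> U"
    using p by (auto simp: free_def prs_def)
  have "R \<preceq> A" "l \<preceq> B"
    using AB mt1[of A U] mt1[of B U] by auto
  then show thesis
    using that[OF p(1)] Rl AB S_lev by auto
qed

text \<open>The small member of such a flag meets \<open>U\<close> in a single point, and that point
  is a hole. So the pencil of a point of \<open>U\<close> in \<open>M\<close> covers nothing of
  \<open>TT\<close>.\<close>

lemma point_of_MU_not_le:
  assumes "P \<in> MU" "(A, B) \<in> TT"
  shows "\<not> P \<preceq> A"
proof
  assume le: "P \<preceq> A"
  obtain R where R: "R \<in> S" "A \<curlywedge> U = R" "A \<in> lev d" "R \<in> lev 1"
    using assms(2) by (elim TT_cases)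
  have P: "P \<in> lev 1" "P \<preceq> U"
    using assms(1) MU_lev by (auto simp: MU_def)
  have "P \<preceq> R"
    unfolding R(2)[symmetric] using P R le by (auto intro: mt_greatest)
  then have "P = R"
    using rk_eqD[of P R] P R by auto
  then show False
    using assms(1) R MU_S by auto
qed

lemma chosen_cases:
  assumes P: "P \<in> MU" and AB: "(A, B) \<in> C (ch P)" "(A, B) \<in> TT"
  shows "B \<in> BBP P" "P \<preceq> B" "\<not> P \<preceq> A"
proof -
  have Pl: "P \<in> lev 1"
    using P MU_lev by auto
  show n: "\<not> P \<preceq> A"
    by (rule point_of_MU_not_le[OF P AB(2)])
  show "B \<in> BBP P"
    using AB n unfolding BBP_def pencil_def by force
  show "P \<preceq> B"
    using indep_pencil_le[OF C_ch[OF P] Pl AB(1)] .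
qed

lemma BBP_props:
  assumes P: "P \<in> MU"
  shows "BBP P \<subseteq> lev (d + 1)" "\<And>B. B \<in> BBP P \<Longrightarrow> P \<preceq> B"
    "\<And>B B'. B \<in> BBP P \<Longrightarrow> B' \<in> BBP P \<Longrightarrow> 2 \<le> rk (B \<curlywedge> B')"
proof -
  have Pl: "P \<in> lev 1"
    using P MU_lev by auto
  have ex: "\<exists>A. (A, B) \<in> C (ch P) \<and> \<not> P \<preceq> A" if B: "B \<in> BBP P" for B
  proof -
    obtain A where A: "(A, B) \<in> C (ch P) - pencil P"
      using B unfolding BBP_def by (metis imageE prod.collapse)
    then have "(A, B) \<in> FL"
      using indep_FL[OF C_ch(1)[OF P]] by auto
    then show ?thesis
      using A by (auto simp: pencil_def)
  qed
  show "BBP P \<subseteq> lev (d + 1)"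
    using ex indep_FL[OF C_ch(1)[OF P]] by (fastforce simp: FL_def)
  show "\<And>B. B \<in> BBP P \<Longrightarrow> P \<preceq> B"
    using ex indep_pencil_le[OF C_ch[OF P] Pl] by blast
  show "\<And>B B'. B \<in> BBP P \<Longrightarrow> B' \<in> BBP P \<Longrightarrow> 2 \<le> rk (B \<curlywedge> B')"
    using ex indep_pencil_mt[OF C_ch[OF P] Pl] by blast
qed

lemma finite_BBP: "P \<in> MU \<Longrightarrow> finite (BBP P)"
  using BBP_props(1) finite_lev finite_subset by blast

lemma not_heavy:
  assumes P: "P \<in> MU - Big" and l: "l \<in> lev 2" "P \<preceq> l"
  shows "real (card {B \<in> BBP P. l \<preceq> B}) \<le> 6 * G / (real q)\<^sup>2"
proof -
  have Pl: "P \<in> lev 1" "P \<in> MU"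
    using P MU_lev by auto
  have "\<not> heavy P l"
    using P by (auto simp: Big_def)
  then have "\<not> real (card {B \<in> BBP P. \<not> l \<preceq> B}) \<le> qint q (d + 1)"
    using l by (simp add: heavy_def)
  then show ?thesis
    using intersecting_dichotomy[OF BBP_props[OF Pl(2)] Pl(1) l] by blast
qed

text \<open>Flags whose large member avoids the served line \<open>l\<close> are at most [d+1]^2.
  For the others the hole \<open>R\<close> is not on \<open>l\<close>, so a whole plane
  \<open>l \<curlyvee> R\<close> is prescribed below the large member, at a cost of q^d for each
  hole.\<close>

lemma cover_Big:
  assumes P: "P \<in> Big"
  shows "real (card (C (ch P) \<inter> TT)) \<le> real (card S) * (u / Q) + (qint q (d + 1))\<^sup>2"
proof -
  have PM: "P \<in> MU" "P \<in> lev 1" "P \<in> M"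
    using P MU_lev by (auto simp: Big_def)
  define l where "l = lP P"
  have h: "l \<in> lev 2" "P \<preceq> l" "real (card {B \<in> BBP P. \<not> l \<preceq> B}) \<le> qint q (d + 1)"
    using lP[OF P] by (auto simp: heavy_def l_def)
  define F1 where "F1 = {(A, B) \<in> FL. B \<in> BBP P \<and> \<not> l \<preceq> B}"
  define S' where "S' = {R \<in> S. \<not> R \<preceq> l}"
  define F2 where "F2 = (\<Union>R\<in>S'. {(A, B) \<in> FL. R \<preceq> A \<and> l \<curlyvee> R \<preceq> B})"
  have fin': "finite F1" "finite F2"
    by (rule finite_subset[OF _ finite_FL]; auto simp: F1_def F2_def)+
  have "C (ch P) \<inter> TT \<subseteq> F1 \<union> F2"
  proof
    fix F assume "F \<in> C (ch P) \<inter> TT"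
    then obtain A B where F: "F = (A, B)" "(A, B) \<in> C (ch P)" "(A, B) \<in> TT"
      by (cases F) auto
    note c = chosen_cases[OF PM(1) F(2,3)]
    show "F \<in> F1 \<union> F2"
    proof (cases "l \<preceq> B")
      case False
      obtain "(A, B) \<in> FL"
        using F(3) by (elim TT_cases)
      then show ?thesis
        using F(1) c False by (simp add: F1_def)
    next
      case True
      obtain R l' where R: "(R, l') \<in> free" "R \<in> S" "R \<in> lev 1" "l' \<in> lev 2" "R \<preceq> l'" "B \<curlywedge> U = l'"
        "B \<in> lev (d + 1)" "(A, B) \<in> FL" "R \<preceq> A" "l' \<preceq> B"
        using F(3) by (elim TT_cases)
      have ne: "l' \<noteq> l"
        using R(1) P by (auto simp: free_def l_def)
      have "P \<preceq> l'"
        unfolding R(6)[symmetric] using c PM R by (auto intro: mt_greatest simp: MU_def)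
      have "\<not> R \<preceq> l"
      proof
        assume Rl: "R \<preceq> l"
        \<comment> \<open>If \<open>R\<close> were on \<open>l\<close>, both \<open>l\<close> and
          \<open>l'\<close> would be the line through \<open>P\<close> and \<open>R\<close>; but
          \<open>(R, l')\<close> is free and \<open>l\<close> is served.\<close>
        have "P \<noteq> R"
          using R PM MU_S by auto
        then have "l = P \<curlyvee> R" "l' = P \<curlyvee> R"
          using points_eq_line[of P R l] points_eq_line[of P R l'] PM R h Rl \<open>P \<preceq> l'\<close> by auto
        then show False
          using ne by simp
      qed
      moreover have "R \<preceq> B"
        using le_trans[of R l' B] R by auto
      then have "l \<curlyvee> R \<preceq> B"
        using True R h by (auto intro: jn_least)
      ultimately show ?thesis
        using F R by (auto simp: F2_def S'_def)
    qed
  qed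
  then have "card (C (ch P) \<inter> TT) \<le> card (F1 \<union> F2)"
    using fin' by (intro card_mono) auto
  also have "\<dots> \<le> card F1 + card F2"
    by (rule card_Un_le)
  finally have "real (card (C (ch P) \<inter> TT)) \<le> real (card F1) + real (card F2)"
    by (metis of_nat_add of_nat_mono)
  moreover have "real (card F1) \<le> (qint q (d + 1))\<^sup>2"
  proof -
    have "{B \<in> lev (d + 1). B \<in> BBP P \<and> \<not> l \<preceq> B} = {B \<in> BBP P. \<not> l \<preceq> B}"
      using BBP_props(1)[OF PM(1)] by auto
    then have "real (card F1) = real (card {B \<in> BBP P. \<not> l \<preceq> B}) * qint q (d + 1)"
      unfolding F1_def using card_flags_B_le[of "\<lambda>B. B \<in> BBP P \<and> \<not> l \<preceq> B"] by simp
    also have "\<dots> \<le> qint q (d + 1) * qint q (d + 1)"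
      using h by (intro mult_right_mono) auto
    finally show ?thesis
      by (simp add: power2_eq_square)
  qed
  moreover have "real (card F2) \<le> real (card S) * (u / Q)"
  proof -
    have "real (card {(A, B) \<in> FL. R \<preceq> A \<and> l \<curlyvee> R \<preceq> B}) \<le> u / Q" if R: "R \<in> S'" for R
    proof -
      have R': "R \<in> lev 1" "\<not> R \<preceq> l"
        using R S_lev by (auto simp: S'_def)
      have e: "l \<curlyvee> R \<in> lev 3"
        using rk_jn_point[OF R'(1) _ R'(2)] h R' by (intro levI) auto
      have "card {B \<in> lev (d + 1). R \<preceq> B \<and> l \<curlyvee> R \<preceq> B} \<le> card {B \<in> lev (d + 1). l \<curlyvee> R \<preceq> B}"
        by (rule card_mono) auto
      then have "real (card {B \<in> lev (d + 1). R \<preceq> B \<and> l \<curlyvee> R \<preceq> B}) \<le> G / Q"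
        using card_big_above_plane[OF e] by linarith
      then have "real (card {B \<in> lev (d + 1). R \<preceq> B \<and> l \<curlyvee> R \<preceq> B}) * qint q d \<le> G / Q * qint q d"
        by (intro mult_right_mono) auto
      then show ?thesis
        using card_flags_point_B[OF R'(1), of "\<lambda>B. l \<curlyvee> R \<preceq> B"] by (simp add: u_def)
    qed
    then have "real (card F2) \<le> real (card S') * (u / Q)"
      unfolding F2_def by (intro card_UN_le_mult) (auto simp: S'_def)
    also have "\<dots> \<le> real (card S) * (u / Q)"
      using u_pos by (intro mult_right_mono of_nat_mono card_mono) (auto simp: S'_def)
    finally show ?thesis .
  qed
  ultimately show ?thesis
    by linarith
qed

text \<open>The large member of a covered flag contains the line through \<open>P\<close> and the
  hole. As no line through \<open>P\<close> is heavy, \<open>not_heavy\<close> bounds the number of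
  such members for each hole.\<close>

lemma cover_not_Big:
  assumes P: "P \<in> MU - Big"
  shows "real (card (C (ch P) \<inter> TT)) \<le> real (card S) * (6 * u / (real q * real q))"
proof -
  have PM: "P \<in> MU" "P \<in> lev 1" "P \<in> M"
    using P MU_lev by auto
  define F2 where "F2 = (\<Union>R\<in>S. {(A, B) \<in> FL. R \<preceq> A \<and> (B \<in> BBP P \<and> P \<curlyvee> R \<preceq> B)})"
  have fin': "finite F2"
    by (rule finite_subset[OF _ finite_FL]) (auto simp: F2_def)
  have "C (ch P) \<inter> TT \<subseteq> F2"
  proof
    fix F assume "F \<in> C (ch P) \<inter> TT"
    then obtain A B where F: "F = (A, B)" "(A, B) \<in> C (ch P)" "(A, B) \<in> TT"
      by (cases F) auto
    note c = chosen_cases[OF PM(1) F(2,3)]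
    obtain R l' where R: "R \<in> S" "R \<in> lev 1" "l' \<in> lev 2" "R \<preceq> l'"
        "B \<in> lev (d + 1)" "(A, B) \<in> FL" "R \<preceq> A" "l' \<preceq> B"
      using F(3) by (elim TT_cases)
    have "R \<preceq> B"
      using le_trans[of R l' B] R by auto
    then have "P \<curlyvee> R \<preceq> B"
      using c PM R by (auto intro: jn_least)
    then show "F \<in> F2"
      using F R c by (auto simp: F2_def)
  qed
  then have "card (C (ch P) \<inter> TT) \<le> card F2"
    using fin' by (intro card_mono) auto
  then have "real (card (C (ch P) \<inter> TT)) \<le> real (card F2)"
    by simp
  also have "\<dots> \<le> real (card S) * (6 * u / (real q * real q))"
    unfolding F2_def
  proof (rule card_UN_le_mult)
    fix R assume R: "R \<in> S"
    then have R': "R \<in> lev 1" "P \<noteq> R"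
      using S_lev PM MU_S by auto
    have l: "P \<curlyvee> R \<in> lev 2"
      using rk_line[of P R] PM R' by (intro levI) auto
    have "{B \<in> lev (d + 1). R \<preceq> B \<and> (B \<in> BBP P \<and> P \<curlyvee> R \<preceq> B)} \<subseteq> {B \<in> BBP P. P \<curlyvee> R \<preceq> B}"
      by auto
    then have "card {B \<in> lev (d + 1). R \<preceq> B \<and> (B \<in> BBP P \<and> P \<curlyvee> R \<preceq> B)} \<le> card {B \<in> BBP P. P \<curlyvee> R \<preceq> B}"
      using finite_BBP[OF PM(1)] by (intro card_mono) auto
    also have "real \<dots> \<le> 6 * G / (real q)\<^sup>2"
      using not_heavy[OF P l] PM R' by simp
    finally have "real (card {B \<in> lev (d + 1). R \<preceq> B \<and> (B \<in> BBP P \<and> P \<curlyvee> R \<preceq> B)}) * qint q d \<le> 6 * G / (real q)\<^sup>2 * qint q d"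
      by (intro mult_right_mono) auto
    then show "real (card {(A, B) \<in> FL. R \<preceq> A \<and> (B \<in> BBP P \<and> P \<curlyvee> R \<preceq> B)}) \<le> 6 * u / (real q * real q)"
      using card_flags_point_B[OF R'(1), of "\<lambda>B. B \<in> BBP P \<and> P \<curlyvee> R \<preceq> B"]
      by (simp add: u_def power2_eq_square)
  qed simp
  finally show ?thesis .
qed

text \<open>Apart from the extra part of the class, a covered flag has the point and a hole in its
  small member. The point then lies outside \<open>U\<close>, and a full line is prescribed below
  the small member.\<close>

lemma cover_other_point:
  assumes i: "i \<in> O1"
  shows "real (card (C i \<inter> TT)) \<le> real (card S) * (fl / (real q * Q)) + 24 * fl / (real q)\<^sup>2"
proof -
  define P where "P = pt i"
  have i1: "i \<in> I1"
    using i by (simp add: O1_def)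
  have P: "P \<in> lev 1" "indep (C i)" "pencil P \<subseteq> C i" "P \<in> M"
    using i1 pt indep_C by (auto simp: P_def M_def)
  define E where "E = C i - pencil P"
  \<comment> \<open>\<open>O1\<close> also contains indices that repeat a point of
    \<open>MU\<close>; their pencils miss \<open>TT\<close>, which is the empty case.\<close>
  define F2 where "F2 = (if P \<preceq> U then {} else (\<Union>R\<in>S. {(A, B) \<in> FL. P \<curlyvee> R \<preceq> A}))"
  have fin': "finite E" "finite F2"
    using indep_FL[OF P(2)] by (auto simp: E_def F2_def intro: finite_subset[OF _ finite_FL])
  have "C i \<inter> TT \<subseteq> E \<union> F2"
  proof
    fix F assume F: "F \<in> C i \<inter> TT"
    obtain A B where AB: "F = (A, B)"
      by (cases F)
    show "F \<in> E \<union> F2"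
    proof (cases "F \<in> pencil P")
      case True
      then have PA: "P \<preceq> A"
        by (auto simp: pencil_def AB)
      have nU: "\<not> P \<preceq> U"
      proof
        assume "P \<preceq> U"
        then have "P \<in> MU"
          using P by (simp add: MU_def)
        then show False
          using point_of_MU_not_le F AB PA by blast
      qed
      obtain R where R: "R \<in> S" "R \<in> lev 1" "A \<in> lev d" "(A, B) \<in> FL" "R \<preceq> A"
        using F AB by (elim IntE) (auto elim: TT_cases)
      then have "P \<curlyvee> R \<preceq> A"
        using PA P by (auto intro: jn_least)
      then show ?thesis
        using nU R AB by (auto simp: F2_def)
    qed (use F in \<open>auto simp: E_def\<close>)
  qed
  then have "card (C i \<inter> TT) \<le> card (E \<union> F2)"
    using fin' by (intro card_mono) auto
  then have "card (C i \<inter> TT) \<le> card E + card F2"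
    using card_Un_le[of E F2] by linarith
  then have "real (card (C i \<inter> TT)) \<le> real (card E) + real (card F2)"
    by (metis of_nat_add of_nat_mono)
  moreover have "real (card E) \<le> 24 * fl / (real q)\<^sup>2"
    unfolding E_def by (rule card_extra_le[OF P(2,3,1)])
  moreover have "real (card F2) \<le> real (card S) * (fl / (real q * Q))"
  proof (cases "P \<preceq> U")
    case True
    then show ?thesis
      using fl_pos by (simp add: F2_def)
  next
    case False
    have "real (card {(A, B) \<in> FL. P \<curlyvee> R \<preceq> A}) \<le> fl / (real q * Q)" if R: "R \<in> S" for R
    proof -
      have R': "R \<in> lev 1" "P \<noteq> R"
        using R S_lev False by (auto simp: S_def)
      have "P \<curlyvee> R \<in> lev 2"
        using rk_line[of P R] P R' by (intro levI) auto
      then have "real (card {(A, B) \<in> FL. P \<curlyvee> R \<preceq> A}) = a2 * qint q (d + 1)"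
        using card_flags_A[of "\<lambda>A. P \<curlyvee> R \<preceq> A"] card_A_above_line by simp
      also have "\<dots> \<le> a1 / (real q * Q) * qint q (d + 1)"
        using a2_le by (intro mult_right_mono) (auto simp: field_simps)
      also have "\<dots> = fl / (real q * Q)"
        by (simp add: fl_a1)
      finally show ?thesis .
    qed
    then show ?thesis
      unfolding F2_def using False by (simp only: if_False) (intro card_UN_le_mult, auto)
  qed
  ultimately show ?thesis
    by linarith
qed

text \<open>Incidences between holes and hyperplanes. A flag covered by a dual pencil yields one,
  because its hole lies below the hyperplane, and each incidence accounts for at most u
  flags.\<close>

definition hsum :: real where "hsum = (\<Sum>H\<in>HH. real (card {R \<in> S. R \<preceq> H}))"

lemma cover_hyperplanes:
  "real (card ((\<Union>i\<in>I2. C i) \<inter> TT)) \<le> hsum * u + real (card I2) * (24 * fl / (real q)\<^sup>2)"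
proof -
  define E where "E = (\<Union>i\<in>I2. C i - dpencil (hp i))"
  define HR where "HR = (SIGMA H:HH. {R \<in> S. R \<preceq> H})"
  define F2 where "F2 = (\<Union>(H, R)\<in>HR. {(A, B) \<in> FL. R \<preceq> A \<and> B \<preceq> H})"
  have finHR: "finite HR"
    by (simp add: HR_def)
  have ind: "indep (C i)" if "i \<in> I2" for i
    using that indep_C by auto
  have fin': "finite E" "finite F2"
  proof -
    have "E \<subseteq> FL" "F2 \<subseteq> FL"
      using indep_FL[OF ind] by (auto simp: E_def F2_def)
    then show "finite E" "finite F2"
      using finite_FL finite_subset by blast+
  qed
  have "(\<Union>i\<in>I2. C i) \<inter> TT \<subseteq> E \<union> F2"
  proof
    fix F assume F: "F \<in> (\<Union>i\<in>I2. C i) \<inter> TT"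
    then obtain i where i: "i \<in> I2" "F \<in> C i" "F \<in> TT"
      by blast
    obtain A B where AB: "F = (A, B)"
      by (cases F)
    show "F \<in> E \<union> F2"
    proof (cases "F \<in> dpencil (hp i)")
      case True
      then have BH: "B \<preceq> hp i"
        by (auto simp: dpencil_def AB)
      have H: "hp i \<in> HH" "hp i \<in> lev (2 * d)"
        using i hp by (auto simp: HH_def)
      obtain R where R: "R \<in> S" "R \<in> lev 1" "A \<in> lev d" "B \<in> lev (d + 1)" "A \<preceq> B" "(A, B) \<in> FL" "R \<preceq> A"
        using i(3) unfolding AB by (elim TT_cases)
      have "R \<preceq> B"
        using le_trans[of R A B] R by auto
      then have "R \<preceq> hp i"
        using le_trans[of R B "hp i"] R H BH by auto
      then have "(hp i, R) \<in> HR"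
        using H R by (simp add: HR_def)
      then show ?thesis
        using R AB BH unfolding F2_def by blast
    qed (use i in \<open>auto simp: E_def\<close>)
  qed
  then have "card ((\<Union>i\<in>I2. C i) \<inter> TT) \<le> card (E \<union> F2)"
    using fin' by (intro card_mono) auto
  then have "card ((\<Union>i\<in>I2. C i) \<inter> TT) \<le> card E + card F2"
    using card_Un_le[of E F2] by linarith
  then have "real (card ((\<Union>i\<in>I2. C i) \<inter> TT)) \<le> real (card E) + real (card F2)"
    by (metis of_nat_add of_nat_mono)
  moreover have "real (card E) \<le> real (card I2) * (24 * fl / (real q)\<^sup>2)"
    unfolding E_def using fin_I ind hp by (intro card_UN_le_mult card_dextra_le) auto
  moreover have "real (card F2) \<le> hsum * u"
  proof -
    have "real (card (case x of (H, R) \<Rightarrow> {(A, B) \<in> FL. R \<preceq> A \<and> B \<preceq> H})) \<le> u" if x: "x \<in> HR" for x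
    proof -
      obtain H R where HR: "x = (H, R)" "H \<in> HH" "R \<in> S" "R \<preceq> H"
        using x by (auto simp: HR_def)
      have lv: "H \<in> lev (2 * d)" "R \<in> lev 1"
        using HR HH_lev S_lev by auto
      have "real (card {B \<in> lev (d + 1). R \<preceq> B \<and> B \<preceq> H}) = qbin q (2 * d - 1) d"
        using card_lev_between[of R H "d + 1"] lv HR by simp
      also have "\<dots> = G"
      proof -
        have "2 * d - 1 - (d - 1) = d"
          using d3 by simp
        then show ?thesis
          using qbin_sym[of "d - 1" "2 * d - 1" q] d3 by (simp add: G_def)
      qed
      finally show ?thesis
        using card_flags_point_B[OF lv(2), of "\<lambda>B. B \<preceq> H"] HR(1) by (simp add: u_def)
    qed
    then have "real (card F2) \<le> real (card HR) * u"
      unfolding F2_def by (rule card_UN_le_mult[OF finHR])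
    also have "real (card HR) = hsum"
      by (simp add: HR_def hsum_def)
    finally show ?thesis .
  qed
  ultimately show ?thesis
    by linarith
qed

text \<open>The trivial bound serves the case of few holes. The second one is
  \<open>hyperplane_discrepancy\<close> for points: a large set of holes cannot concentrate on the
  given hyperplanes.\<close>

lemma hsum_le:
  "hsum \<le> real (card I2) * real (card S)"
  "hsum \<le> real (card S) * real (card I2) / real q + sqrt (real (card S) * real (card I2) * (2 * (Q * Q) / real q))"
proof -
  have "hsum \<le> (\<Sum>H\<in>HH. real (card S))"
    unfolding hsum_def by (intro sum_mono of_nat_mono card_mono) auto
  also have "\<dots> \<le> real (card I2) * real (card S)"
    using card_HH_le by (simp add: mult_right_mono)
  finally show "hsum \<le> real (card I2) * real (card S)" .
  have "hsum = (\<Sum>R\<in>S. real (card {H \<in> HH. R \<preceq> H}))"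
    unfolding hsum_def by (rule real_card_swap) auto
  also have "\<dots> \<le> real (card S) * (real (card HH) * qint q (2 * d) / qint q (2 * d + 1))
      + sqrt (real (card S) * (real (card HH) * qint q (2 * d)))"
  proof -
    have a: "1 \<le> 2 * d - 1" and b: "2 * d + 1 - 1 = 2 * d" and c: "qbin q (2 * d) 1 = qint q (2 * d)"
      using d3 by auto
    show ?thesis
      using hyperplane_discrepancy[OF HH_lev a S_lev] unfolding b c abs_le_iff by linarith
  qed
  also have "\<dots> \<le> real (card S) * real (card I2) / real q + sqrt (real (card S) * real (card I2) * (2 * (Q * Q) / real q))"
  proof (rule add_mono)
    have pos: "0 < qint q (2 * d + 1)"
      by (intro qint_pos) simp
    have "real q * qint q (2 * d) \<le> qint q (2 * d + 1)"
      by (simp add: qint_Suc')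
    then have "qint q (2 * d) / qint q (2 * d + 1) \<le> 1 / real q"
      using pos by (simp add: field_simps)
    then have "real (card HH) * (qint q (2 * d) / qint q (2 * d + 1)) \<le> real (card I2) * (1 / real q)"
      using card_HH_le pos by (intro mult_mono) auto
    then have "real (card S) * (real (card HH) * (qint q (2 * d) / qint q (2 * d + 1))) \<le> real (card S) * (real (card I2) * (1 / real q))"
      by (intro mult_left_mono) auto
    then show "real (card S) * (real (card HH) * qint q (2 * d) / qint q (2 * d + 1)) \<le> real (card S) * real (card I2) / real q"
      by simp
    have "qint q (2 * d) \<le> 2 * (Q * Q) / real q"
    proof -
      obtain n where n: "2 * d = Suc n"
        using d3 by (cases "2 * d") auto
      have "Q * Q = real q ^ (2 * d)"
        by (simp add: power_add[symmetric] mult_2)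
      also have "\<dots> = real q * real q ^ n"
        by (simp add: n)
      finally show ?thesis
        using qint_le_2power[of q n] unfolding n by simp
    qed
    then have "real (card HH) * qint q (2 * d) \<le> real (card I2) * (2 * (Q * Q) / real q)"
      using card_HH_le by (intro mult_mono) auto
    then have "real (card S) * (real (card HH) * qint q (2 * d)) \<le> real (card S) * (real (card I2) * (2 * (Q * Q) / real q))"
      by (intro mult_left_mono) auto
    then show "sqrt (real (card S) * (real (card HH) * qint q (2 * d))) \<le> sqrt (real (card S) * real (card I2) * (2 * (Q * Q) / real q))"
      by (simp add: mult.assoc)
  qed
  finally show "hsum \<le> real (card S) * real (card I2) / real q + sqrt (real (card S) * real (card I2) * (2 * (Q * Q) / real q))" .
qed

end

context qcover_rich
begin

lemma card_TT_le:
  "real (card TT) \<le> real (card Big) * (real (card S) * (u / Q) + (qint q (d + 1))\<^sup>2)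
    + real (card (MU - Big)) * (real (card S) * (6 * u / (real q * real q)))
    + real (card O1) * (real (card S) * (fl / (real q * Q)) + 24 * fl / (real q)\<^sup>2)
    + (hsum * u + real (card I2) * (24 * fl / (real q)\<^sup>2))
    + real (card I3) * (fl / 1000000)"
proof -
  define X1 where "X1 = (\<Union>P\<in>Big. C (ch P) \<inter> TT)"
  define X2 where "X2 = (\<Union>P\<in>MU - Big. C (ch P) \<inter> TT)"
  define X3 where "X3 = (\<Union>i\<in>O1. C i \<inter> TT)"
  define X4 where "X4 = (\<Union>i\<in>I2. C i) \<inter> TT"
  define X5 where "X5 = (\<Union>i\<in>I3. C i)"
  have finX: "finite X1" "finite X2" "finite X3" "finite X4" "finite X5"
    using fin_I finite_C by (auto simp: X1_def X2_def X3_def X4_def X5_def O1_def)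
  have "TT \<subseteq> X1 \<union> (X2 \<union> (X3 \<union> (X4 \<union> X5)))"
  proof
    fix F assume F: "F \<in> TT"
    have "F \<in> FL"
      using F by (auto simp: TT_def Fp_def)
    then obtain i where i: "i \<in> I1 \<union> I2 \<union> I3" "F \<in> C i"
      using cover by blast
    have "i \<in> I1 \<Longrightarrow> i \<in> O1 \<or> (\<exists>P\<in>MU. i = ch P)"
      by (auto simp: O1_def)
    then show "F \<in> X1 \<union> (X2 \<union> (X3 \<union> (X4 \<union> X5)))"
      using F i unfolding X1_def X2_def X3_def X4_def X5_def by blast
  qed
  then have "card TT \<le> card (X1 \<union> (X2 \<union> (X3 \<union> (X4 \<union> X5))))"
    using finX by (intro card_mono) auto
  also have "\<dots> \<le> card X1 + (card X2 + (card X3 + (card X4 + card X5)))"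
    by (meson add_mono card_Un_le order_refl order_trans)
  finally have "real (card TT) \<le> real (card X1) + (real (card X2) + (real (card X3) + (real (card X4) + real (card X5))))"
    by (metis of_nat_add of_nat_mono)
  moreover have "real (card X1) \<le> real (card Big) * (real (card S) * (u / Q) + (qint q (d + 1))\<^sup>2)"
    unfolding X1_def by (rule card_UN_le_mult[OF finite_Big cover_Big])
  moreover have "real (card X2) \<le> real (card (MU - Big)) * (real (card S) * (6 * u / (real q * real q)))"
    unfolding X2_def by (rule card_UN_le_mult[OF _ cover_not_Big]) auto
  moreover have "real (card X3) \<le> real (card O1) * (real (card S) * (fl / (real q * Q)) + 24 * fl / (real q)\<^sup>2)"
    unfolding X3_def using fin_I by (intro card_UN_le_mult[OF _ cover_other_point]) (auto simp: O1_def)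
  moreover have "real (card X4) \<le> hsum * u + real (card I2) * (24 * fl / (real q)\<^sup>2)"
    unfolding X4_def by (rule cover_hyperplanes)
  moreover have "real (card X5) \<le> real (card I3) * (fl / 1000000)"
    unfolding X5_def using fin_I small_C by (intro card_UN_le_mult) auto
  ultimately show ?thesis
    by linarith
qed

text \<open>The lower bound \<open>card_TT\<close> against the upper bound
  \<open>card_TT_le\<close>, divided by u, where fl \<le> 2 Q u.\<close>

lemma main_inequality:
  "real (card free) / 2 \<le> real (card Big) * (real (card S) / Q + (qint q (d + 1))\<^sup>2 / u)
    + real (card (MU - Big)) * (6 * real (card S) / (real q * real q))
    + real (card O1) * (2 * real (card S) / real q + 48 * Q / (real q * real q)) + hsum
    + real (card I2) * (48 * Q / (real q * real q)) + real (card I3) * (2 * Q / 1000000)"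
proof -
  have e1: "24 * fl / (real q)\<^sup>2 \<le> 48 * Q / (real q * real q) * u"
    using fl_le by (simp add: power2_eq_square field_simps)
  have e2: "real (card S) * (fl / (real q * Q)) \<le> 2 * real (card S) / real q * u"
  proof -
    have "fl / (real q * Q) \<le> 2 * u / real q"
      using fl_le by (simp add: field_simps)
    then have "real (card S) * (fl / (real q * Q)) \<le> real (card S) * (2 * u / real q)"
      by (intro mult_left_mono) auto
    then show ?thesis
      by (simp add: ac_simps)
  qed
  have e3: "fl / 1000000 \<le> 2 * Q / 1000000 * u"
    using fl_le by simp
  have f1: "real (card Big) * (real (card S) * (u / Q) + (qint q (d + 1))\<^sup>2)
      = real (card Big) * (real (card S) / Q + (qint q (d + 1))\<^sup>2 / u) * u"
    using u_pos by (simp add: field_simps)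
  have f3: "real (card O1) * (real (card S) * (fl / (real q * Q)) + 24 * fl / (real q)\<^sup>2)
      \<le> real (card O1) * (2 * real (card S) / real q + 48 * Q / (real q * real q)) * u"
  proof -
    have "real (card S) * (fl / (real q * Q)) + 24 * fl / (real q)\<^sup>2
        \<le> (2 * real (card S) / real q + 48 * Q / (real q * real q)) * u"
      using add_mono[OF e2 e1] by (simp only: distrib_right)
    then have "real (card O1) * (real (card S) * (fl / (real q * Q)) + 24 * fl / (real q)\<^sup>2)
        \<le> real (card O1) * ((2 * real (card S) / real q + 48 * Q / (real q * real q)) * u)"
      by (rule mult_left_mono) simp
    then show ?thesis
      by (simp only: mult.assoc)
  qed
  have f4: "real (card I2) * (24 * fl / (real q)\<^sup>2) \<le> real (card I2) * (48 * Q / (real q * real q)) * u"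
    unfolding mult.assoc by (rule mult_left_mono) (use e1 in \<open>simp_all add: mult.assoc\<close>)
  have f5: "real (card I3) * (fl / 1000000) \<le> real (card I3) * (2 * Q / 1000000) * u"
    unfolding mult.assoc by (rule mult_left_mono) (use e3 in \<open>simp_all add: mult.assoc\<close>)
  have f2: "real (card (MU - Big)) * (real (card S) * (6 * u / (real q * real q)))
      = real (card (MU - Big)) * (6 * real (card S) / (real q * real q)) * u"
    by simp
  have "real (card free) / 2 * u \<le> (real (card Big) * (real (card S) / Q + (qint q (d + 1))\<^sup>2 / u)
    + real (card (MU - Big)) * (6 * real (card S) / (real q * real q))
    + real (card O1) * (2 * real (card S) / real q + 48 * Q / (real q * real q)) + hsum
    + real (card I2) * (48 * Q / (real q * real q)) + real (card I3) * (2 * Q / 1000000)) * u"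
    using card_TT card_TT_le f3 f4 f5 unfolding f1 f2 distrib_right by linarith
  then show ?thesis
    by (rule mult_right_le_imp_le) (rule u_pos)
qed

lemma holes_le: "real (card S) \<le> real q"
proof (rule ccontr)
  assume "\<not> real (card S) \<le> real q"
  then have tq: "real q + 1 \<le> real (card S)"
    by (simp add: not_le flip: of_nat_Suc)
  have k: "qint q (d + 2) = 1 + real q * qint q (d + 1)" "qint q (d + 1) = qint q d + Q"
    using qint_Suc'[of q "d + 1"] qint_Suc[of q d] by simp_all
  have kb: "Q \<le> qint q (d + 1)" "qint q (d + 1) \<le> Q + 2 * (Q / real q)"
    using k qint_d_le qint_nonneg[of q d] by linarith+
  have "Big \<subseteq> MU"
    by (auto simp: Big_def)
  then have "card MU = card Big + card (MU - Big)"
    using card_Diff_subset[of Big MU] card_mono[of MU Big] by simp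
  then have cMU: "real (card Big) + real (card (MU - Big)) = real q * qint q (d + 1) + 1 - real (card S)"
    using card_MU_S k by simp
  have "free \<subseteq> prs"
    by (auto simp: free_def)
  then have "card prs = card free + card (prs - free)"
    using card_Diff_subset[of free prs] card_mono[of prs free] by simp
  then have cfree: "real (card S) * qint q (d + 1) - real (card (prs - free)) \<le> real (card free)"
    using card_prs by simp
  have t2: "real (card S) \<le> real q * Q / 500"
  proof -
    have "real q * qint q (d + 1) \<le> real q * (Q + 2 * (Q / real q))"
      using kb by (intro mult_left_mono) auto
    then have "real q * qint q (d + 1) \<le> real q * Q + 2 * Q"
      by (simp add: algebra_simps)
    moreover have "real q * Q - real q * Q / 1000 \<le> real (card MU)"
      using rich by (simp add: MU_def algebra_simps)
    moreover have "10000000000000000 * Q \<le> real q * Q"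
      using q_ge(1) by (intro mult_right_mono) auto
    ultimately show ?thesis
      using card_MU_S k(1) Q_ge by linarith
  qed
  have qqq: "real q * real q * real q \<le> Q"
  proof -
    have "real q ^ 3 \<le> Q"
      using d3 by (intro power_increasing) auto
    then show ?thesis
      by (simp add: power3_eq_cube)
  qed
  show False
    by (rule holes_arith[OF q_ge(1) qqq tq t2 _ _ cMU kb _ _ _ card_others _ w_le cfree card_assigned
          hsum_le main_inequality]) (use u_pos in auto)
qed

text \<open>With at most q holes the bound t - q on the number of remaining classes is at most 0, so
  every class is the chosen one of a point of \<open>U\<close>. Conversely that bound is at least 0,
  so there are exactly q holes and the number of classes is determined.\<close>

lemma conclusion:
  "real (card I1) = qint q (d + 2) - real q" "I2 = {}" "I3 = {}" "inj_on pt I1" "\<And>i. i \<in> I1 \<Longrightarrow> pt i \<preceq> U"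
proof -
  have c: "real (card O1) + real (card I2) + real (card I3) \<le> 0"
    using card_others holes_le by linarith
  then have "card O1 = 0" "card I2 = 0" "card I3 = 0"
    by auto
  then have O1: "O1 = {}" and I23: "I2 = {}" "I3 = {}"
    using fin_I by (auto simp: O1_def)
  show "I2 = {}" "I3 = {}"
    by fact+
  have ex: "\<exists>P\<in>MU. i = ch P" if "i \<in> I1" for i
    using that O1 by (auto simp: O1_def)
  show "inj_on pt I1"
    using ex ch(2) by (metis inj_onI)
  show "\<And>i. i \<in> I1 \<Longrightarrow> pt i \<preceq> U"
    using ex ch(2) by (force simp: MU_def)
  have "inj_on ch MU"
    by (intro inj_onI) (metis ch(2))
  then have "card (ch ` MU) = card MU"
    by (rule card_image)
  moreover have "ch ` MU = I1"
    using ex ch(1) by blast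
  ultimately have "card I1 = card MU"
    by (rule subst[rotated])
  moreover have "real q \<le> real (card S)"
    using card_others by linarith
  ultimately show "real (card I1) = qint q (d + 2) - real q"
    using card_MU_S holes_le by linarith
qed

end

context qcover_points
begin

lemma points_conclusion:
  "\<exists>U\<in>lev (d + 2). real (card I1) = qint q (d + 2) - real q \<and> I2 = {} \<and> I3 = {} \<and>
     inj_on pt I1 \<and> (\<forall>i\<in>I1. pt i \<preceq> U)"
proof -
  obtain U where U: "U \<in> lev (d + 2)" "real q * Q * (1 - 1 / 1000) \<le> real (card {P \<in> M. P \<preceq> U})"
    by (rule ex_rich_subspace)
  interpret R: qcover_rich L le mt jn bt tp rk q d I1 I2 I3 C pt hp U
    by unfold_locales (fact U)+
  show ?thesis
    using R.conclusion U(1) by blast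
qed

end

text \<open>If hyperplanes are in the majority, the result for points is applied to the dual
  lattice, where flags are reversed and hyperplanes are points. An element of dual rank d + 2 has
  rank d - 1.\<close>

theorem (in qcover) cover_structure:
  "(\<exists>U\<in>lev (d + 2). real (card I1) = qint q (d + 2) - real q \<and> I2 = {} \<and> I3 = {} \<and>
     inj_on pt I1 \<and> (\<forall>i\<in>I1. pt i \<preceq> U)) \<or>
   (\<exists>U\<in>lev (d - 1). real (card I2) = qint q (d + 2) - real q \<and> I1 = {} \<and> I3 = {} \<and>
     inj_on hp I2 \<and> (\<forall>i\<in>I2. U \<preceq> hp i))"
proof (cases "card I2 \<le> card I1")
  case True
  interpret qcover_points L le mt jn bt tp rk q d I1 I2 I3 C pt hp
    by unfold_locales (rule True)
  show ?thesis
    using points_conclusion by blast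
next
  case False
  interpret D: qflag_dual L "\<lambda>x y. y \<preceq> x" "(\<curlyvee>)" "(\<curlywedge>)" tp bt crk q d
    by (rule qflag_dual.intro[OF dual_flag])
  have lv: "dual.lev 1 = lev (2 * d)" "dual.lev (2 * d) = lev 1" "dual.lev (d + 2) = lev (d - 1)"
  proof -
    have "2 * d + 1 - (d + 2) = d - 1"
      by simp
    then show "dual.lev (d + 2) = lev (d - 1)"
      using dual_lev[of "d + 2"] d3 by simp
    show "dual.lev 1 = lev (2 * d)" "dual.lev (2 * d) = lev 1"
      using dual_lev[of 1] dual_lev[of "2 * d"] by simp_all
  qed
  interpret D: qcover_points L "\<lambda>x y. y \<preceq> x" "(\<curlyvee>)" "(\<curlywedge>)" tp bt crk q d I2 I1 I3 "\<lambda>i. prod.swap ` C i" hp pt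
  proof unfold_locales
    show "finite I2" "finite I1" "finite I3"
      by (fact fin_I)+
    show "real (card I2) + real (card I1) + real (card I3) \<le> qint q (d + 2) - real q"
      using card_I by linarith
    show "dual.indep (prod.swap ` C i)" if "i \<in> I2 \<union> I1" for i
      using dual_indep[OF indep_FL[OF indep_C]] indep_C that by blast
    show "hp i \<in> dual.lev 1" if "i \<in> I2" for i
      using hp(1)[OF that] lv by simp
    show "pt i \<in> dual.lev (2 * d)" if "i \<in> I1" for i
      using pt(1)[OF that] lv by simp
    show "dual.pencil (hp i) \<subseteq> prod.swap ` C i" if "i \<in> I2" for i
      using hp(2)[OF that] unfolding dual_pencil by (rule image_mono)
    show "dual.dpencil (pt i) \<subseteq> prod.swap ` C i" if "i \<in> I1" for i
      using pt(2)[OF that] unfolding dual_dpencil by (rule image_mono)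
    show "real (card (prod.swap ` C i)) \<le> fl / 1000000" if "i \<in> I3" for i
      using small_C[OF that] by (simp add: card_image)
    show "finite (prod.swap ` C i)" if "i \<in> I3" for i
      using finite_C[OF that] by simp
    show "dual.FL \<subseteq> (\<Union>i\<in>I2 \<union> I1 \<union> I3. prod.swap ` C i)"
    proof
      fix F assume "F \<in> dual.FL"
      then obtain F' where F': "F' \<in> FL" "F = prod.swap F'"
        unfolding dual_FL by auto
      then obtain i where "i \<in> I1 \<union> I2 \<union> I3" "F' \<in> C i"
        using cover by blast
      then show "F \<in> (\<Union>i\<in>I2 \<union> I1 \<union> I3. prod.swap ` C i)"
        using F'(2) by blast
    qed
    show "card I1 \<le> card I2"
      using False by simp
  qed
  show ?thesis
    using D.points_conclusion unfolding lv by blast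
qed

context qflag
begin

section \<open>The colouring\<close>

text \<open>A colouring with \<open>qint q (d + 2) - q\<close> points of a subspace \<open>U\<close> of rank \<open>d + 2\<close>: all points of a
  line \<open>l0\<close> of \<open>U\<close> except one, \<open>R\<close>, are discarded, and a flag meeting \<open>U\<close> only in a discarded point
  is coloured by a point of the line in which its large member meets \<open>U\<close>.  The function \<open>\<phi>\<close>
  distributes the points of \<open>U\<close> off \<open>l0\<close> so that each discarded point finds such a colour on every line.\<close>
lemma ex_transversal_map:
  assumes U: "U \<in> L" and l0: "l0 \<in> lev 2" "l0 \<preceq> U" and R: "R \<in> lev 1" "R \<preceq> l0"
  obtains \<phi> where "\<And>P. P \<in> lev 1 \<Longrightarrow> P \<preceq> U \<Longrightarrow> \<not> P \<preceq> l0 \<Longrightarrow> \<phi> P \<in> lev 1 \<and> \<phi> P \<preceq> l0"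
    "\<And>P0 l. P0 \<in> lev 1 \<Longrightarrow> P0 \<preceq> l0 \<Longrightarrow> P0 \<noteq> R \<Longrightarrow> l \<in> lev 2 \<Longrightarrow> l \<preceq> U \<Longrightarrow> l \<noteq> l0 \<Longrightarrow> P0 \<preceq> l \<Longrightarrow>
      \<exists>P. P \<in> lev 1 \<and> P \<preceq> l \<and> \<not> P \<preceq> l0 \<and> \<phi> P = P0"
proof -
  define D where "D = {P \<in> lev 1. P \<preceq> l0} - {R}"
  \<comment> \<open>In a plane \<open>e\<close> through \<open>l0\<close> there are q lines through
    \<open>R\<close> besides \<open>l0\<close>, and \<open>l0\<close> has q points besides
    \<open>R\<close>. A bijection between them assigns one colour point of each line to the
    discarded points.\<close>
  define g where "g e = {m \<in> lev 2. R \<preceq> m \<and> m \<preceq> e} - {l0}" for e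
  have "\<exists>\<beta>. bij_betw \<beta> (g e) D" if e: "e \<in> lev 3" "l0 \<preceq> e" for e
  proof -
    have Re: "R \<preceq> e"
      using le_trans[of R l0 e] R l0 e by auto
    have "real (card {m \<in> lev 2. R \<preceq> m \<and> m \<preceq> e}) = qint q 2"
      using card_covers_between[of R e 2] R e Re by simp
    moreover have "real (card {P \<in> lev 1. P \<preceq> l0}) = qint q 2"
      using card_points_below[of l0] l0 by simp
    ultimately have eq: "card {m \<in> lev 2. R \<preceq> m \<and> m \<preceq> e} = card {P \<in> lev 1. P \<preceq> l0}"
      by simp
    have "card (g e) = card D"
      unfolding g_def D_def using eq R l0 e by (subst (1 2) card_Diff_singleton) auto
    moreover have "finite (g e)" "finite D"
      by (auto simp: g_def D_def)
    ultimately show ?thesis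
      by (intro finite_same_card_bij)
  qed
  then obtain \<beta> where \<beta>: "\<And>e. e \<in> lev 3 \<Longrightarrow> l0 \<preceq> e \<Longrightarrow> bij_betw (\<beta> e) (g e) D"
    by metis
  define \<phi> where "\<phi> P = \<beta> (l0 \<curlyvee> P) (R \<curlyvee> P)" for P
  show thesis
  proof (rule that[of \<phi>])
    fix P assume P: "P \<in> lev 1" "P \<preceq> U" "\<not> P \<preceq> l0"
    have e: "l0 \<curlyvee> P \<in> lev 3"
      using rk_jn_point[OF P(1) _ P(3)] l0 P by (intro levI) auto
    have "P \<noteq> R"
      using P R by auto
    then have m: "R \<curlyvee> P \<in> lev 2"
      using rk_line[of R P] R P by (intro levI) auto
    have "R \<curlyvee> P \<preceq> l0 \<curlyvee> P"
      using R l0 P by (intro jn_mono) auto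
    moreover have "R \<curlyvee> P \<noteq> l0"
      using P R jn2[of R P] by auto
    ultimately have "R \<curlyvee> P \<in> g (l0 \<curlyvee> P)"
      using m R P by (auto simp: g_def)
    then have "\<phi> P \<in> D"
      unfolding \<phi>_def using \<beta>[OF e] l0 P by (auto dest: bij_betwE)
    then show "\<phi> P \<in> lev 1 \<and> \<phi> P \<preceq> l0"
      by (auto simp: D_def)
  next
    fix P0 l assume P0: "P0 \<in> lev 1" "P0 \<preceq> l0" "P0 \<noteq> R"
      and l: "l \<in> lev 2" "l \<preceq> U" "l \<noteq> l0" "P0 \<preceq> l"
    define e where "e = l0 \<curlyvee> l"
    have nle: "\<not> l \<preceq> l0"
      using rk_eqD[of l l0] l l0 by auto
    have e: "e \<in> lev 3" "l0 \<preceq> e" "l \<preceq> e"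
      using rk_jn_line[OF P0(1) l(1,4) _ P0(2) nle] l l0 by (auto simp: e_def intro!: levI)
    have "P0 \<in> D"
      using P0 by (auto simp: D_def)
    then obtain m where m: "m \<in> g e" "\<beta> e m = P0"
      using \<beta>[OF e(1,2)] by (metis bij_betw_imp_surj_on imageE)
    have m': "m \<in> lev 2" "R \<preceq> m" "m \<preceq> e" "m \<noteq> l0"
      using m by (auto simp: g_def)
    have Rl: "\<not> R \<preceq> l"
    proof
      assume "R \<preceq> l"
      then have "l = P0 \<curlyvee> R" "l0 = P0 \<curlyvee> R"
        using points_eq_line[of P0 R l] points_eq_line[of P0 R l0] P0 R l l0 by auto
      then show False
        using l by simp
    qed
    \<comment> \<open>Two lines of the plane \<open>e\<close> meet. The common point of
      \<open>l\<close> and the line \<open>m\<close> that belongs to \<open>P0\<close> is the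
      witness.\<close>
    have "rk (m \<curlyvee> l) \<le> 3"
      using rk_mono[of "m \<curlyvee> l" e] m' e l by (auto intro: jn_least)
    then have "1 \<le> rk (m \<curlywedge> l)"
      using modular[of m l] m' l by simp
    then obtain P where P: "P \<in> lev 1" "P \<preceq> m \<curlywedge> l"
      using ex_point[of "m \<curlywedge> l"] m' l by auto
    have P': "P \<preceq> m" "P \<preceq> l"
      using P m' l by (auto simp: le_mt_iff)
    have PR: "P \<noteq> R"
      using P' Rl by auto
    have mPR: "m = R \<curlyvee> P"
      using points_eq_line[of R P m] P P' PR R m' by auto
    have Pl0: "\<not> P \<preceq> l0"
    proof
      assume "P \<preceq> l0"
      then have "l0 = R \<curlyvee> P"
        using points_eq_line[of R P l0] P PR R l0 by auto
      then show False
        using m' mPR by simp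
    qed
    have "l0 \<curlyvee> P = e"
      using rk_jn_point[OF P(1) _ Pl0] l0 e P P' le_trans[of P l e] l by (intro jn_eqI) auto
    then have "\<phi> P = P0"
      unfolding \<phi>_def using m(2) mPR by simp
    then show "\<exists>P. P \<in> lev 1 \<and> P \<preceq> l \<and> \<not> P \<preceq> l0 \<and> \<phi> P = P0"
      using P P' Pl0 by auto
  qed
qed

text \<open>Colour \<open>P\<close> is available to a flag if \<open>P\<close> is in its small
  member or the line \<open>ml P\<close> is in its large member. Two flags of colour
  \<open>P\<close> both have \<open>P\<close> in the large member, which settles all cases except
  two flags of the second kind; there each small member already meets \<open>ml P\<close> for
  reasons of rank.\<close>

lemma ex_colouring:
  obtains K and col :: "'a \<times> 'a \<Rightarrow> 'a" where "finite K" "real (card K) = qint q (d + 2) - real q"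
    "\<And>F. F \<in> FL \<Longrightarrow> col F \<in> K"
    "\<And>A B A' B'. (A, B) \<in> FL \<Longrightarrow> (A', B') \<in> FL \<Longrightarrow> col (A, B) = col (A', B') \<Longrightarrow>
       A \<curlywedge> B' = bt \<Longrightarrow> A' \<curlywedge> B \<noteq> bt"
proof -
  have "0 < qbin q (rk tp) (d + 2)"
    using d3 by (intro qbin_pos) simp
  then have "lev (d + 2) \<noteq> {}"
    using card_lev[of "d + 2"] by auto
  then obtain U where U: "U \<in> lev (d + 2)"
    by blast
  obtain R where R: "R \<in> lev 1" "R \<preceq> U"
    using ex_point[of U] U by auto
  obtain l0 where l0: "l0 \<in> lev 2" "R \<preceq> l0" "l0 \<preceq> U"
    using ex_line_below[of R U] R U by auto
  obtain \<phi> where \<phi>1: "\<And>P. P \<in> lev 1 \<Longrightarrow> P \<preceq> U \<Longrightarrow> \<not> P \<preceq> l0 \<Longrightarrow> \<phi> P \<in> lev 1 \<and> \<phi> P \<preceq> l0"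
    and \<phi>2: "\<And>P0 l. P0 \<in> lev 1 \<Longrightarrow> P0 \<preceq> l0 \<Longrightarrow> P0 \<noteq> R \<Longrightarrow> l \<in> lev 2 \<Longrightarrow> l \<preceq> U \<Longrightarrow> l \<noteq> l0 \<Longrightarrow> P0 \<preceq> l \<Longrightarrow>
      \<exists>P. P \<in> lev 1 \<and> P \<preceq> l \<and> \<not> P \<preceq> l0 \<and> \<phi> P = P0"
    using ex_transversal_map[of U l0 R] U R l0 by auto
  define K where "K = {P \<in> lev 1. P \<preceq> U} - ({P \<in> lev 1. P \<preceq> l0} - {R})"
  \<comment> \<open>\<open>R\<close> is the only kept point of \<open>l0\<close>; it takes the flags
    whose large member contains \<open>l0\<close> itself.\<close>
  define ml where "ml P = (if P = R then l0 else P \<curlyvee> \<phi> P)" for P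
  have KI: "P \<in> K \<longleftrightarrow> P \<in> lev 1 \<and> P \<preceq> U \<and> (P = R \<or> \<not> P \<preceq> l0)" for P
    using R l0 by (auto simp: K_def)
  have ml: "ml P \<in> lev 2" "P \<preceq> ml P" if P: "P \<in> K" for P
  proof -
    have "P \<noteq> R \<Longrightarrow> P \<noteq> \<phi> P \<and> \<phi> P \<in> lev 1"
      using P \<phi>1[of P] by (auto simp: KI)
    then show "ml P \<in> lev 2" "P \<preceq> ml P"
      using P l0 rk_line[of P "\<phi> P"] by (auto simp: ml_def KI intro!: levI)
  qed
  have ex: "\<exists>P. P \<in> K \<and> (P \<preceq> A \<or> ml P \<preceq> B)" if F: "(A, B) \<in> FL" for A B
  proof -
    have A: "A \<in> lev d" "B \<in> lev (d + 1)" "A \<preceq> B"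
      using F by (auto simp: FL_def)
    show ?thesis
    proof (cases "\<exists>P\<in>K. P \<preceq> A")
      case False
      have sub: "P \<preceq> l0" "P \<noteq> R" if "P \<in> lev 1" "P \<preceq> A \<curlywedge> U" for P
        using False that A U by (auto simp: KI le_mt_iff)
      \<comment> \<open>The ranks d and d + 2 exceed the total 2 d + 1 by one, the ranks d + 1 and d
        + 2 by two.\<close>
      have rkA: "1 \<le> rk (A \<curlywedge> U)"
        using modular[of A U] rk_le_tp[of "A \<curlyvee> U"] A U by simp
      have rkB: "2 \<le> rk (B \<curlywedge> U)"
        using modular[of B U] rk_le_tp[of "B \<curlyvee> U"] A U by simp
      obtain P0 where P0: "P0 \<in> lev 1" "P0 \<preceq> A \<curlywedge> U"
        using ex_point[of "A \<curlywedge> U"] rkA A U by auto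
      have P0': "P0 \<preceq> A" "P0 \<preceq> U" "P0 \<preceq> l0" "P0 \<noteq> R"
        using P0 sub A U by (auto simp: le_mt_iff)
      have "P0 \<preceq> B \<curlywedge> U"
        using P0 P0' A U le_trans[of P0 A B] by (auto intro: mt_greatest)
      then obtain l where l: "l \<in> lev 2" "P0 \<preceq> l" "l \<preceq> B \<curlywedge> U"
        using ex_line_below[of P0 "B \<curlywedge> U"] rkB P0 A U by auto
      have l': "l \<preceq> B" "l \<preceq> U"
        using l A U by (auto simp: le_mt_iff)
      show ?thesis
      proof (cases "l = l0")
        case True
        then show ?thesis
          using l' R by (intro exI[of _ R]) (auto simp: KI ml_def)
      next
        case False
        obtain P where P: "P \<in> lev 1" "P \<preceq> l" "\<not> P \<preceq> l0" "\<phi> P = P0"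
          using \<phi>2[OF P0(1) P0'(3,4) l(1) l'(2) False l(2)] by blast
        have "P \<preceq> U"
          using le_trans[of P l U] P l l' U by auto
        moreover have "P \<noteq> R"
          using P R l0 by auto
        moreover have "P \<curlyvee> P0 \<preceq> B"
          using P P0 l l' A le_trans[of P l B] le_trans[of P0 l B] by (intro jn_least) auto
        ultimately show ?thesis
          using P by (intro exI[of _ P]) (auto simp: KI ml_def)
      qed
    qed blast
  qed
  define col where "col F = (SOME P. P \<in> K \<and> (P \<preceq> fst F \<or> ml P \<preceq> snd F))" for F
  have col: "col (A, B) \<in> K \<and> (col (A, B) \<preceq> A \<or> ml (col (A, B)) \<preceq> B)" if "(A, B) \<in> FL" for A B
    using someI_ex[OF ex[OF that]] by (simp add: col_def)
  show thesis
  proof (rule that[of K col])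
    show "finite K"
      by (simp add: K_def)
    have sub: "{P \<in> lev 1. P \<preceq> l0} - {R} \<subseteq> {P \<in> lev 1. P \<preceq> U}"
      using le_trans[of _ l0 U] l0 U by auto
    have c1: "real (card {P \<in> lev 1. P \<preceq> U}) = qint q (d + 2)"
      using card_points_below[of U] U by simp
    have "card {P \<in> lev 1. P \<preceq> l0} = Suc (card ({P \<in> lev 1. P \<preceq> l0} - {R}))"
      using R l0 by (intro card.remove) auto
    moreover have "real (card {P \<in> lev 1. P \<preceq> l0}) = real q + 1"
      using card_points_below[of l0] l0 by (simp add: qint_def numeral_2_eq_2)
    ultimately have c2: "real (card ({P \<in> lev 1. P \<preceq> l0} - {R})) = real q"
      by simp
    have "card K = card {P \<in> lev 1. P \<preceq> U} - card ({P \<in> lev 1. P \<preceq> l0} - {R})"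
      unfolding K_def using sub by (intro card_Diff_subset) auto
    moreover have "card ({P \<in> lev 1. P \<preceq> l0} - {R}) \<le> card {P \<in> lev 1. P \<preceq> U}"
      using sub by (intro card_mono) auto
    ultimately show "real (card K) = qint q (d + 2) - real q"
      using c1 c2 by (simp add: of_nat_diff)
    show "col F \<in> K" if "F \<in> FL" for F
      using col[of "fst F" "snd F"] that by simp
    fix A B A' B' assume F: "(A, B) \<in> FL" "(A', B') \<in> FL" "col (A, B) = col (A', B')" "A \<curlywedge> B' = bt"
    define P where "P = col (A, B)"
    have lv: "A \<in> lev d" "B \<in> lev (d + 1)" "A \<preceq> B" "A' \<in> lev d" "B' \<in> lev (d + 1)" "A' \<preceq> B'"
      using F by (auto simp: FL_def)
    have P: "P \<in> K" "P \<preceq> A \<or> ml P \<preceq> B" "P \<preceq> A' \<or> ml P \<preceq> B'"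
      using col[OF F(1)] col[OF F(2)] F(3) by (auto simp: P_def)
    have Pl: "P \<in> lev 1" "ml P \<in> lev 2" "P \<preceq> ml P"
      using P ml by (auto simp: KI)
    have common: "x \<curlywedge> y \<noteq> bt" if "P \<preceq> x" "P \<preceq> y" "x \<in> L" "y \<in> L" for x y
    proof -
      have "P \<preceq> x \<curlywedge> y"
        using that Pl by (intro mt_greatest) auto
      then have "rk P \<le> rk (x \<curlywedge> y)"
        using that Pl by (intro rk_mono) auto
      then have "rk (x \<curlywedge> y) \<noteq> 0"
        using Pl by simp
      then show ?thesis
        by (metis rk_bt)
    qed
    have PB: "P \<preceq> B" "P \<preceq> B'"
      using P Pl lv le_trans[of P A B] le_trans[of P "ml P" B] le_trans[of P A' B'] le_trans[of P "ml P" B'] by auto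
    show "A' \<curlywedge> B \<noteq> bt"
    proof (cases "P \<preceq> A'")
      case True
      then show ?thesis
        using common[of A' B] PB lv by auto
    next
      case False
      have nA: "\<not> P \<preceq> A"
        using common[of A B'] PB lv F(4) by auto
      then have m: "ml P \<preceq> B" "ml P \<preceq> B'"
        using P False by auto
      \<comment> \<open>\<open>A\<close> has corank one in \<open>B\<close>, which contains the line
        \<open>ml P\<close>; so \<open>A\<close> contains a point of \<open>ml P\<close>, and this
        point is in \<open>B'\<close>.\<close>
      have "rk (A \<curlyvee> ml P) \<le> d + 1"
        using rk_mono[of "A \<curlyvee> ml P" B] jn_least[of A B "ml P"] m lv Pl by auto
      then have "1 \<le> rk (A \<curlywedge> ml P)"
        using modular[of A "ml P"] lv Pl by simp
      moreover have "A \<curlywedge> ml P \<preceq> A \<curlywedge> B'"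
        using m lv Pl by (intro mt_mono) auto
      ultimately have "1 \<le> rk (A \<curlywedge> B')"
        using rk_mono[of "A \<curlywedge> ml P" "A \<curlywedge> B'"] lv Pl by auto
      then show ?thesis
        using F(4) by simp
    qed
  qed
qed

end

section \<open>Subspace lattices over finite fields\<close>

context abelian_group
begin

lemma add_minus_cancel2:
  assumes "x \<in> carrier G" "y \<in> carrier G" "w \<in> carrier G"
  shows "(x \<oplus> w) \<oplus> (y \<ominus> w) = x \<oplus> y"
proof -
  have "(x \<oplus> w) \<oplus> (y \<ominus> w) = (x \<oplus> y) \<oplus> (w \<oplus> \<ominus> w)"
    using assms by (simp add: minus_eq a_ac)
  then show ?thesis
    using assms by (simp add: r_neg)
qed

lemma add_minus_cancel_left:
  assumes "x \<in> carrier G" "w \<in> carrier G"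
  shows "(x \<oplus> w) \<ominus> x = w" "x \<oplus> (w \<ominus> x) = w"
proof -
  have "(x \<oplus> w) \<ominus> x = w \<oplus> (x \<oplus> \<ominus> x)" "x \<oplus> (w \<ominus> x) = w \<oplus> (x \<oplus> \<ominus> x)"
    using assms by (simp_all add: minus_eq a_ac)
  then show "(x \<oplus> w) \<ominus> x = w" "x \<oplus> (w \<ominus> x) = w"
    using assms by (simp_all add: r_neg)
qed

lemma add_eq_minus_eq:
  assumes "x \<in> carrier G" "y \<in> carrier G" "x' \<in> carrier G" "y' \<in> carrier G" "x \<oplus> y = x' \<oplus> y'"
  shows "x \<ominus> x' = y' \<ominus> y" "y' \<ominus> (x \<ominus> x') = y"
proof -
  have "((x \<oplus> y) \<ominus> y) \<ominus> x' = (x \<ominus> x') \<oplus> (y \<oplus> \<ominus> y)"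
    using assms(1-4) by (simp add: minus_eq a_ac)
  moreover have "((x' \<oplus> y') \<ominus> y) \<ominus> x' = (y' \<ominus> y) \<oplus> (x' \<oplus> \<ominus> x')"
    using assms(1-4) by (simp add: minus_eq a_ac)
  ultimately show e: "x \<ominus> x' = y' \<ominus> y"
    using assms by (simp add: r_neg)
  have "y' \<ominus> (y' \<ominus> y) = y \<oplus> (y' \<oplus> \<ominus> y')"
    using assms(1-4) by (simp add: minus_eq minus_add a_ac)
  then show "y' \<ominus> (x \<ominus> x') = y"
    unfolding e using assms by (simp add: r_neg)
qed

end

locale finite_vs = vectorspace K V for K :: "'a ring" and V :: "('a, 'v) module" +
  assumes finK: "finite (carrier K)" and finV: "finite (carrier V)"
begin

lemma card_V: "card (carrier V) = card (carrier K) ^ dim"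
proof -
  have "gen_set (carrier V)"
    by (metis in_own_span span_is_subset2 subset_antisym order_refl)
  then have "fin_dim"
    unfolding fin_dim_def using finV by blast
  then obtain b where b: "finite b" "basis b"
    using finite_basis_exists by blast
  then have bV: "b \<subseteq> carrier V"
    by (simp add: basis_def)
  have uniq: "\<forall>v. v \<in> carrier V \<longrightarrow> (\<exists>! a. a \<in> b \<rightarrow>\<^sub>E carrier K \<and> lincomb a b = v)"
    using basis_criterion[OF b(1) bV] b(2) by simp
  have "bij_betw (\<lambda>a. lincomb a b) (b \<rightarrow>\<^sub>E carrier K) (carrier V)"
  proof (rule bij_betwI')
    fix a a' assume a: "a \<in> b \<rightarrow>\<^sub>E carrier K" "a' \<in> b \<rightarrow>\<^sub>E carrier K"
    have "lincomb a b \<in> carrier V"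
      using a bV by (intro lincomb_closed) auto
    then show "(lincomb a b = lincomb a' b) = (a = a')"
      using uniq a by metis
  next
    fix a assume "a \<in> b \<rightarrow>\<^sub>E carrier K"
    then show "lincomb a b \<in> carrier V"
      using bV by (intro lincomb_closed) auto
  next
    fix v assume "v \<in> carrier V"
    then show "\<exists>a\<in>b \<rightarrow>\<^sub>E carrier K. v = lincomb a b"
      using uniq by metis
  qed
  then have "card (carrier V) = card (b \<rightarrow>\<^sub>E carrier K)"
    by (metis bij_betw_same_card)
  also have "\<dots> = card (carrier K) ^ card b"
    using b(1) by (simp add: card_PiE)
  finally show ?thesis
    using dim_basis[OF b] by simp
qed

lemma subspaceD:
  assumes "subspace K A V"
  shows "A \<subseteq> carrier V" "\<zero>\<^bsub>V\<^esub> \<in> A" "x \<in> A \<Longrightarrow> y \<in> A \<Longrightarrow> x \<oplus>\<^bsub>V\<^esub> y \<in> A"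
    "c \<in> carrier K \<Longrightarrow> x \<in> A \<Longrightarrow> c \<odot>\<^bsub>V\<^esub> x \<in> A" "x \<in> A \<Longrightarrow> y \<in> A \<Longrightarrow> x \<ominus>\<^bsub>V\<^esub> y \<in> A"
proof -
  interpret submodule K A V
    using assms by (simp add: subspace_def)
  show "A \<subseteq> carrier V" "\<zero>\<^bsub>V\<^esub> \<in> A" "x \<in> A \<Longrightarrow> y \<in> A \<Longrightarrow> x \<oplus>\<^bsub>V\<^esub> y \<in> A"
    "c \<in> carrier K \<Longrightarrow> x \<in> A \<Longrightarrow> c \<odot>\<^bsub>V\<^esub> x \<in> A"
    using subset by auto
  assume x: "x \<in> A" "y \<in> A"
  have "\<ominus>\<^bsub>V\<^esub> y = (\<ominus>\<^bsub>K\<^esub> \<one>\<^bsub>K\<^esub>) \<odot>\<^bsub>V\<^esub> y"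
    using x subset by (simp add: smult_minus_1 subset_iff)
  then have "\<ominus>\<^bsub>V\<^esub> y \<in> A"
    using x by simp
  then show "x \<ominus>\<^bsub>V\<^esub> y \<in> A"
    using x by (simp add: a_minus_def)
qed

lemma subspaceI:
  assumes "A \<subseteq> carrier V" "\<zero>\<^bsub>V\<^esub> \<in> A" "\<And>x y. x \<in> A \<Longrightarrow> y \<in> A \<Longrightarrow> x \<oplus>\<^bsub>V\<^esub> y \<in> A"
    "\<And>c x. c \<in> carrier K \<Longrightarrow> x \<in> A \<Longrightarrow> c \<odot>\<^bsub>V\<^esub> x \<in> A"
  shows "subspace K A V"
  using assms by (intro subspace.intro submodule.intro) (auto intro: vectorspace_axioms module_axioms)

lemma finite_subspace: "subspace K A V \<Longrightarrow> finite A"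
  using subspaceD(1) finV finite_subset by blast

text \<open>The bridge to counting: as q is at least 2, facts about ranks can be read off from
  cardinalities, so bases are needed in \<open>card_V\<close> only.\<close>

lemma card_subspace:
  assumes "subspace K A V"
  shows "card A = card (carrier K) ^ rank K V A"
proof -
  interpret A: vectorspace K "vs A"
    by (rule subspace_is_vs[OF assms])
  interpret A: finite_vs K "vs A"
    by unfold_locales (use finK finite_subspace[OF assms] in auto)
  show ?thesis
    using A.card_V by (simp add: rank_def)
qed

lemma subspace_Int:
  assumes "subspace K A V" "subspace K B V"
  shows "subspace K (A \<inter> B) V"
  using subspaceD[OF assms(1)] subspaceD[OF assms(2)] by (intro subspaceI) auto

lemma subspace_zero: "subspace K {\<zero>\<^bsub>V\<^esub>} V"
  by (rule subspaceI) auto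

lemma subspace_carrier: "subspace K (carrier V) V"
  by (rule subspaceI) auto

lemma q_ge_2: "2 \<le> card (carrier K)"
proof -
  have "{\<zero>\<^bsub>K\<^esub>, \<one>\<^bsub>K\<^esub>} \<subseteq> carrier K"
    by auto
  then have "card {\<zero>\<^bsub>K\<^esub>, \<one>\<^bsub>K\<^esub>} \<le> card (carrier K)"
    using finK by (rule card_mono[rotated])
  then show ?thesis
    by simp
qed

text \<open>For each z of the sum one decomposition \<open>r z\<close> is fixed. All others arise by
  adding an element w of the intersection to the first part and subtracting it from the second, so
  pairs (z, w) correspond to pairs of elements of \<open>A\<close> and \<open>B\<close>.\<close>

lemma card_sum:
  assumes A: "subspace K A V" and B: "subspace K B V"
  shows "card (submodule_sum A B) * card (A \<inter> B) = card A * card B"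
proof -
  note A' = subspaceD[OF A] and B' = subspaceD[OF B]
  define r where "r z = (SOME p. fst p \<in> A \<and> snd p \<in> B \<and> fst p \<oplus>\<^bsub>V\<^esub> snd p = z)" for z
  have r: "fst (r z) \<in> A \<and> snd (r z) \<in> B \<and> fst (r z) \<oplus>\<^bsub>V\<^esub> snd (r z) = z" if "z \<in> submodule_sum A B" for z
  proof -
    have "\<exists>p. fst p \<in> A \<and> snd p \<in> B \<and> fst p \<oplus>\<^bsub>V\<^esub> snd p = z"
      using that by (force simp: submodule_sum_def)
    then show ?thesis
      unfolding r_def by (rule someI_ex)
  qed
  have sum: "x \<oplus>\<^bsub>V\<^esub> y \<in> submodule_sum A B" if "x \<in> A" "y \<in> B" for x y
    using that by (force simp: submodule_sum_def)
  define f where "f = (\<lambda>(z, w). (fst (r z) \<oplus>\<^bsub>V\<^esub> w, snd (r z) \<ominus>\<^bsub>V\<^esub> w))"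
  define g where "g = (\<lambda>(x, y). (x \<oplus>\<^bsub>V\<^esub> y, x \<ominus>\<^bsub>V\<^esub> fst (r (x \<oplus>\<^bsub>V\<^esub> y))))"
  have "bij_betw f (submodule_sum A B \<times> (A \<inter> B)) (A \<times> B)"
  proof (rule bij_betw_byWitness[of _ g])
    show "\<forall>p\<in>submodule_sum A B \<times> (A \<inter> B). g (f p) = p"
    proof safe
      fix z w assume z: "z \<in> submodule_sum A B" and w: "w \<in> A" "w \<in> B"
      have c: "fst (r z) \<in> carrier V" "snd (r z) \<in> carrier V" "w \<in> carrier V"
        using r[OF z] w A' B' by auto
      have "fst (f (z, w)) \<oplus>\<^bsub>V\<^esub> snd (f (z, w)) = z"
        using r[OF z] M.add_minus_cancel2[OF c] by (simp add: f_def)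
      then show "g (f (z, w)) = (z, w)"
        using M.add_minus_cancel_left(1)[OF c(1,3)] by (simp add: g_def f_def)
    qed
    show "\<forall>p\<in>A \<times> B. f (g p) = p"
    proof safe
      fix x y assume xy: "x \<in> A" "y \<in> B"
      define z where "z = x \<oplus>\<^bsub>V\<^esub> y"
      have z: "z \<in> submodule_sum A B"
        unfolding z_def by (rule sum[OF xy])
      have c: "fst (r z) \<in> carrier V" "snd (r z) \<in> carrier V" "x \<in> carrier V" "y \<in> carrier V"
        using r[OF z] xy A' B' by auto
      have e: "x \<oplus>\<^bsub>V\<^esub> y = fst (r z) \<oplus>\<^bsub>V\<^esub> snd (r z)"
        using r[OF z] by (simp add: z_def)
      show "f (g (x, y)) = (x, y)"
        using M.add_minus_cancel_left(2)[OF c(1,3)] M.add_eq_minus_eq(2)[OF c(3,4,1,2) e]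
        by (simp add: f_def g_def z_def)
    qed
    show "f ` (submodule_sum A B \<times> (A \<inter> B)) \<subseteq> A \<times> B"
      using r A' B' by (auto simp: f_def)
    show "g ` (A \<times> B) \<subseteq> submodule_sum A B \<times> (A \<inter> B)"
    proof safe
      fix x y z w assume xy: "x \<in> A" "y \<in> B" and g: "(z, w) = g (x, y)"
      have z: "z = x \<oplus>\<^bsub>V\<^esub> y" "z \<in> submodule_sum A B"
        using sum[OF xy] g by (auto simp: g_def)
      have w: "w = x \<ominus>\<^bsub>V\<^esub> fst (r z)"
        using g z by (simp add: g_def)
      show "z \<in> submodule_sum A B"
        by (rule z(2))
      show "w \<in> A"
        using r[OF z(2)] xy A' w by auto
      have c: "fst (r z) \<in> carrier V" "snd (r z) \<in> carrier V" "x \<in> carrier V" "y \<in> carrier V"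
        using r[OF z(2)] xy A' B' by auto
      have "w = snd (r z) \<ominus>\<^bsub>V\<^esub> y"
        unfolding w using r[OF z(2)] z by (intro M.add_eq_minus_eq(1)[OF c(3,4,1,2)]) simp
      then show "w \<in> B"
        using r[OF z(2)] xy B' by auto
    qed
  qed
  then have "card (submodule_sum A B \<times> (A \<inter> B)) = card (A \<times> B)"
    by (rule bij_betw_same_card)
  then show ?thesis
    by (simp add: card_cartesian_product)
qed

lemma rank_modular:
  assumes A: "subspace K A V" and B: "subspace K B V"
  shows "rank K V (A \<inter> B) + rank K V (submodule_sum A B) = rank K V A + rank K V B"
proof -
  have "card (carrier K) ^ (rank K V (submodule_sum A B) + rank K V (A \<inter> B))
      = card (carrier K) ^ (rank K V A + rank K V B)"
    using card_sum[OF A B] card_subspace[OF A] card_subspace[OF B] card_subspace[OF subspace_Int[OF A B]]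
      card_subspace[OF sum_is_subspace[OF A B]] by (simp add: power_add)
  then show ?thesis
    using q_ge_2 by (simp add: power_inject_exp)
qed

lemma rank_strict:
  assumes A: "subspace K A V" and B: "subspace K B V" and AB: "A \<subseteq> B" "A \<noteq> B"
  shows "rank K V A < rank K V B"
proof -
  have "card A < card B"
    using AB finite_subspace[OF B] by (intro psubset_card_mono) auto
  then show ?thesis
    using q_ge_2 unfolding card_subspace[OF A] card_subspace[OF B] by (auto intro: power_less_imp_less_exp)
qed

lemma rank_zero: "rank K V {\<zero>\<^bsub>V\<^esub>} = 0"
proof -
  have "card (carrier K) ^ rank K V {\<zero>\<^bsub>V\<^esub>} = 1"
    using card_subspace[OF subspace_zero] by simp
  then show ?thesis
    using q_ge_2 by simp
qed

lemma ray:
  assumes v: "v \<in> carrier V" "v \<noteq> \<zero>\<^bsub>V\<^esub>"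
  defines "S \<equiv> (\<lambda>c. c \<odot>\<^bsub>V\<^esub> v) ` carrier K"
  shows "subspace K S V" "rank K V S = 1" "v \<in> S"
    "\<And>A. subspace K A V \<Longrightarrow> v \<notin> A \<Longrightarrow> A \<inter> S = {\<zero>\<^bsub>V\<^esub>}"
proof -
  have inv: "inv\<^bsub>K\<^esub> c \<odot>\<^bsub>V\<^esub> (c \<odot>\<^bsub>V\<^esub> v) = v" "inv\<^bsub>K\<^esub> c \<in> carrier K"
    if c: "c \<in> carrier K" "c \<noteq> \<zero>\<^bsub>K\<^esub>" for c
  proof -
    have "c \<in> Units K"
      using c field_Units by auto
    then show i: "inv\<^bsub>K\<^esub> c \<in> carrier K"
      by (rule Units_inv_closed)
    have "inv\<^bsub>K\<^esub> c \<otimes>\<^bsub>K\<^esub> c = \<one>\<^bsub>K\<^esub>"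
      using \<open>c \<in> Units K\<close> by (rule Units_l_inv)
    then show "inv\<^bsub>K\<^esub> c \<odot>\<^bsub>V\<^esub> (c \<odot>\<^bsub>V\<^esub> v) = v"
      using smult_assoc1[OF i c(1) v(1)] smult_one[OF v(1)] by simp
  qed
  show S: "subspace K S V"
  proof (rule subspaceI)
    show "S \<subseteq> carrier V"
      using v by (auto simp: S_def)
    have "\<zero>\<^bsub>V\<^esub> = \<zero>\<^bsub>K\<^esub> \<odot>\<^bsub>V\<^esub> v"
      using v by simp
    then show "\<zero>\<^bsub>V\<^esub> \<in> S"
      unfolding S_def by blast
    fix x y assume "x \<in> S" "y \<in> S"
    then obtain c c' where c: "c \<in> carrier K" "c' \<in> carrier K" "x = c \<odot>\<^bsub>V\<^esub> v" "y = c' \<odot>\<^bsub>V\<^esub> v"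
      by (auto simp: S_def)
    then have "x \<oplus>\<^bsub>V\<^esub> y = (c \<oplus>\<^bsub>K\<^esub> c') \<odot>\<^bsub>V\<^esub> v"
      using v by (simp add: smult_l_distr)
    then show "x \<oplus>\<^bsub>V\<^esub> y \<in> S"
      unfolding S_def using c by blast
  next
    fix c x assume "c \<in> carrier K" "x \<in> S"
    then obtain c' where c: "c \<in> carrier K" "c' \<in> carrier K" "x = c' \<odot>\<^bsub>V\<^esub> v"
      by (auto simp: S_def)
    then have "c \<odot>\<^bsub>V\<^esub> x = (c \<otimes>\<^bsub>K\<^esub> c') \<odot>\<^bsub>V\<^esub> v"
      using v by (simp add: smult_assoc1)
    then show "c \<odot>\<^bsub>V\<^esub> x \<in> S"
      unfolding S_def using c by blast
  qed
  have "inj_on (\<lambda>c. c \<odot>\<^bsub>V\<^esub> v) (carrier K)"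
  proof (rule inj_onI, rule ccontr)
    fix c c' assume c: "c \<in> carrier K" "c' \<in> carrier K" "c \<odot>\<^bsub>V\<^esub> v = c' \<odot>\<^bsub>V\<^esub> v" "c \<noteq> c'"
    define e where "e = c \<ominus>\<^bsub>K\<^esub> c'"
    have "abelian_group K"
      by unfold_locales
    then have e: "e \<in> carrier K" "e \<noteq> \<zero>\<^bsub>K\<^esub>"
      using c abelian_group.add_minus_cancel_left(2)[of K c' c] abelian_monoid.r_zero[of K c']
      by (auto simp: e_def)
    have "e \<odot>\<^bsub>V\<^esub> v = c \<odot>\<^bsub>V\<^esub> v \<oplus>\<^bsub>V\<^esub> \<ominus>\<^bsub>V\<^esub> (c' \<odot>\<^bsub>V\<^esub> v)"
      using c v by (simp add: e_def a_minus_def smult_l_distr smult_l_minus)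
    also have "\<dots> = \<zero>\<^bsub>V\<^esub>"
      using c v by (simp add: M.r_neg)
    finally have "v = inv\<^bsub>K\<^esub> e \<odot>\<^bsub>V\<^esub> \<zero>\<^bsub>V\<^esub>"
      using inv(1)[OF e] by simp
    then show False
      using v inv(2)[OF e] by simp
  qed
  then have "card S = card (carrier K)"
    unfolding S_def by (rule card_image)
  then have "card (carrier K) ^ rank K V S = card (carrier K) ^ 1"
    using card_subspace[OF S] by simp
  then show "rank K V S = 1"
    using q_ge_2 by (subst (asm) power_inject_exp) auto
  have "v = \<one>\<^bsub>K\<^esub> \<odot>\<^bsub>V\<^esub> v"
    using v by simp
  then show "v \<in> S"
    unfolding S_def by blast
  fix A assume A: "subspace K A V" "v \<notin> A"
  show "A \<inter> S = {\<zero>\<^bsub>V\<^esub>}"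
  proof
    show "A \<inter> S \<subseteq> {\<zero>\<^bsub>V\<^esub>}"
    proof
      fix x assume x: "x \<in> A \<inter> S"
      then obtain c where c: "c \<in> carrier K" "x = c \<odot>\<^bsub>V\<^esub> v"
        by (auto simp: S_def)
      have "c = \<zero>\<^bsub>K\<^esub>"
      proof (rule ccontr)
        assume "c \<noteq> \<zero>\<^bsub>K\<^esub>"
        then have "v \<in> A"
          using inv[OF c(1)] subspaceD(4)[OF A(1), of "inv\<^bsub>K\<^esub> c" x] x c by simp
        then show False
          using A by simp
      qed
      then show "x \<in> {\<zero>\<^bsub>V\<^esub>}"
        using c v by simp
    qed
    show "{\<zero>\<^bsub>V\<^esub>} \<subseteq> A \<inter> S"
      using subspaceD(2)[OF A(1)] subspaceD(2)[OF S] by simp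
  qed
qed

text \<open>The sets z - x, for the covers z of x below y, partition y - x: a vector outside x spans
  a unique cover together with x. They all have q^r (q - 1) elements, where r is the rank of
  x.\<close>

lemma card_covers:
  assumes x: "subspace K x V" and y: "subspace K y V" and xy: "x \<subseteq> y"
  shows "card {z \<in> {A. subspace K A V}. x \<subseteq> z \<and> z \<subseteq> y \<and> rank K V z = Suc (rank K V x)}
    = (\<Sum>i<rank K V y - rank K V x. card (carrier K) ^ i)" (is "card ?Z = ?s")
proof -
  define q where "q = card (carrier K)"
  define r where "r = rank K V x"
  define m where "m = rank K V y - rank K V x"
  have q2: "2 \<le> q"
    using q_ge_2 by (simp add: q_def)
  have ry: "rank K V y = r + m"
    using rank_strict[OF x y xy] by (cases "x = y") (auto simp: r_def m_def)
  have cx: "card x = q ^ r" and cy: "card y = q ^ (r + m)"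
    using card_subspace[OF x] card_subspace[OF y] ry by (auto simp: q_def r_def)
  have fins: "finite x" "finite y"
    using x y finite_subspace by auto
  have finZ: "finite ?Z"
    by (rule finite_subset[of _ "Pow y"]) (use fins in auto)
  have cz: "card (z - x) = q ^ r * (q - 1)" if z: "z \<in> ?Z" for z
  proof -
    have "card z = q ^ Suc r"
      using z card_subspace[of z] by (simp add: q_def r_def)
    then show ?thesis
      using z fins cx by (simp add: card_Diff_subset algebra_simps diff_mult_distrib2)
  qed
  have un: "(\<Union>z\<in>?Z. z - x) = y - x"
  proof
    show "(\<Union>z\<in>?Z. z - x) \<subseteq> y - x"
      by auto
    show "y - x \<subseteq> (\<Union>z\<in>?Z. z - x)"
    proof
      fix v assume v: "v \<in> y - x"
      have vV: "v \<in> carrier V" "v \<noteq> \<zero>\<^bsub>V\<^esub>"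
        using v subspaceD[OF y] subspaceD[OF x] by auto
      define S where "S = (\<lambda>c. c \<odot>\<^bsub>V\<^esub> v) ` carrier K"
      note S = ray[OF vV, folded S_def]
      define z where "z = submodule_sum x S"
      have z: "subspace K z V"
        unfolding z_def by (rule sum_is_subspace[OF x S(1)])
      have sub: "x \<subseteq> z" "S \<subseteq> z"
        using vsum_is_minimal[OF x S(1) z] by (auto simp: z_def)
      have "S \<subseteq> y"
        using v subspaceD(4)[OF y] by (auto simp: S_def)
      then have "z \<subseteq> y"
        using vsum_is_minimal[OF x S(1) y] xy by (auto simp: z_def)
      moreover have "rank K V z = Suc (rank K V x)"
        using rank_modular[OF x S(1)] S(2) S(4)[OF x] v rank_zero by (simp add: z_def)
      ultimately have "z \<in> ?Z"
        using z sub by simp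
      then show "v \<in> (\<Union>z\<in>?Z. z - x)"
        using v S(3) sub by blast
    qed
  qed
  have disj: "(z - x) \<inter> (z' - x) = {}" if z: "z \<in> ?Z" "z' \<in> ?Z" "z \<noteq> z'" for z z'
  proof (rule ccontr)
    assume "(z - x) \<inter> (z' - x) \<noteq> {}"
    then have ne: "x \<noteq> z \<inter> z'"
      by blast
    have i: "subspace K (z \<inter> z') V"
      using z by (intro subspace_Int) auto
    have "rank K V x < rank K V (z \<inter> z')"
      using rank_strict[OF x i _ ne] z by auto
    moreover have "z \<inter> z' \<noteq> z \<Longrightarrow> rank K V (z \<inter> z') < rank K V z" "z \<inter> z' \<noteq> z' \<Longrightarrow> rank K V (z \<inter> z') < rank K V z'"
      using rank_strict[OF i, of z] rank_strict[OF i, of z'] z by auto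
    ultimately have "z \<inter> z' = z" "z \<inter> z' = z'"
      using z by auto
    then show False
      using z by simp
  qed
  have "card (y - x) = (\<Sum>z\<in>?Z. card (z - x))"
    unfolding un[symmetric] using finZ fins disj by (intro card_UN_disjoint) (auto intro: finite_subset)
  then have "card ?Z * (q ^ r * (q - 1)) = card (y - x)"
    using cz by simp
  also have "\<dots> = q ^ r * (q ^ m - 1)"
    using fins xy cx cy by (simp add: card_Diff_subset power_add diff_mult_distrib2)
  finally have "q ^ r * (card ?Z * (q - 1)) = q ^ r * (q ^ m - 1)"
    by (simp add: ac_simps)
  then have "card ?Z * (q - 1) = q ^ m - 1"
    using q2 by simp
  moreover have "(\<Sum>i<m. q ^ i) * (q - 1) = q ^ m - 1"
  proof -
    have "real ((\<Sum>i<m. q ^ i) * (q - 1)) = qint q m * (real q - 1)"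
      using q2 by (simp add: qint_def)
    also have "\<dots> = real q ^ m - 1"
      by (rule qint_closed[OF q2])
    also have "\<dots> = real (q ^ m - 1)"
      using q2 by (simp add: of_nat_diff)
    finally show ?thesis
      by (rule of_nat_eq_iff[THEN iffD1])
  qed
  ultimately have "card ?Z * (q - 1) = (\<Sum>i<m. q ^ i) * (q - 1)"
    by simp
  then show ?thesis
    using q2 by (simp add: q_def m_def)
qed

lemma qlat_subspaces:
  "qlat {A. subspace K A V} (\<subseteq>) (\<inter>) submodule_sum {\<zero>\<^bsub>V\<^esub>} (carrier V) (rank K V) (card (carrier K))"
proof unfold_locales
  have "{A. subspace K A V} \<subseteq> Pow (carrier V)"
    using subspaceD(1) by auto
  then show "finite {A. subspace K A V}"
    using finV finite_subset by blast
next
  fix x y assume xy: "x \<in> {A. subspace K A V}" "y \<in> {A. subspace K A V}"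
  show "x \<subseteq> submodule_sum x y" "y \<subseteq> submodule_sum x y"
    using vsum_is_minimal[of x y "submodule_sum x y"] sum_is_subspace xy by auto
  show "card {z \<in> {A. subspace K A V}. x \<subseteq> z \<and> z \<subseteq> y \<and> rank K V z = Suc (rank K V x)} =
       (\<Sum>i<rank K V y - rank K V x. card (carrier K) ^ i)" if "x \<subseteq> y"
    using card_covers that xy by auto
qed (auto simp: q_ge_2 subspace_Int sum_is_subspace vsum_is_minimal subspace_zero subspace_carrier rank_zero
      rank_modular rank_strict dest: subspaceD)

end

lemma coord_space_finite_vs:
  assumes "field K" "finite (carrier K)"
  shows "finite_vs K (coord_space K n)" "rank K (coord_space K n) (carrier (coord_space K n)) = n"
proof -
  interpret field K
    by (rule assms(1))
  have "module K (coord_space K n)"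
    unfolding coord_space_def by (rule func_space_is_module)
  then interpret vectorspace K "coord_space K n"
    by (simp add: vectorspace_def assms(1))
  have c: "carrier (coord_space K n) = {..<n} \<rightarrow>\<^sub>E carrier K"
    by (simp add: coord_space_def func_space_def)
  show f: "finite_vs K (coord_space K n)"
    by unfold_locales (use assms(2) in \<open>auto simp: c intro: finite_PiE\<close>)
  interpret finite_vs K "coord_space K n"
    by (rule f)
  have "card (carrier K) ^ rank K (coord_space K n) (carrier (coord_space K n)) = card (carrier K) ^ n"
    using card_subspace[OF subspace_carrier] by (simp add: c card_PiE)
  then show "rank K (coord_space K n) (carrier (coord_space K n)) = n"
    using q_ge_2 by (subst (asm) power_inject_exp) auto
qed

text \<open>From 112^2 > 10^4 follows 112^8 > 10^16, the origin of that constant. The exponent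
  2^(d+1) - 1 is at least d + 9; the remaining d + 1 factors 112 turn into 56 after division by
  2^(d+1) and dominate (d+1)^2 \<le> 4^d.\<close>

lemma Kneser_bound_arith:
  fixes q :: real
  assumes "3 \<le> d" "3 * 112 ^ (2 ^ (d + 1) - 1) * (1 / 2 ^ (d + 1)) < q"
  shows "10000000000000000 * (real d + 1)\<^sup>2 \<le> q"
proof -
  have e: "2 * d + 10 \<le> 2 ^ (d + 1)"
    using assms(1) by (induction d rule: nat_induct_at_least) auto
  have d: "(real d + 1)\<^sup>2 \<le> 4 ^ d"
  proof -
    have "real (d + 1) \<le> 2 ^ d"
      by (induction d) auto
    then have "(real d + 1)\<^sup>2 \<le> (2 ^ d)\<^sup>2"
      by (intro power_mono) auto
    then show ?thesis
      by (simp add: power_mult[symmetric] mult.commute[of d] power_mult)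
  qed
  have "10000000000000000 * (real d + 1)\<^sup>2 \<le> 10000000000000000 * 4 ^ d"
    using d by simp
  also have "\<dots> \<le> 112 ^ 8 * 56 ^ (d + 1)"
    by (intro mult_mono order_trans[OF power_mono[of 4 "56::real" d]]) auto
  also have "\<dots> = 112 ^ 8 * 112 ^ (d + 1) * (1 / 2 ^ (d + 1))"
  proof -
    have "(56::real) ^ (d + 1) = (112 / 2) ^ (d + 1)"
      by simp
    then show ?thesis
      by (simp only: power_divide times_divide_eq_right mult_1_right)
  qed
  also have "\<dots> = 112 ^ (d + 9) * (1 / 2 ^ (d + 1))"
    by (simp add: power_add)
  also have "\<dots> \<le> 3 * 112 ^ (2 ^ (d + 1) - 1) * (1 / 2 ^ (d + 1))"
  proof (rule mult_right_mono)
    have "(112::real) ^ (d + 9) \<le> 112 ^ (2 ^ (d + 1) - 1)"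
      using e by (intro power_increasing) auto
    then show "(112::real) ^ (d + 9) \<le> 3 * 112 ^ (2 ^ (d + 1) - 1)"
      using zero_le_power[of "112::real" "2 ^ (d + 1) - 1"] by linarith
  qed simp
  finally show ?thesis
    using assms(2) by linarith
qed

text \<open>Up to \<alpha> = 10^6 the absolute bound on q is enough, beyond that the square of
  \<alpha> takes over.\<close>

lemma small_set_arith:
  fixes q \<alpha> :: real
  assumes "10000000000000000 \<le> q" "3 / 2 * \<alpha>\<^sup>2 + 21 / 2 * \<alpha> + 17 \<le> q"
  shows "\<alpha> * 1000000 \<le> q"
proof (cases "\<alpha> \<le> 1000000")
  case False
  then have "\<alpha> * 1000000 \<le> \<alpha> * \<alpha>"
    by (intro mult_left_mono) auto
  then show ?thesis
    using assms(2) False unfolding power2_eq_square by linarith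
qed (use assms(1) in simp)

lemma ex_maximal_independent:
  assumes "finite (pverts G)" "independent_set G S"
  obtains T where "maximal_independent_set G T" "S \<subseteq> T"
proof -
  have "finite {T. independent_set G T}"
    by (rule finite_subset[of _ "Pow (pverts G)"]) (use assms(1) in \<open>auto simp: independent_set_def\<close>)
  then obtain T where T: "independent_set G T" "S \<subseteq> T" "\<forall>T'\<in>{T. independent_set G T}. T \<subseteq> T' \<longrightarrow> T = T'"
    using finite_has_maximal2[of "{T. independent_set G T}" S] assms(2) by auto
  then have "maximal_independent_set G T"
    unfolding maximal_independent_set_def by blast
  then show thesis
    using that T(2) by blast
qed

section \<open>Transfer between the Kneser graph and the lattice of subspaces\<close>

locale gf_flags =
  fixes q d :: nat and K :: "nat ring" and V :: "(nat, nat \<Rightarrow> nat) module"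
    and \<Gamma> :: "(nat \<Rightarrow> nat) set set pair_pre_digraph"
  assumes GF: "is_GF q K" and d3: "3 \<le> d" and q_big: "10000000000000000 * (real d + 1)\<^sup>2 \<le> real q"
    and V: "V = coord_space K (2 * d + 1)" and \<Gamma>: "\<Gamma> = kneser_graph K (2 * d + 1) {d, d + 1}"
begin

lemma point_pencil_eq:
  "point_pencil K d P = {f \<in> flags K V {d, d + 1}. \<exists>A\<in>f. rank K V A = d \<and> P \<subseteq> A}"
  and dual_point_pencil_eq:
  "dual_point_pencil K d P = {f \<in> flags K V {d, d + 1}. \<exists>B\<in>f. rank K V B = d + 1 \<and> B \<subseteq> P}"
  by (simp_all only: point_pencil_def dual_point_pencil_def V)

lemma pverts_eq: "pverts \<Gamma> = flags K V {d, d + 1}"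
  and parcs_eq: "(f1, f2) \<in> parcs \<Gamma> \<longleftrightarrow> f1 \<in> flags K V {d, d + 1} \<and> f2 \<in> flags K V {d, d + 1} \<and>
    f1 \<noteq> f2 \<and> general_position V f1 f2"
  by (simp_all only: kneser_graph_def V \<Gamma> pair_pre_digraph.simps mem_Collect_eq prod.case)

lemma GFD: "field K" "finite (carrier K)" "card (carrier K) = q"
  using GF by (auto simp: is_GF_def)

sublocale W: finite_vs K V
  unfolding V by (rule coord_space_finite_vs(1)[OF GFD(1,2)])

lemma rank_V: "rank K V (carrier V) = 2 * d + 1"
  unfolding V by (rule coord_space_finite_vs(2)[OF GFD(1,2)])

sublocale F: qflag_dual "{A. subspace K A V}" "(\<subseteq>)" "(\<inter>)" "module.submodule_sum V" "{\<zero>\<^bsub>V\<^esub>}" "carrier V" "rank K V" q d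
proof -
  interpret qlat "{A. subspace K A V}" "(\<subseteq>)" "(\<inter>)" "module.submodule_sum V" "{\<zero>\<^bsub>V\<^esub>}" "carrier V" "rank K V" q
    using W.qlat_subspaces by (simp add: GFD(3))
  show "qflag_dual {A. subspace K A V} (\<subseteq>) (\<inter>) (module.submodule_sum V) {\<zero>\<^bsub>V\<^esub>} (carrier V) (rank K V) q d"
    by unfold_locales (fact d3 rank_V q_big)+
qed

lemma lev_eq: "F.lev r = subspaces_of_rank K V r"
  unfolding F.lev_def subspaces_of_rank_def by blast

text \<open>Flags as sets become ordered pairs, the form in which the lattice part treats
  them.\<close>

definition prs :: "(nat \<Rightarrow> nat) set set set \<Rightarrow> ((nat \<Rightarrow> nat) set \<times> (nat \<Rightarrow> nat) set) set" where
  "prs C = {(A, B) \<in> F.FL. {A, B} \<in> C}"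

lemma FLD:
  assumes "(A, B) \<in> F.FL"
  shows "A \<in> F.lev d" "B \<in> F.lev (d + 1)" "A \<subseteq> B" "subspace K A V" "subspace K B V" "rank K V A = d" "rank K V B = d + 1"
  using assms unfolding F.FL_def lev_eq subspaces_of_rank_def by auto

lemma pair_flag:
  assumes "(A, B) \<in> F.FL"
  shows "{A, B} \<in> flags K V {d, d + 1}"
proof -
  note AB = FLD[OF assms]
  have "A \<noteq> {\<zero>\<^bsub>V\<^esub>}" "B \<noteq> {\<zero>\<^bsub>V\<^esub>}" "A \<noteq> carrier V" "B \<noteq> carrier V"
  proof -
    have "rank K V A \<noteq> 0" "rank K V B \<noteq> 0" "rank K V A \<noteq> 2 * d + 1" "rank K V B \<noteq> 2 * d + 1"
      using AB(6,7) d3 by simp_all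
    then show "A \<noteq> {\<zero>\<^bsub>V\<^esub>}" "B \<noteq> {\<zero>\<^bsub>V\<^esub>}" "A \<noteq> carrier V" "B \<noteq> carrier V"
      using W.rank_zero rank_V by metis+
  qed
  then show ?thesis
    using AB by (auto simp: flags_def is_flag_def vectorial_type_def)
qed

text \<open>On a chain of subspaces the rank is injective, so a flag with two ranks has exactly two
  members.\<close>

lemma flag_pair:
  assumes f: "f \<in> flags K V {d, d + 1}"
  obtains A B where "f = {A, B}" "(A, B) \<in> F.FL"
proof -
  have fl: "\<And>X. X \<in> f \<Longrightarrow> subspace K X V" "\<And>X Y. X \<in> f \<Longrightarrow> Y \<in> f \<Longrightarrow> X \<subseteq> Y \<or> Y \<subseteq> X"
    and im: "rank K V ` f = {d, d + 1}"
    using f by (auto simp: flags_def is_flag_def vectorial_type_def)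
  have "d \<in> rank K V ` f" "d + 1 \<in> rank K V ` f"
    unfolding im by auto
  then obtain A B where AB: "A \<in> f" "rank K V A = d" "B \<in> f" "rank K V B = d + 1"
    by (metis imageE)
  have eq: "X = Y" if "X \<in> f" "Y \<in> f" "rank K V X = rank K V Y" for X Y
    using fl(2)[OF that(1,2)]
  proof
    assume "X \<subseteq> Y"
    then show ?thesis
      using F.rk_eqD[of X Y] fl(1) that by simp
  next
    assume "Y \<subseteq> X"
    then show ?thesis
      using F.rk_eqD[of Y X] fl(1) that by simp
  qed
  have "f \<subseteq> {A, B}"
  proof
    fix X assume X: "X \<in> f"
    then have "rank K V X \<in> {d, d + 1}"
      using im by blast
    then show "X \<in> {A, B}"
      using eq[OF X AB(1)] eq[OF X AB(3)] AB by auto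
  qed
  then have "f = {A, B}"
    using AB by auto
  moreover have "A \<subseteq> B"
    using fl(2)[OF AB(1,3)] F.rk_mono[of B A] fl(1) AB by auto
  ultimately show thesis
    using that[of A B] AB fl(1) unfolding F.FL_def lev_eq subspaces_of_rank_def by auto
qed

lemma pair_inj:
  assumes "(A, B) \<in> F.FL" "(A', B') \<in> F.FL" "{A, B} = {A', B'}"
  shows "A = A'" "B = B'"
  using assms FLD(6,7)[OF assms(1)] FLD(6,7)[OF assms(2)] by (auto simp: doubleton_eq_iff)

text \<open>Only the two mixed conditions matter. For ranks d and d + 1, trivial intersection and
  spanning are equivalent; a trivial \<open>A \<inter> B'\<close> makes \<open>A \<inter> A'\<close>
  trivial, and a spanning pair \<open>B\<close>, \<open>A'\<close> makes \<open>B\<close>,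
  \<open>B'\<close> spanning. A flag cannot be adjacent to itself because \<open>A\<close> is not
  zero.\<close>

lemma arc_iff:
  assumes F: "(A, B) \<in> F.FL" "(A', B') \<in> F.FL"
  shows "({A, B}, {A', B'}) \<in> parcs \<Gamma> \<longleftrightarrow> A \<inter> B' = {\<zero>\<^bsub>V\<^esub>} \<and> A' \<inter> B = {\<zero>\<^bsub>V\<^esub>}"
proof -
  note A = FLD[OF F(1)] and A' = FLD[OF F(2)]
  have sums: "W.submodule_sum X Y = carrier V \<longleftrightarrow> rank K V (X \<inter> Y) + (2 * d + 1) = rank K V X + rank K V Y"
    if "subspace K X V" "subspace K Y V" for X Y
    using W.rank_modular[OF that] F.rk_eq_tp_iff[of "W.submodule_sum X Y"] W.sum_is_subspace[OF that] rank_V by auto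
  have ints: "X \<inter> Y = {\<zero>\<^bsub>V\<^esub>} \<longleftrightarrow> rank K V (X \<inter> Y) = 0" if "subspace K X V" "subspace K Y V" for X Y
    using F.rk_eq_0_iff[of "X \<inter> Y"] W.subspace_Int[OF that] by auto
  have AA: "A \<inter> B' = {\<zero>\<^bsub>V\<^esub>} \<Longrightarrow> A \<inter> A' = {\<zero>\<^bsub>V\<^esub>}"
    using A' A W.subspaceD(2)[OF A(4)] W.subspaceD(2)[OF A'(4)] by blast
  have BB: "B \<inter> A' = {\<zero>\<^bsub>V\<^esub>} \<Longrightarrow> W.submodule_sum B B' = carrier V"
  proof -
    assume "B \<inter> A' = {\<zero>\<^bsub>V\<^esub>}"
    then have "W.submodule_sum B A' = carrier V"
      using ints[OF A(5) A'(4)] sums[OF A(5) A'(4)] A A' by simp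
    moreover have "W.submodule_sum B A' \<subseteq> W.submodule_sum B B'"
      using F.jn_mono[of B B A' B'] A A' by auto
    moreover have "W.submodule_sum B B' \<subseteq> carrier V"
      using W.subspaceD(1)[OF W.sum_is_subspace[OF A(5) A'(5)]] .
    ultimately show ?thesis
      by auto
  qed
  have e: "A \<inter> B' = {\<zero>\<^bsub>V\<^esub>} \<longleftrightarrow> W.submodule_sum A B' = carrier V" "B \<inter> A' = {\<zero>\<^bsub>V\<^esub>} \<longleftrightarrow> W.submodule_sum B A' = carrier V"
    using ints[OF A(4) A'(5)] sums[OF A(4) A'(5)] ints[OF A(5) A'(4)] sums[OF A(5) A'(4)] A A' by simp_all
  have gp: "general_position V {A, B} {A', B'} \<longleftrightarrow>
      ((A \<inter> A' = {\<zero>\<^bsub>V\<^esub>} \<or> W.submodule_sum A A' = carrier V) \<and> (A \<inter> B' = {\<zero>\<^bsub>V\<^esub>} \<or> W.submodule_sum A B' = carrier V)) \<and>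
      (B \<inter> A' = {\<zero>\<^bsub>V\<^esub>} \<or> W.submodule_sum B A' = carrier V) \<and> (B \<inter> B' = {\<zero>\<^bsub>V\<^esub>} \<or> W.submodule_sum B B' = carrier V)"
    unfolding general_position_def by simp
  have c: "A' \<inter> B = B \<inter> A'"
    by blast
  have "general_position V {A, B} {A', B'} \<longleftrightarrow> A \<inter> B' = {\<zero>\<^bsub>V\<^esub>} \<and> A' \<inter> B = {\<zero>\<^bsub>V\<^esub>}"
    unfolding gp c using e AA BB by blast
  moreover have "{A, B} \<noteq> {A', B'}" if "A \<inter> B' = {\<zero>\<^bsub>V\<^esub>}"
  proof
    assume "{A, B} = {A', B'}"
    then have "B' = B"
      using pair_inj[OF F] by simp
    then have "A = {\<zero>\<^bsub>V\<^esub>}"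
      using that A(3) by auto
    then show False
      using A(6) W.rank_zero d3 by simp
  qed
  ultimately show ?thesis
    unfolding parcs_eq using pair_flag[OF F(1)] pair_flag[OF F(2)] by blast
qed

lemma finite_pverts: "finite (pverts \<Gamma>)"
proof -
  have "pverts \<Gamma> \<subseteq> (\<lambda>(A, B). {A, B}) ` F.FL"
  proof
    fix f assume "f \<in> pverts \<Gamma>"
    then obtain A B where "f = {A, B}" "(A, B) \<in> F.FL"
      unfolding pverts_eq by (elim flag_pair)
    then show "f \<in> (\<lambda>(A, B). {A, B}) ` F.FL"
      by (metis (mono_tags, lifting) case_prod_conv imageI)
  qed
  then show ?thesis
    using F.finite_FL finite_subset by blast
qed

lemma prs_indep:
  assumes "independent_set \<Gamma> C"
  shows "F.indep (prs C)"
  unfolding F.indep_def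
proof (intro conjI allI impI)
  show "prs C \<subseteq> F.FL"
    by (auto simp: prs_def)
  fix A B A' B' assume h: "(A, B) \<in> prs C" "(A', B') \<in> prs C" "A \<inter> B' = {\<zero>\<^bsub>V\<^esub>}"
  show "A' \<inter> B \<noteq> {\<zero>\<^bsub>V\<^esub>}"
  proof
    assume "A' \<inter> B = {\<zero>\<^bsub>V\<^esub>}"
    then have "({A, B}, {A', B'}) \<in> parcs \<Gamma>"
      using h arc_iff[of A B A' B'] by (auto simp: prs_def)
    then show False
      using assms h by (auto simp: independent_set_def prs_def)
  qed
qed

lemma card_prs_le:
  assumes "finite C"
  shows "card (prs C) \<le> card C"
proof -
  have "inj_on (\<lambda>(A, B). {A, B}) (prs C)"
  proof (rule inj_onI)
    fix x y assume xy: "x \<in> prs C" "y \<in> prs C" "(case x of (A, B) \<Rightarrow> {A, B}) = (case y of (A, B) \<Rightarrow> {A, B})"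
    obtain A B A' B' where p: "x = (A, B)" "y = (A', B')"
      by (metis surj_pair)
    then have "(A, B) \<in> F.FL" "(A', B') \<in> F.FL" "{A, B} = {A', B'}"
      using xy by (auto simp: prs_def)
    then show "x = y"
      using pair_inj[of A B A' B'] unfolding p by blast
  qed
  then have "card (prs C) = card ((\<lambda>(A, B). {A, B}) ` prs C)"
    by (simp add: card_image)
  also have "\<dots> \<le> card C"
    using assms by (intro card_mono) (auto simp: prs_def)
  finally show ?thesis .
qed

lemma pencil_prs:
  assumes "point_pencil K d P \<subseteq> C"
  shows "F.pencil P \<subseteq> prs C"
proof
  fix F assume F: "F \<in> F.pencil P"
  obtain A B where AB: "F = (A, B)" "(A, B) \<in> F.FL" "P \<subseteq> A"
    using F by (auto simp: F.pencil_def)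
  have "{A, B} \<in> point_pencil K d P"
    unfolding point_pencil_eq using pair_flag[OF AB(2)] FLD(6)[OF AB(2)] AB(3) by blast
  then show "F \<in> prs C"
    using assms AB by (auto simp: prs_def)
qed

lemma dpencil_prs:
  assumes "dual_point_pencil K d H \<subseteq> C"
  shows "F.dpencil H \<subseteq> prs C"
proof
  fix F assume F: "F \<in> F.dpencil H"
  obtain A B where AB: "F = (A, B)" "(A, B) \<in> F.FL" "B \<subseteq> H"
    using F by (auto simp: F.dpencil_def)
  have "{A, B} \<in> dual_point_pencil K d H"
    unfolding dual_point_pencil_eq using pair_flag[OF AB(2)] FLD(7)[OF AB(2)] AB(3) by blast
  then show "F \<in> prs C"
    using assms AB by (auto simp: prs_def)
qed

text \<open>Classes that contain both kinds of pencil are counted with the points. The equality for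
  the cardinality doubles as the lower bound on the chromatic number, and the indexing by
  \<open>J\<close> allows colours whose extended classes coincide.\<close>

lemma cover_family:
  fixes J :: "'j set"
  assumes J: "finite J" "real (card J) \<le> qint q (d + 2) - real q"
    and max: "\<And>j. j \<in> J \<Longrightarrow> maximal_independent_set \<Gamma> (CC j)"
    and cov: "pverts \<Gamma> \<subseteq> (\<Union>j\<in>J. CC j)"
    and rho: "\<And>C. maximal_independent_set \<Gamma> C \<Longrightarrow>
      (\<exists>P \<in> subspaces_of_rank K V 1. point_pencil K d P \<subseteq> C) \<or>
      (\<exists>H \<in> subspaces_of_rank K V (2 * d). dual_point_pencil K d H \<subseteq> C) \<or>
      real (card C) \<le> F.fl / 1000000"
  shows "real (card J) = qint q (d + 2) - real q \<and>
    ((\<exists>U \<in> subspaces_of_rank K V (d + 2). \<exists>\<mu>. inj_on \<mu> J \<and>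
        (\<forall>C\<in>J. \<mu> C \<in> subspaces_of_rank K V 1 \<and> \<mu> C \<subseteq> U \<and> point_pencil K d (\<mu> C) \<subseteq> CC C)) \<or>
     (\<exists>U' \<in> subspaces_of_rank K V (d - 1). \<exists>\<mu>. inj_on \<mu> J \<and>
        (\<forall>C\<in>J. \<mu> C \<in> subspaces_of_rank K V (2 * d) \<and> U' \<subseteq> \<mu> C \<and> dual_point_pencil K d (\<mu> C) \<subseteq> CC C)))"
proof -
  define P1 where "P1 j P \<longleftrightarrow> P \<in> subspaces_of_rank K V 1 \<and> point_pencil K d P \<subseteq> CC j" for j P
  define P2 where "P2 j H \<longleftrightarrow> H \<in> subspaces_of_rank K V (2 * d) \<and> dual_point_pencil K d H \<subseteq> CC j" for j H
  define J1 where "J1 = {j \<in> J. \<exists>P. P1 j P}"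
  define J2 where "J2 = {j \<in> J - J1. \<exists>H. P2 j H}"
  define J3 where "J3 = J - J1 - J2"
  define pt where "pt j = (SOME P. P1 j P)" for j
  define hp where "hp j = (SOME H. P2 j H)" for j
  have pt: "P1 j (pt j)" if "j \<in> J1" for j
    using that unfolding J1_def pt_def by (auto intro: someI_ex)
  have hp: "P2 j (hp j)" if "j \<in> J2" for j
    using that unfolding J2_def hp_def by (auto intro: someI_ex)
  have ind: "independent_set \<Gamma> (CC j)" if "j \<in> J" for j
    using max[OF that] by (simp add: maximal_independent_set_def)
  have fins: "finite J1" "finite J2" "finite J3"
    using J by (auto simp: J1_def J2_def J3_def)
  have parts: "J = J1 \<union> (J2 \<union> J3)" "J1 \<inter> (J2 \<union> J3) = {}" "J2 \<inter> J3 = {}"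
    by (auto simp: J1_def J2_def J3_def)
  then have cards: "card J = card J1 + (card J2 + card J3)"
    using fins by (metis card_Un_disjoint finite_Un)
  interpret Q: qcover "{A. subspace K A V}" "(\<subseteq>)" "(\<inter>)" "module.submodule_sum V" "{\<zero>\<^bsub>V\<^esub>}" "carrier V" "rank K V" q d
    J1 J2 J3 "\<lambda>j. prs (CC j)" pt hp
  proof unfold_locales
    show "finite J1" "finite J2" "finite J3"
      by (fact fins)+
    show "real (card J1) + real (card J2) + real (card J3) \<le> qint q (d + 2) - real q"
      using J(2) cards by simp
    show "F.indep (prs (CC j))" if "j \<in> J1 \<union> J2" for j
      using prs_indep ind parts that by blast
    show "pt j \<in> F.lev 1" "F.pencil (pt j) \<subseteq> prs (CC j)" if "j \<in> J1" for j
      using pt[OF that] pencil_prs by (auto simp: P1_def lev_eq)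
    show "hp j \<in> F.lev (2 * d)" "F.dpencil (hp j) \<subseteq> prs (CC j)" if "j \<in> J2" for j
      using hp[OF that] dpencil_prs by (auto simp: P2_def lev_eq)
    show "finite (prs (CC j))" for j
      by (rule finite_subset[OF _ F.finite_FL]) (auto simp: prs_def)
    show "real (card (prs (CC j))) \<le> F.fl / 1000000" if j: "j \<in> J3" for j
    proof -
      have jJ: "j \<in> J" "\<not> (\<exists>P. P1 j P)" "\<not> (\<exists>H. P2 j H)"
        using j by (auto simp: J1_def J2_def J3_def)
      have "finite (CC j)"
        using ind[OF jJ(1)] finite_pverts finite_subset by (auto simp: independent_set_def)
      then have "real (card (prs (CC j))) \<le> real (card (CC j))"
        using card_prs_le by simp
      then show ?thesis
        using rho[OF max[OF jJ(1)]] jJ by (auto simp: P1_def P2_def)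
    qed
    show "F.FL \<subseteq> (\<Union>j\<in>J1 \<union> J2 \<union> J3. prs (CC j))"
    proof
      fix F assume F: "F \<in> F.FL"
      obtain A B where AB: "F = (A, B)"
        by (cases F)
      then have "{A, B} \<in> pverts \<Gamma>"
        using pair_flag F by (simp add: pverts_eq)
      then obtain j where "j \<in> J" "{A, B} \<in> CC j"
        using cov by blast
      then show "F \<in> (\<Union>j\<in>J1 \<union> J2 \<union> J3. prs (CC j))"
        using F AB parts(1) by (auto simp: prs_def)
    qed
  qed
  show ?thesis
    using Q.cover_structure
  proof
    assume "\<exists>U\<in>F.lev (d + 2). real (card J1) = qint q (d + 2) - real q \<and> J2 = {} \<and> J3 = {} \<and> inj_on pt J1 \<and> (\<forall>i\<in>J1. pt i \<subseteq> U)"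
    then obtain U where U: "U \<in> F.lev (d + 2)" "real (card J1) = qint q (d + 2) - real q" "J2 = {}" "J3 = {}"
      "inj_on pt J1" "\<forall>i\<in>J1. pt i \<subseteq> U"
      by blast
    have JJ: "J = J1"
      using parts(1) U by simp
    have "\<exists>\<mu>. inj_on \<mu> J \<and> (\<forall>C\<in>J. \<mu> C \<in> subspaces_of_rank K V 1 \<and> \<mu> C \<subseteq> U \<and> point_pencil K d (\<mu> C) \<subseteq> CC C)"
      using U pt unfolding JJ P1_def by (intro exI[of _ pt]) auto
    then show ?thesis
      using U(1,2) unfolding JJ lev_eq by blast
  next
    assume "\<exists>U\<in>F.lev (d - 1). real (card J2) = qint q (d + 2) - real q \<and> J1 = {} \<and> J3 = {} \<and> inj_on hp J2 \<and> (\<forall>i\<in>J2. U \<subseteq> hp i)"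
    then obtain U where U: "U \<in> F.lev (d - 1)" "real (card J2) = qint q (d + 2) - real q" "J1 = {}" "J3 = {}"
      "inj_on hp J2" "\<forall>i\<in>J2. U \<subseteq> hp i"
      by blast
    have JJ: "J = J2"
      using parts(1) U by simp
    have "\<exists>\<mu>. inj_on \<mu> J \<and> (\<forall>C\<in>J. \<mu> C \<in> subspaces_of_rank K V (2 * d) \<and> U \<subseteq> \<mu> C \<and> dual_point_pencil K d (\<mu> C) \<subseteq> CC C)"
      using U hp unfolding JJ P2_def by (intro exI[of _ hp]) auto
    then show ?thesis
      using U(1,2) unfolding JJ lev_eq by blast
  qed
qed

text \<open>The upper bound is \<open>F.ex_colouring\<close>. For the lower bound the classes of a
  colouring with fewer colours are extended to maximal independent sets; these cover all vertices,
  contrary to the equality in \<open>cover_family\<close>.\<close>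

lemma chromatic_number_eq:
  assumes rho: "\<And>C. maximal_independent_set \<Gamma> C \<Longrightarrow>
      (\<exists>P \<in> subspaces_of_rank K V 1. point_pencil K d P \<subseteq> C) \<or>
      (\<exists>H \<in> subspaces_of_rank K V (2 * d). dual_point_pencil K d H \<subseteq> C) \<or>
      real (card C) \<le> F.fl / 1000000"
  shows "real (chromatic_number \<Gamma>) = qint q (d + 2) - real q"
proof (rule F.ex_colouring)
  fix Kc and col :: "(nat \<Rightarrow> nat) set \<times> (nat \<Rightarrow> nat) set \<Rightarrow> (nat \<Rightarrow> nat) set"
  assume Kc: "finite Kc" "real (card Kc) = qint q (d + 2) - real q" "\<And>F. F \<in> F.FL \<Longrightarrow> col F \<in> Kc"
    and col: "\<And>A B A' B'. (A, B) \<in> F.FL \<Longrightarrow> (A', B') \<in> F.FL \<Longrightarrow> col (A, B) = col (A', B') \<Longrightarrow>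
       A \<inter> B' = {\<zero>\<^bsub>V\<^esub>} \<Longrightarrow> A' \<inter> B \<noteq> {\<zero>\<^bsub>V\<^esub>}"
  obtain h where h: "bij_betw h Kc {0..<card Kc}"
    using ex_bij_betw_finite_nat[OF Kc(1)] by blast
  define pr where "pr f = (SOME p. p \<in> F.FL \<and> f = {fst p, snd p})" for f
  have pr: "pr f \<in> F.FL \<and> f = {fst (pr f), snd (pr f)}" if f: "f \<in> pverts \<Gamma>" for f
  proof -
    have "\<exists>p. p \<in> F.FL \<and> f = {fst p, snd p}"
      using f unfolding pverts_eq by (elim flag_pair) auto
    then show ?thesis
      unfolding pr_def by (rule someI_ex)
  qed
  define c where "c f = h (col (pr f))" for f
  have "proper_coloring \<Gamma> (card Kc) c"
    unfolding proper_coloring_def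
  proof
    show "c ` pverts \<Gamma> \<subseteq> {..<card Kc}"
    proof
      fix k assume "k \<in> c ` pverts \<Gamma>"
      then obtain f where f: "f \<in> pverts \<Gamma>" "k = c f"
        by blast
      then have "col (pr f) \<in> Kc"
        using pr[OF f(1)] Kc(3) by blast
      then have "k \<in> {0..<card Kc}"
        using bij_betwE[OF h] f(2) unfolding c_def by blast
      then show "k \<in> {..<card Kc}"
        by simp
    qed
    show "\<forall>(f, g)\<in>parcs \<Gamma>. c f \<noteq> c g"
    proof safe
      fix f g assume fg: "(f, g) \<in> parcs \<Gamma>" "c f = c g"
      have v: "f \<in> pverts \<Gamma>" "g \<in> pverts \<Gamma>"
        using fg(1) unfolding parcs_eq pverts_eq by blast+
      obtain A B A' B' where p: "pr f = (A, B)" "pr g = (A', B')"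
        by (metis surj_pair)
      have F: "(A, B) \<in> F.FL" "(A', B') \<in> F.FL" "f = {A, B}" "g = {A', B'}"
        using pr[OF v(1)] pr[OF v(2)] p by auto
      have "col (A, B) = col (A', B')"
        using fg(2) bij_betw_imp_inj_on[OF h] Kc(3)[OF F(1)] Kc(3)[OF F(2)] by (auto simp: c_def p dest: inj_onD)
      then show False
        using col[OF F(1,2)] fg(1) arc_iff[OF F(1,2)] unfolding F(3,4) by blast
    qed
  qed
  moreover have "card Kc \<le> k" if "proper_coloring \<Gamma> k c" for k c
  proof (rule ccontr)
    assume less: "\<not> card Kc \<le> k"
    have pc: "c ` pverts \<Gamma> \<subseteq> {..<k}" "\<And>f g. (f, g) \<in> parcs \<Gamma> \<Longrightarrow> c f \<noteq> c g"
      using that by (auto simp: proper_coloring_def)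
    have ex: "\<exists>T. maximal_independent_set \<Gamma> T \<and> {f \<in> pverts \<Gamma>. c f = j} \<subseteq> T" for j
    proof -
      \<comment> \<open>For a colour that does not occur this is the empty set, which is extended
        like the others.\<close>
      have "independent_set \<Gamma> {f \<in> pverts \<Gamma>. c f = j}"
        unfolding independent_set_def using pc(2) by blast
      then show ?thesis
        by (rule ex_maximal_independent[OF finite_pverts]) blast
    qed
    define CC where "CC j = (SOME T. maximal_independent_set \<Gamma> T \<and> {f \<in> pverts \<Gamma>. c f = j} \<subseteq> T)" for j
    have CC: "maximal_independent_set \<Gamma> (CC j)" "{f \<in> pverts \<Gamma>. c f = j} \<subseteq> CC j" for j
      using someI_ex[OF ex[of j]] unfolding CC_def by auto
    have "real k \<le> qint q (d + 2) - real q"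
      using less Kc(2) by linarith
    then have le: "real (card {..<k}) \<le> qint q (d + 2) - real q"
      by simp
    have cov: "pverts \<Gamma> \<subseteq> (\<Union>j\<in>{..<k}. CC j)"
    proof
      fix f assume f: "f \<in> pverts \<Gamma>"
      then have "c f \<in> {..<k}" "f \<in> CC (c f)"
        using pc(1) CC(2)[of "c f"] by blast+
      then show "f \<in> (\<Union>j\<in>{..<k}. CC j)"
        by blast
    qed
    have "real (card {..<k}) = qint q (d + 2) - real q"
      by (rule cover_family[OF finite_lessThan le CC(1) cov rho, THEN conjunct1])
    then show False
      using less Kc(2) by simp
  qed
  ultimately have "chromatic_number \<Gamma> = card Kc"
    unfolding chromatic_number_def by (intro Least_equality) blast+
  then show ?thesis
    using Kc(2) by simp
qed

end

theorem theorem1p2: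
  fixes d :: nat and \<rho> \<alpha> :: int and q :: nat and K :: "nat ring"
  assumes d: "d \<ge> 3"
    and rho: "\<forall>q' K'. primepow q' \<and> is_GF q' K' \<longrightarrow>
      (\<forall>C. maximal_independent_set (kneser_graph K' (2 * d + 1) {d, d + 1}) C \<longrightarrow>
        (\<exists>P \<in> subspaces_of_rank K' (coord_space K' (2 * d + 1)) 1. point_pencil K' d P \<subseteq> C) \<or>
        (\<exists>H \<in> subspaces_of_rank K' (coord_space K' (2 * d + 1)) (2 * d).
           dual_point_pencil K' d H \<subseteq> C) \<or>
        int (card C) \<le> \<rho> * int q' ^ (d\<^sup>2 + d - 2))"
    and alpha: "\<alpha> = max 5 \<rho>"
    and q: "primepow q"
    and K: "is_GF q K"
    and q_large1: "real q > 3 * 112 ^ (2 ^ (d + 1) - 1) * (1 / 2 ^ (d + 1))"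
    and q_large2: "real q \<ge> 3 / 2 * (real_of_int \<alpha>)\<^sup>2 + 21 / 2 * real_of_int \<alpha> + 17"
  shows "real (chromatic_number (kneser_graph K (2 * d + 1) {d, d + 1}))
           = (real q ^ (d + 2) - 1) / (real q - 1) - real q
    \<and> (\<forall>\<F>. (\<forall>C\<in>\<F>. maximal_independent_set (kneser_graph K (2 * d + 1) {d, d + 1}) C) \<and>
            real (card \<F>) = (real q ^ (d + 2) - 1) / (real q - 1) - real q \<and>
            \<Union>\<F> = pverts (kneser_graph K (2 * d + 1) {d, d + 1}) \<longrightarrow>
         (\<exists>U \<in> subspaces_of_rank K (coord_space K (2 * d + 1)) (d + 2). \<exists>\<mu>.
            inj_on \<mu> \<F> \<and>
            (\<forall>C\<in>\<F>. \<mu> C \<in> subspaces_of_rank K (coord_space K (2 * d + 1)) 1 \<and> \<mu> C \<subseteq> U \<and>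
                     point_pencil K d (\<mu> C) \<subseteq> C)) \<or>
         (\<exists>U' \<in> subspaces_of_rank K (coord_space K (2 * d + 1)) (d - 1). \<exists>\<mu>.
            inj_on \<mu> \<F> \<and>
            (\<forall>C\<in>\<F>. \<mu> C \<in> subspaces_of_rank K (coord_space K (2 * d + 1)) (2 * d) \<and> U' \<subseteq> \<mu> C \<and>
                     dual_point_pencil K d (\<mu> C) \<subseteq> C)))"
proof -
  define V where "V = coord_space K (2 * d + 1)"
  define \<Gamma> where "\<Gamma> = kneser_graph K (2 * d + 1) {d, d + 1}"
  interpret gf_flags q d K V \<Gamma>
    by unfold_locales (rule K, rule d, rule Kneser_bound_arith[OF d q_large1], rule V_def, rule \<Gamma>_def)
  have q16: "10000000000000000 \<le> real q"
    by (rule F.q_ge(1))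
  have chi: "(real q ^ (d + 2) - 1) / (real q - 1) - real q = qint q (d + 2) - real q"
    using qint_closed[of q "d + 2"] q16 by (simp add: field_simps)
  have small: "real (card C) \<le> F.fl / 1000000" if "int (card C) \<le> \<rho> * int q ^ (d\<^sup>2 + d - 2)" for C :: "(nat \<Rightarrow> nat) set set set"
  proof -
    have "real_of_int \<rho> * 1000000 \<le> real_of_int \<alpha> * 1000000"
      by (simp add: alpha)
    also have "\<dots> \<le> real q"
      by (rule small_set_arith[OF q16 q_large2])
    finally have r: "real_of_int \<rho> \<le> real q / 1000000"
      by simp
    have "real_of_int (int (card C)) \<le> real_of_int (\<rho> * int q ^ (d\<^sup>2 + d - 2))"
      using that by (simp only: of_int_le_iff)
    then have "real (card C) \<le> real_of_int \<rho> * real q ^ (d\<^sup>2 + d - 2)"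
      by simp
    also have "\<dots> \<le> real q / 1000000 * real q ^ (d\<^sup>2 + d - 2)"
      using r by (rule mult_right_mono) simp
    also have "\<dots> = real q ^ Suc (d\<^sup>2 + d - 2) / 1000000"
      by simp
    \<comment> \<open>The size allowed by the hypothesis is one power of q below the order of a
      pencil. That factor q pays for \<rho> and for the denominator 10^6; on the right stand the
      exponents of the lower bounds for \<open>G\<close> and [2 d].\<close>
    also have "Suc (d\<^sup>2 + d - 2) = d * (d - 1) + (2 * d - 1)"
    proof -
      obtain m where m: "d = Suc (Suc (Suc m))"
        by (rule F.d_Suc)
      show ?thesis
        unfolding m by (simp add: power2_eq_square)
    qed
    also have "real q ^ (d * (d - 1) + (2 * d - 1)) \<le> F.fl"
    proof -
      have "Suc (2 * d - 1) = 2 * d"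
        using d by simp
      then have "real q ^ (2 * d - 1) \<le> qint q (2 * d)"
        using qint_ge_power[of q "2 * d - 1"] by metis
      then show ?thesis
        unfolding F.fl_def power_add using F.G_ge F.G_pos by (intro mult_mono) auto
    qed
    finally show ?thesis
      by simp
  qed
  have rho': "(\<exists>P \<in> subspaces_of_rank K V 1. point_pencil K d P \<subseteq> C) \<or>
      (\<exists>H \<in> subspaces_of_rank K V (2 * d). dual_point_pencil K d H \<subseteq> C) \<or>
      real (card C) \<le> F.fl / 1000000" if "maximal_independent_set \<Gamma> C" for C
    using rho q K that small unfolding V_def \<Gamma>_def by blast
  show ?thesis
    unfolding chi V_def[symmetric] \<Gamma>_def[symmetric]
  proof (intro conjI allI impI)
    show "real (chromatic_number \<Gamma>) = qint q (d + 2) - real q"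
      by (rule chromatic_number_eq[OF rho'])
    fix \<F>
    assume F: "(\<forall>C\<in>\<F>. maximal_independent_set \<Gamma> C) \<and> real (card \<F>) = qint q (d + 2) - real q \<and> \<Union>\<F> = pverts \<Gamma>"
    have "0 < qint q (d + 2) - real q"
    proof -
      have "real q ^ 1 < real q ^ (d + 1)"
        using d q16 by (intro power_strict_increasing) auto
      moreover have "real q ^ (d + 1) \<le> qint q (d + 2)"
        using qint_ge_power[of q "d + 1"] by simp
      ultimately show ?thesis
        by (simp only: power_one_right)
    qed
    \<comment> \<open>An infinite set would have cardinality 0 by convention, so the positive number
      of classes yields finiteness.\<close>
    then have "finite \<F>"
      using F by (metis card.infinite less_irrefl of_nat_0)
    then show "(\<exists>U \<in> subspaces_of_rank K V (d + 2). \<exists>\<mu>. inj_on \<mu> \<F> \<and>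
        (\<forall>C\<in>\<F>. \<mu> C \<in> subspaces_of_rank K V 1 \<and> \<mu> C \<subseteq> U \<and> point_pencil K d (\<mu> C) \<subseteq> C)) \<or>
       (\<exists>U' \<in> subspaces_of_rank K V (d - 1). \<exists>\<mu>. inj_on \<mu> \<F> \<and>
        (\<forall>C\<in>\<F>. \<mu> C \<in> subspaces_of_rank K V (2 * d) \<and> U' \<subseteq> \<mu> C \<and> dual_point_pencil K d (\<mu> C) \<subseteq> C))"
      using cover_family[of \<F> "\<lambda>C. C"] F rho' by auto
  qed
qed

end
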